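(* Let $d\ge1$ be an integer, and let $0<\beta_{0,t}<\beta_{1,t}<\infty$, $t=0,\dots,d$, be constants such that $\beta_{0,0}<\phi<\beta_{1,0}$ and $\beta_{0,t}<\theta_t<\beta_{1,t}$, $t=1,\dots,d$. Let $\tilde X_n\sim N_{n^d}(0,\Sigma_{\phi,\theta_1,\dots,\theta_d;n})$, let $(\tilde\theta_1,\dots,\tilde\theta_d)\in\prod_{t=1}^d(\beta_{0,t},\beta_{1,t})$ be an arbitrary fixed vector, and define $$\hat\phi_{\tilde\theta_1,\dots,\tilde\theta_d}=\left\{\frac{2^d\tilde\theta_1^3\cdots\tilde\theta_d^3}{\pi^dn^d}\,\tilde X_n'\left(\bigotimes_{t=1}^dR_{\tilde\theta_t,n}\right)^{-1}\tilde X_n\right\}^{1/d}.$$ Then $$\frac{2^d\tilde\theta_1^3\cdots\tilde\theta_d^3}{\pi^dn^d}E\left[\tilde X_n'\left(\bigotimes_{t=1}^dR_{\tilde\theta_t,n}\right)^{-1}\tilde X_n\right]=\phi^d+O(n^{-1}),$$ $$\mathrm{Var}\left\{\frac{2^d\tilde\theta_1^3\cdots\tilde\theta_d^3}{\pi^dn^d}\tilde X_n'\left(\bigotimes_{t=1}^dR_{\tilde\theta_t,n}\right)^{-1}\tilde X_n\right\}=O(n^{-d}),$$ as $n\to\infty$. Consequently, $\hat\phi_{\tilde\theta_1,\dots,\tilde\theta_d}\to\phi$ in probability as $n\to\infty$.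
   Context: For $\theta>0$ and a positive integer $n$, $R_{\theta,n}$ is the $n\times n$ matrix with $(i,j)$th element $(1+\theta|i-j|/n)e^{-\theta|i-j|/n}$, and $$\Sigma_{\phi,\theta_1,\dots,\theta_d;n}=\frac{\pi^d\phi^d}{2^d\theta_1^3\cdots\theta_d^3}\bigotimes_{t=1}^dR_{\theta_t,n}$$ ($\otimes$ = Kronecker product, $'$ = transpose). $\tilde X_n$ is the lexicographically ordered vector of observations $X(i_1/n,\dots,i_d/n)$, $1\le i_t\le n$, of a mean-zero Gaussian random field $X$ on $[0,1]^d$ with $\mathrm{Cov}(X(x),X(y))=\frac{\pi^d\phi^d}{2^d\theta_1^3\cdots\theta_d^3}\prod_{t=1}^d(1+\theta_t|x_t-y_t|)e^{-\theta_t|x_t-y_t|}$. Expectation, variance and convergence in probability are under the true parameters $(\phi,\theta_1,\dots,\theta_d)$. ($\hat\phi_{\tilde\theta_1,\dots,\tilde\theta_d}$ is the value of $\phi$ maximizing the Gaussian likelihood when the correlation parameters are set to $\tilde\theta_1,\dots,\tilde\theta_d$.) *)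

theory Defs
  imports
    "HOL-Probability.Probability"
    "HOL-Library.Landau_Symbols"
    "Jordan_Normal_Form.Gauss_Jordan_Elimination"
begin

definition kron :: "real mat \<Rightarrow> real mat \<Rightarrow> real mat" where
  "kron A B = mat (dim_row A * dim_row B) (dim_col A * dim_col B)
     (\<lambda>(i, j). A $$ (i div dim_row B, j div dim_col B) * B $$ (i mod dim_row B, j mod dim_col B))"

(* The factors are indexed from 1: kron_upto F d is the Kronecker product of F 1, ..., F d, in this order. *)
primrec kron_upto :: "(nat \<Rightarrow> real mat) \<Rightarrow> nat \<Rightarrow> real mat" where
  "kron_upto F 0 = 1\<^sub>m 1"
| "kron_upto F (Suc d) = kron (kron_upto F d) (F (Suc d))"

(* Unspecified (not zero) when A is singular. *)
definition inv_mat :: "real mat \<Rightarrow> real mat" where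
  "inv_mat A = the (mat_inverse A)"

(* Indices run over 0..n-1; the entries depend only on the difference of the indices. *)
definition corr_mat :: "real \<Rightarrow> nat \<Rightarrow> real mat" where
  "corr_mat \<theta> n = mat n n (\<lambda>(i, j).
     (1 + \<theta> * \<bar>real i - real j\<bar> / real n) * exp (- \<theta> * \<bar>real i - real j\<bar> / real n))"

definition corr_kron :: "nat \<Rightarrow> (nat \<Rightarrow> real) \<Rightarrow> nat \<Rightarrow> real mat" where
  "corr_kron d \<theta> n = kron_upto (\<lambda>t. corr_mat (\<theta> t) n) d"

definition cov_mat :: "nat \<Rightarrow> real \<Rightarrow> (nat \<Rightarrow> real) \<Rightarrow> nat \<Rightarrow> real mat" where
  "cov_mat d \<phi> \<theta> n = (pi ^ d * \<phi> ^ d / (2 ^ d * (\<Prod>t=1..d. \<theta> t ^ 3))) \<cdot>\<^sub>m corr_kron d \<theta> n"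

(* The law N(m, v) on the reals, for v = 0 the point mass at m. *)
definition normal_rv :: "'a measure \<Rightarrow> ('a \<Rightarrow> real) \<Rightarrow> real \<Rightarrow> real \<Rightarrow> bool" where
  "normal_rv M Y m v \<longleftrightarrow>
     (v > 0 \<and> distributed M lborel Y (\<lambda>x. ennreal (normal_density m (sqrt v) x))) \<or>
     (v = 0 \<and> Y \<in> borel_measurable M \<and> (AE \<omega> in M. Y \<omega> = m))"

(* X has the law N_k(\<mu>, S): every linear combination a'X is univariate normal with mean a'\<mu>
   and variance a'Sa. *)
definition multivariate_normal ::
  "'a measure \<Rightarrow> ('a \<Rightarrow> real Matrix.vec) \<Rightarrow> nat \<Rightarrow> real Matrix.vec \<Rightarrow> real mat \<Rightarrow> bool" where
  "multivariate_normal M X k \<mu> S \<longleftrightarrow>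
     \<mu> \<in> carrier_vec k \<and> S \<in> carrier_mat k k \<and> S\<^sup>T = S \<and>
     (\<forall>\<omega>\<in>space M. X \<omega> \<in> carrier_vec k) \<and>
     (\<forall>a\<in>carrier_vec k.
        normal_rv M (\<lambda>\<omega>. scalar_prod a (X \<omega>)) (scalar_prod a \<mu>) (scalar_prod a (S *\<^sub>v a)))"

definition quad_stat :: "nat \<Rightarrow> (nat \<Rightarrow> real) \<Rightarrow> nat \<Rightarrow> real Matrix.vec \<Rightarrow> real" where
  "quad_stat d \<theta> n x = scalar_prod x (inv_mat (corr_kron d \<theta> n) *\<^sub>v x)"

definition quad_coeff :: "nat \<Rightarrow> (nat \<Rightarrow> real) \<Rightarrow> nat \<Rightarrow> real" where
  "quad_coeff d \<theta> n = 2 ^ d * (\<Prod>t=1..d. \<theta> t ^ 3) / (pi ^ d * real n ^ d)"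

definition phi_hat :: "nat \<Rightarrow> (nat \<Rightarrow> real) \<Rightarrow> nat \<Rightarrow> real Matrix.vec \<Rightarrow> real" where
  "phi_hat d \<theta> n x = root d (quad_coeff d \<theta> n * quad_stat d \<theta> n x)"

definition tendsto_in_prob :: "'a measure \<Rightarrow> (nat \<Rightarrow> 'a \<Rightarrow> real) \<Rightarrow> real \<Rightarrow> bool" where
  "tendsto_in_prob M Y c \<longleftrightarrow>
     (\<forall>\<epsilon>>0. (\<lambda>n. measure M {\<omega> \<in> space M. \<bar>Y n \<omega> - c\<bar> > \<epsilon>}) \<longlonglongrightarrow> 0)"

lemma dim_kron_upto:
  assumes "\<And>t. t \<in> {1..d} \<Longrightarrow> F t \<in> carrier_mat n n"
  shows "kron_upto F d \<in> carrier_mat (n ^ d) (n ^ d)"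
  using assms
proof (induction d)
  case 0
  then show ?case by simp
next
  case (Suc d)
  have c: "kron_upto F d \<in> carrier_mat (n ^ d) (n ^ d)" using Suc by auto
  have f: "F (Suc d) \<in> carrier_mat n n" using Suc.prems by auto
  show ?case using carrier_matD[OF c] carrier_matD[OF f]
    by (auto simp: kron_def mult.commute)
qed

lemma kron_upto_index:
  assumes "\<And>t. t \<in> {1..d} \<Longrightarrow> F t \<in> carrier_mat n n" "k < n ^ d" "l < n ^ d"
  shows "kron_upto F d $$ (k, l) =
    (\<Prod>t=1..d. F t $$ (k div n ^ (d - t) mod n, l div n ^ (d - t) mod n))"
  using assms
proof (induction d arbitrary: k l)
  case 0
  then show ?case by simp
next
  case (Suc d)
  have c: "kron_upto F d \<in> carrier_mat (n ^ d) (n ^ d)"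
    using Suc.prems by (intro dim_kron_upto) auto
  have f: "F (Suc d) \<in> carrier_mat n n" using Suc.prems by auto
  have b: "k div n < n ^ d" "l div n < n ^ d"
    using Suc.prems by (auto simp: less_mult_imp_div_less mult.commute)
  have "kron_upto F (Suc d) $$ (k, l) =
      kron_upto F d $$ (k div n, l div n) * F (Suc d) $$ (k mod n, l mod n)"
    using carrier_matD[OF c] carrier_matD[OF f] Suc.prems(2,3) by (auto simp: kron_def mult.commute)
  also have "kron_upto F d $$ (k div n, l div n) =
      (\<Prod>t=1..d. F t $$ (k div n div n ^ (d - t) mod n, l div n div n ^ (d - t) mod n))"
    using Suc.prems b by (intro Suc.IH) auto
  also have "\<dots> = (\<Prod>t=1..d. F t $$ (k div n ^ (Suc d - t) mod n, l div n ^ (Suc d - t) mod n))"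
    by (intro prod.cong) (auto simp: div_mult2_eq Suc_diff_le)
  finally show ?case by simp
qed

(* Coordinate t of the k-th point (k counted from 0) of the grid {1/n, ..., n/n}^d in
   lexicographic order. *)
definition grid_point :: "nat \<Rightarrow> nat \<Rightarrow> nat \<Rightarrow> nat \<Rightarrow> real" where
  "grid_point d n k t = real (k div n ^ (d - t) mod n + 1) / real n"

(* cov_mat is the covariance matrix of the lexicographically ordered observations. *)
lemma cov_mat_index:
  assumes "n \<ge> 1" "k < n ^ d" "l < n ^ d"
  shows "cov_mat d \<phi> \<theta> n $$ (k, l) =
    pi ^ d * \<phi> ^ d / (2 ^ d * (\<Prod>t=1..d. \<theta> t ^ 3)) *
    (\<Prod>t=1..d. (1 + \<theta> t * \<bar>grid_point d n k t - grid_point d n l t\<bar>) *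
       exp (- \<theta> t * \<bar>grid_point d n k t - grid_point d n l t\<bar>))"
proof -
  have c: "corr_kron d \<theta> n \<in> carrier_mat (n ^ d) (n ^ d)"
    unfolding corr_kron_def by (intro dim_kron_upto) (auto simp: corr_mat_def)
  have d: "\<bar>grid_point d n k t - grid_point d n l t\<bar> =
      \<bar>real (k div n ^ (d - t) mod n) - real (l div n ^ (d - t) mod n)\<bar> / real n" for t
    using assms by (simp add: grid_point_def diff_divide_distrib[symmetric] abs_divide)
  have "corr_kron d \<theta> n $$ (k, l) =
      (\<Prod>t=1..d. corr_mat (\<theta> t) n $$ (k div n ^ (d - t) mod n, l div n ^ (d - t) mod n))"
    unfolding corr_kron_def using assms by (intro kron_upto_index) (auto simp: corr_mat_def)
  then show ?thesis
    using c assms by (auto simp: cov_mat_def d corr_mat_def intro!: prod.cong)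
qed

end

theory Submission
  imports Defs "Jordan_Normal_Form.Determinant" "HOL-Real_Asymp.Real_Asymp"
begin

text \<open>
  Let \<open>\<Sigma>\<close> be the covariance matrix of the data and \<open>Q\<close> the inverse of the Kronecker product of the
  matrices \<open>R a = corr_mat a n\<close> for the assumed parameters. The quadratic form of a centred Gaussian
  vector has mean \<open>tr (Q \<Sigma>)\<close> and variance \<open>2 tr ((Q \<Sigma>)\<^sup>2)\<close> (\<open>quadratic_form_expectation_variance\<close>).
  Inverses, products and traces respect Kronecker products, so both numbers are products over the
  coordinates, and the theorem reduces to two facts about one coordinate with true parameter \<open>b\<close> and
  assumed parameter \<open>a\<close> (\<open>corr_mat_trace_bounds\<close>):
  \<open>tr ((R a)\<^sup>-\<^sup>1 R b) = n b\<^sup>3 / a\<^sup>3 + O(1)\<close> and \<open>tr (((R a)\<^sup>-\<^sup>1 R b)\<^sup>2) = O(n)\<close>.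

  For one coordinate put \<open>S a = R a / a\<^sup>3\<close> and \<open>\<rho> = exp (- a / n)\<close>. The filtered differences
  \<open>x i - 2 \<rho> x (i - 1) + \<rho>\<^sup>2 x (i - 2)\<close> of the sampled process form a moving average of order one.
  With rows of suitable scale the filter is a lower triangular matrix \<open>L a\<close> for which
  \<open>Z a = L a S a (L a)\<^sup>T\<close> is tridiagonal (\<open>whitened_covariance\<close>). Up to \<open>O(1 / n)\<close> the entries of
  \<open>Z a\<close> outside a corner of fixed size are \<open>8/3\<close> and \<open>2/3\<close>, whatever \<open>a\<close> is. So \<open>Z a\<close> is strictly
  diagonally dominant and \<open>(Z a)\<^sup>-\<^sup>1\<close> is bounded uniformly in \<open>n\<close>, and \<open>Z b - Z a\<close> has a bounded
  sum of absolute entries and bounded Frobenius norm.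

  The two filters differ little: \<open>L a (L b)\<^sup>-\<^sup>1 = 1 + K\<close> where \<open>K\<close> has zero diagonal and, its entries being
  mostly of order \<open>1 / n\<close>, bounded Frobenius norm (\<open>filter_change_mat_frobenius\<close>). Hence
  \<open>tr ((S a)\<^sup>-\<^sup>1 S b) = tr ((Z a)\<^sup>-\<^sup>1 (1 + K) Z b (1 + K)\<^sup>T)\<close>. The term without \<open>K\<close> is \<open>n + O(1)\<close>. The terms
  linear in \<open>K\<close> would be \<open>2 tr K = 0\<close> if \<open>Z a\<close> and \<open>Z b\<close> were equal, and they deviate from this by the trace of
  a product of two matrices of bounded Frobenius norm, as does the quadratic term from \<open>0\<close>
  (\<open>trace_inverse_congruence\<close>). Consistency follows from Chebyshev's inequality and the continuity
  of the \<open>d\<close>-th root.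
\<close>

(* The sign $ is kept for the entries of Matrix.vec only: with a second meaning, a formula with
   several entries would have exponentially many parses. *)
unbundle no vec_syntax

section \<open>Norms and traces of real matrices\<close>

definition mat_trace :: "real mat \<Rightarrow> real" where
  "mat_trace A = (\<Sum>i<dim_row A. A $$ (i, i))"

definition frobenius :: "real mat \<Rightarrow> real" where
  "frobenius A = L2_set (\<lambda>p. A $$ p) ({..<dim_row A} \<times> {..<dim_col A})"

definition vec_norm2 :: "real Matrix.vec \<Rightarrow> real" where
  "vec_norm2 v = L2_set (\<lambda>i. v $ i) {..<dim_vec v}"

definition op_bound :: "real mat \<Rightarrow> real \<Rightarrow> bool" where
  "op_bound A c \<longleftrightarrow> (\<forall>v\<in>carrier_vec (dim_col A). vec_norm2 (A *\<^sub>v v) \<le> c * vec_norm2 v)"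

lemma mat_mult_entry:
  assumes "A \<in> carrier_mat n k" "B \<in> carrier_mat k m" "i < n" "j < m"
  shows "(A * B) $$ (i, j) = (\<Sum>l<k. A $$ (i, l) * B $$ (l, j))"
  using assms by (auto simp: scalar_prod_def lessThan_atLeast0)

lemma mult_mat_vec_entry:
  assumes "A \<in> carrier_mat n k" "v \<in> carrier_vec k" "i < n"
  shows "(A *\<^sub>v v) $ i = (\<Sum>l<k. A $$ (i, l) * v $ l)"
  using assms by (auto simp: scalar_prod_def lessThan_atLeast0)

lemma mat_trace_mult:
  assumes "A \<in> carrier_mat n k" "B \<in> carrier_mat k n"
  shows "mat_trace (A * B) = (\<Sum>i<n. \<Sum>j<k. A $$ (i, j) * B $$ (j, i))"
  using assms mat_mult_entry[OF assms] by (simp add: mat_trace_def)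

lemma mat_trace_comm:
  assumes "A \<in> carrier_mat n k" "B \<in> carrier_mat k n"
  shows "mat_trace (A * B) = mat_trace (B * A)"
  unfolding mat_trace_mult[OF assms] mat_trace_mult[OF assms(2,1)]
  by (subst sum.swap) (simp add: mult.commute)

lemma mat_trace_transpose: "A \<in> carrier_mat n n \<Longrightarrow> mat_trace (A\<^sup>T) = mat_trace A"
  by (simp add: mat_trace_def)

lemma mat_trace_add:
  "A \<in> carrier_mat n n \<Longrightarrow> B \<in> carrier_mat n n \<Longrightarrow> mat_trace (A + B) = mat_trace A + mat_trace B"
  by (simp add: mat_trace_def sum.distrib)

lemma mat_trace_smult: "A \<in> carrier_mat n n \<Longrightarrow> mat_trace (c \<cdot>\<^sub>m A) = c * mat_trace A"
  by (simp add: mat_trace_def sum_distrib_left)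

lemma mat_trace_one [simp]: "mat_trace (1\<^sub>m n) = real n"
  by (simp add: mat_trace_def)

lemma frobenius_nonneg [simp]: "0 \<le> frobenius A"
  by (simp add: frobenius_def)

lemma vec_norm2_nonneg [simp]: "0 \<le> vec_norm2 v"
  by (simp add: vec_norm2_def)

lemma frobenius_power2:
  "A \<in> carrier_mat n m \<Longrightarrow> (frobenius A)\<^sup>2 = (\<Sum>i<n. \<Sum>j<m. (A $$ (i, j))\<^sup>2)"
  by (simp add: frobenius_def L2_set_def sum_nonneg sum.cartesian_product case_prod_beta)

lemma vec_norm2_power2: "v \<in> carrier_vec n \<Longrightarrow> (vec_norm2 v)\<^sup>2 = (\<Sum>i<n. (v $ i)\<^sup>2)"
  by (simp add: vec_norm2_def L2_set_def sum_nonneg)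

lemma frobenius_power2_columns:
  assumes "A \<in> carrier_mat n m"
  shows "(frobenius A)\<^sup>2 = (\<Sum>j<m. (vec_norm2 (col A j))\<^sup>2)"
proof -
  have "(\<Sum>j<m. (vec_norm2 (col A j))\<^sup>2) = (\<Sum>j<m. \<Sum>i<n. (A $$ (i, j))\<^sup>2)"
    using assms by (intro sum.cong refl, subst vec_norm2_power2[where n = n]) auto
  then show ?thesis using assms by (simp add: frobenius_power2 sum.swap[of _ "{..<m}"])
qed

lemma frobenius_transpose:
  assumes "A \<in> carrier_mat n m"
  shows "frobenius (A\<^sup>T) = frobenius A"
proof -
  have "(frobenius (A\<^sup>T))\<^sup>2 = (frobenius A)\<^sup>2"
    using assms by (subst (1 2) frobenius_power2) (auto simp: sum.swap[of _ "{..<m}"])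
  then show ?thesis by simp
qed

lemma frobenius_triangle:
  assumes "A \<in> carrier_mat n m" "B \<in> carrier_mat n m"
  shows "frobenius (A + B) \<le> frobenius A + frobenius B"
proof -
  have "frobenius (A + B) = L2_set (\<lambda>p. A $$ p + B $$ p) ({..<n} \<times> {..<m})"
    unfolding frobenius_def using assms by (intro L2_set_cong) auto
  then show ?thesis using assms L2_set_triangle_ineq by (auto simp: frobenius_def)
qed

lemma frobenius_one: "frobenius (1\<^sub>m n) = sqrt (real n)"
proof -
  have "(frobenius (1\<^sub>m n))\<^sup>2 = (\<Sum>i<n. \<Sum>j<n. (1\<^sub>m n $$ (i, j))\<^sup>2)" by (rule frobenius_power2) simp
  also have "\<dots> = (\<Sum>i<n. \<Sum>j<n. if i = j then 1 else 0)" by (intro sum.cong refl) auto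
  also have "\<dots> = real n" by simp
  finally show ?thesis by (metis frobenius_nonneg real_sqrt_unique)
qed

lemma abs_mat_trace_mult_le:
  assumes "A \<in> carrier_mat n m" "B \<in> carrier_mat m n"
  shows "\<bar>mat_trace (A * B)\<bar> \<le> frobenius A * frobenius B"
proof -
  have "\<bar>mat_trace (A * B)\<bar> = \<bar>\<Sum>p\<in>{..<n} \<times> {..<m}. A $$ p * B\<^sup>T $$ p\<bar>"
    using assms unfolding mat_trace_mult[OF assms] sum.cartesian_product
    by (intro arg_cong[of _ _ abs] sum.cong) auto
  also have "\<dots> \<le> (\<Sum>p\<in>{..<n} \<times> {..<m}. \<bar>A $$ p\<bar> * \<bar>B\<^sup>T $$ p\<bar>)"
    by (rule order_trans[OF sum_abs]) (simp add: abs_mult)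
  also have "\<dots> \<le> frobenius A * frobenius (B\<^sup>T)"
    using L2_set_mult_ineq[of "\<lambda>p. A $$ p" "\<lambda>p. B\<^sup>T $$ p" "{..<n} \<times> {..<m}"] assms by (simp add: frobenius_def)
  finally show ?thesis using assms by (simp add: frobenius_transpose)
qed

lemma op_boundD:
  "op_bound A c \<Longrightarrow> A \<in> carrier_mat n m \<Longrightarrow> v \<in> carrier_vec m \<Longrightarrow> vec_norm2 (A *\<^sub>v v) \<le> c * vec_norm2 v"
  by (simp add: op_bound_def)

text \<open>
  A product is controlled by one operator norm and one Frobenius norm, since left multiplication acts
  on the columns separately. This is what keeps traces of products of several \<open>n \<times> n\<close> matrices bounded
  when only some of the factors are small.
\<close>
lemma frobenius_mult_le:
  assumes A: "A \<in> carrier_mat n k" and B: "B \<in> carrier_mat k m" and c: "op_bound A c" "0 \<le> c"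
  shows "frobenius (A * B) \<le> c * frobenius B"
proof (rule power2_le_imp_le)
  have "(frobenius (A * B))\<^sup>2 = (\<Sum>j<m. (vec_norm2 (A *\<^sub>v col B j))\<^sup>2)"
    using A B frobenius_power2_columns[of "A * B" n m] by (simp del: col_mult add: col_mult2)
  also have "\<dots> \<le> (\<Sum>j<m. (c * vec_norm2 (col B j))\<^sup>2)"
    using A B op_boundD[OF c(1) A] by (intro sum_mono power_mono) auto
  also have "\<dots> = (c * frobenius B)\<^sup>2"
    using frobenius_power2_columns[OF B] by (simp add: power_mult_distrib sum_distrib_left)
  finally show "(frobenius (A * B))\<^sup>2 \<le> (c * frobenius B)\<^sup>2" .
qed (use c in simp)

lemma vec_norm2_triangle:
  assumes "v \<in> carrier_vec n" "w \<in> carrier_vec n"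
  shows "vec_norm2 (v + w) \<le> vec_norm2 v + vec_norm2 w"
proof -
  have "vec_norm2 (v + w) = L2_set (\<lambda>i. v $ i + w $ i) {..<n}"
    unfolding vec_norm2_def using assms by (intro L2_set_cong) auto
  then show ?thesis using assms L2_set_triangle_ineq by (auto simp: vec_norm2_def)
qed

lemma abs_scalar_prod_le:
  assumes "v \<in> carrier_vec n" "w \<in> carrier_vec n"
  shows "\<bar>v \<bullet> w\<bar> \<le> vec_norm2 v * vec_norm2 w"
proof -
  have "\<bar>v \<bullet> w\<bar> \<le> (\<Sum>i<n. \<bar>v $ i\<bar> * \<bar>w $ i\<bar>)"
    using assms unfolding scalar_prod_def lessThan_atLeast0[symmetric]
    by (auto simp flip: abs_mult)
  then show ?thesis using L2_set_mult_ineq[of "\<lambda>i. v $ i" "\<lambda>i. w $ i" "{..<n}"] assms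
    by (simp add: vec_norm2_def)
qed

lemma op_bound_frobenius: "op_bound A (frobenius A)"
  unfolding op_bound_def
proof
  fix v :: "real Matrix.vec" assume v: "v \<in> carrier_vec (dim_col A)"
  show "vec_norm2 (A *\<^sub>v v) \<le> frobenius A * vec_norm2 v"
  proof (rule power2_le_imp_le)
    have "A *\<^sub>v v \<in> carrier_vec (dim_row A)" by (rule carrier_vecI) simp
    then have "(vec_norm2 (A *\<^sub>v v))\<^sup>2 = (\<Sum>i<dim_row A. \<bar>row A i \<bullet> v\<bar>\<^sup>2)"
      by (simp add: vec_norm2_power2)
    also have "\<dots> \<le> (\<Sum>i<dim_row A. (vec_norm2 (row A i) * vec_norm2 v)\<^sup>2)"
      using v by (intro sum_mono power_mono abs_scalar_prod_le) auto
    also have "\<dots> = (\<Sum>i<dim_row A. (vec_norm2 (row A i))\<^sup>2) * (vec_norm2 v)\<^sup>2"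
      by (simp add: power_mult_distrib sum_distrib_right)
    also have "(\<Sum>i<dim_row A. (vec_norm2 (row A i))\<^sup>2) = (frobenius A)\<^sup>2"
      by (subst vec_norm2_power2[where n = "dim_col A"])
         (auto simp: frobenius_power2[where n = "dim_row A" and m = "dim_col A"])
    finally show "(vec_norm2 (A *\<^sub>v v))\<^sup>2 \<le> (frobenius A * vec_norm2 v)\<^sup>2"
      by (simp add: power_mult_distrib)
  qed simp
qed

lemma op_bound_one_add:
  assumes K: "K \<in> carrier_mat n n"
  shows "op_bound (1\<^sub>m n + K) (1 + frobenius K)"
  unfolding op_bound_def
proof
  fix v :: "real Matrix.vec" assume "v \<in> carrier_vec (dim_col (1\<^sub>m n + K))"
  then have v: "v \<in> carrier_vec n" using K by auto
  have "vec_norm2 ((1\<^sub>m n + K) *\<^sub>v v) = vec_norm2 (v + K *\<^sub>v v)"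
    using K v by (simp add: add_mult_distrib_mat_vec[of _ n n])
  also have "\<dots> \<le> vec_norm2 v + frobenius K * vec_norm2 v"
    using K v op_boundD[OF op_bound_frobenius K v]
    by (intro order_trans[OF vec_norm2_triangle[of _ n]]) auto
  finally show "vec_norm2 ((1\<^sub>m n + K) *\<^sub>v v) \<le> (1 + frobenius K) * vec_norm2 v"
    by (simp add: algebra_simps)
qed

lemma abs_entry_le_op_bound:
  assumes A: "A \<in> carrier_mat n m" and c: "op_bound A c" and ij: "i < n" "j < m"
  shows "\<bar>A $$ (i, j)\<bar> \<le> c"
proof -
  have u: "vec_norm2 (unit_vec m j) = 1"
  proof -
    have "(vec_norm2 (unit_vec m j))\<^sup>2 = (\<Sum>i<m. (unit_vec m j $ i)\<^sup>2)" by (rule vec_norm2_power2) simp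
    also have "\<dots> = (\<Sum>i<m. if i = j then 1 else 0)" using ij by (intro sum.cong) auto
    also have "\<dots> = 1" using ij by simp
    finally show ?thesis by (metis vec_norm2_nonneg power2_eq_1_iff not_one_le_zero neg_0_le_iff_le)
  qed
  have e: "A *\<^sub>v unit_vec m j = col A j" using A ij by (intro eq_vecI) (auto simp: scalar_prod_right_unit)
  have "\<bar>A $$ (i, j)\<bar>\<^sup>2 \<le> (\<Sum>k<n. (col A j $ k)\<^sup>2)"
    using A ij member_le_sum[of i "{..<n}" "\<lambda>k. (col A j $ k)\<^sup>2"] by auto
  also have "\<dots> = (vec_norm2 (col A j))\<^sup>2" using A by (subst vec_norm2_power2[where n = n]) auto
  finally have "\<bar>A $$ (i, j)\<bar> \<le> vec_norm2 (col A j)" by (rule power2_le_imp_le) simp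
  also have "\<dots> \<le> c" using op_boundD[OF c A, of "unit_vec m j"] u e by simp
  finally show ?thesis .
qed

text \<open>
  The Cauchy--Schwarz bound would cost a factor \<open>sqrt n\<close> for a matrix \<open>A\<close> that is merely bounded as an
  operator; summing the absolute entries of \<open>B\<close> avoids it when \<open>B\<close> has few entries of order one.
\<close>
lemma abs_mat_trace_mult_le_entrywise:
  assumes A: "A \<in> carrier_mat n m" "op_bound A c" and B: "B \<in> carrier_mat m n"
  shows "\<bar>mat_trace (A * B)\<bar> \<le> c * (\<Sum>i<m. \<Sum>j<n. \<bar>B $$ (i, j)\<bar>)"
proof -
  have "\<bar>mat_trace (A * B)\<bar> \<le> (\<Sum>i<n. \<Sum>j<m. \<bar>A $$ (i, j) * B $$ (j, i)\<bar>)"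
    unfolding mat_trace_mult[OF A(1) B] by (intro order_trans[OF sum_abs] sum_mono sum_abs)
  also have "\<dots> \<le> (\<Sum>i<n. \<Sum>j<m. c * \<bar>B $$ (j, i)\<bar>)"
    using abs_entry_le_op_bound[OF A] by (intro sum_mono) (auto simp: abs_mult intro!: mult_right_mono)
  also have "\<dots> = c * (\<Sum>i<m. \<Sum>j<n. \<bar>B $$ (i, j)\<bar>)"
    by (subst sum.swap) (simp add: sum_distrib_left)
  finally show ?thesis .
qed

text \<open>
  Schur's test: Cauchy--Schwarz with weights \<open>\<bar>A $$ (i, j)\<bar>\<close> in each row, then the same row bound, by
  symmetry, for the columns.
\<close>
lemma op_bound_row_sums:
  assumes A: "A \<in> carrier_mat n n" "A\<^sup>T = A" and c: "\<And>i. i < n \<Longrightarrow> (\<Sum>j<n. \<bar>A $$ (i, j)\<bar>) \<le> c" "0 \<le> c"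
  shows "op_bound A c"
  unfolding op_bound_def
proof
  fix v :: "real Matrix.vec" assume "v \<in> carrier_vec (dim_col A)"
  then have v: "v \<in> carrier_vec n" using A by auto
  have sym: "A $$ (j, i) = A $$ (i, j)" if "i < n" "j < n" for i j
    using that A by (metis carrier_matD index_transpose_mat(1))
  show "vec_norm2 (A *\<^sub>v v) \<le> c * vec_norm2 v"
  proof (rule power2_le_imp_le)
    have row: "((A *\<^sub>v v) $ i)\<^sup>2 \<le> c * (\<Sum>j<n. \<bar>A $$ (i, j)\<bar> * (v $ j)\<^sup>2)" if i: "i < n" for i
    proof -
      have "\<bar>(A *\<^sub>v v) $ i\<bar> \<le> (\<Sum>j<n. \<bar>sqrt \<bar>A $$ (i, j)\<bar>\<bar> * \<bar>sqrt \<bar>A $$ (i, j)\<bar> * v $ j\<bar>)"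
        unfolding mult_mat_vec_entry[OF A(1) v i]
        by (rule order_trans[OF sum_abs]) (simp add: abs_mult flip: mult.assoc)
      also have "\<dots> \<le> L2_set (\<lambda>j. sqrt \<bar>A $$ (i, j)\<bar>) {..<n} * L2_set (\<lambda>j. sqrt \<bar>A $$ (i, j)\<bar> * v $ j) {..<n}"
        by (rule L2_set_mult_ineq)
      also have "\<dots> = sqrt ((\<Sum>j<n. \<bar>A $$ (i, j)\<bar>) * (\<Sum>j<n. \<bar>A $$ (i, j)\<bar> * (v $ j)\<^sup>2))"
        by (simp add: L2_set_def real_sqrt_mult power_mult_distrib)
      finally have "\<bar>(A *\<^sub>v v) $ i\<bar>\<^sup>2 \<le> (sqrt ((\<Sum>j<n. \<bar>A $$ (i, j)\<bar>) * (\<Sum>j<n. \<bar>A $$ (i, j)\<bar> * (v $ j)\<^sup>2)))\<^sup>2"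
        by (intro power_mono) auto
      also have "\<dots> = (\<Sum>j<n. \<bar>A $$ (i, j)\<bar>) * (\<Sum>j<n. \<bar>A $$ (i, j)\<bar> * (v $ j)\<^sup>2)"
        by (simp add: sum_nonneg)
      also have "\<dots> \<le> c * (\<Sum>j<n. \<bar>A $$ (i, j)\<bar> * (v $ j)\<^sup>2)"
        using c(1)[OF i] by (intro mult_right_mono) (auto intro!: sum_nonneg)
      finally show ?thesis by simp
    qed
    have "(vec_norm2 (A *\<^sub>v v))\<^sup>2 = (\<Sum>i<n. ((A *\<^sub>v v) $ i)\<^sup>2)"
      using A v by (intro vec_norm2_power2) (auto intro: mult_mat_vec_carrier)
    also have "\<dots> \<le> (\<Sum>i<n. c * (\<Sum>j<n. \<bar>A $$ (i, j)\<bar> * (v $ j)\<^sup>2))"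
      using row by (intro sum_mono) auto
    also have "\<dots> = c * (\<Sum>j<n. (\<Sum>i<n. \<bar>A $$ (j, i)\<bar>) * (v $ j)\<^sup>2)"
      by (simp add: sum_distrib_left sum_distrib_right, subst sum.swap) (auto intro!: sum.cong simp: sym)
    also have "\<dots> \<le> c * (\<Sum>j<n. c * (v $ j)\<^sup>2)"
      using c by (intro mult_left_mono sum_mono mult_right_mono) auto
    also have "\<dots> = c * (c * (\<Sum>j<n. (v $ j)\<^sup>2))" by (simp add: sum_distrib_left)
    also have "\<dots> = (c * vec_norm2 v)\<^sup>2"
      by (simp only: vec_norm2_power2[OF v, symmetric] power_mult_distrib power2_eq_square[of c] mult.assoc)
    finally show "(vec_norm2 (A *\<^sub>v v))\<^sup>2 \<le> (c * vec_norm2 v)\<^sup>2" .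
  qed (use c in simp)
qed

text \<open>
  Each off-diagonal term is at most \<open>\<bar>A $$ (i, j)\<bar> ((v $ i)\<^sup>2 + (v $ j)\<^sup>2) / 2\<close>, and by symmetry these charge
  to \<open>(v $ i)\<^sup>2\<close> just the off-diagonal sum of row \<open>i\<close>.
\<close>
lemma diagonally_dominant_lower_bound:
  assumes A: "A \<in> carrier_mat n n" "A\<^sup>T = A" and v: "v \<in> carrier_vec n"
    and c: "\<And>i. i < n \<Longrightarrow> c + (\<Sum>j\<in>{..<n} - {i}. \<bar>A $$ (i, j)\<bar>) \<le> A $$ (i, i)"
  shows "c * (vec_norm2 v)\<^sup>2 \<le> v \<bullet> (A *\<^sub>v v)"
proof -
  have sym: "A $$ (j, i) = A $$ (i, j)" if "i < n" "j < n" for i j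
    using that A by (metis carrier_matD index_transpose_mat(1))
  define off where "off i j = (if i = j then 0 else \<bar>A $$ (i, j)\<bar>)" for i j
  have off: "(\<Sum>j\<in>{..<n} - {i}. \<bar>A $$ (i, j)\<bar>) = (\<Sum>j<n. off i j)" if "i < n" for i
    using that by (intro sum.mono_neutral_cong_left) (auto simp: off_def)
  have "v \<bullet> (A *\<^sub>v v) = (\<Sum>i<n. v $ i * (\<Sum>j<n. A $$ (i, j) * v $ j))"
    using A(1) v mult_mat_vec_entry[OF A(1) v]
    unfolding scalar_prod_def lessThan_atLeast0[symmetric] by (auto intro!: sum.cong)
  also have "\<dots> = (\<Sum>i<n. \<Sum>j<n. A $$ (i, j) * (v $ i * v $ j))"
    by (simp add: sum_distrib_left mult_ac)
  also have "\<dots> \<ge> (\<Sum>i<n. \<Sum>j<n. (if i = j then A $$ (i, i) * (v $ i)\<^sup>2 else 0)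
      - off i j * ((v $ i)\<^sup>2 + (v $ j)\<^sup>2) / 2)"
  proof (intro sum_mono)
    fix i j
    have "\<bar>v $ i * v $ j\<bar> \<le> ((v $ i)\<^sup>2 + (v $ j)\<^sup>2) / 2"
      using sum_squares_bound[of "\<bar>v $ i\<bar>" "\<bar>v $ j\<bar>"] by (simp add: abs_mult)
    then have "\<bar>A $$ (i, j) * (v $ i * v $ j)\<bar> \<le> \<bar>A $$ (i, j)\<bar> * (((v $ i)\<^sup>2 + (v $ j)\<^sup>2) / 2)"
      by (simp only: abs_mult[of "A $$ (i, j)"] mult_left_mono abs_ge_zero)
    then show "(if i = j then A $$ (i, i) * (v $ i)\<^sup>2 else 0) - off i j * ((v $ i)\<^sup>2 + (v $ j)\<^sup>2) / 2
        \<le> A $$ (i, j) * (v $ i * v $ j)"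
      by (auto simp: off_def power2_eq_square)
  qed
  also have "(\<Sum>i<n. \<Sum>j<n. (if i = j then A $$ (i, i) * (v $ i)\<^sup>2 else 0)
      - off i j * ((v $ i)\<^sup>2 + (v $ j)\<^sup>2) / 2) = (\<Sum>i<n. (A $$ (i, i) - (\<Sum>j<n. off i j)) * (v $ i)\<^sup>2)"
  proof -
    have o: "off i j = off j i" if "i < n" "j < n" for i j using sym that by (auto simp: off_def)
    have "(\<Sum>i<n. \<Sum>j<n. off i j * (v $ j)\<^sup>2) = (\<Sum>i<n. \<Sum>j<n. off i j * (v $ i)\<^sup>2)"
      by (subst sum.swap) (auto intro!: sum.cong simp: o)
    then have "(\<Sum>i<n. \<Sum>j<n. off i j * ((v $ i)\<^sup>2 + (v $ j)\<^sup>2) / 2) = (\<Sum>i<n. \<Sum>j<n. off i j * (v $ i)\<^sup>2)"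
      by (simp add: distrib_left sum.distrib add_divide_distrib flip: sum_divide_distrib)
    moreover have "(\<Sum>i<n. \<Sum>j<n. if i = j then A $$ (i, i) * (v $ i)\<^sup>2 else 0) = (\<Sum>i<n. A $$ (i, i) * (v $ i)\<^sup>2)"
      by (intro sum.cong refl) simp
    ultimately show ?thesis
      by (simp only: sum_subtractf left_diff_distrib sum_distrib_right)
  qed
  finally have "(\<Sum>i<n. (A $$ (i, i) - (\<Sum>j<n. off i j)) * (v $ i)\<^sup>2) \<le> v \<bullet> (A *\<^sub>v v)" .
  moreover have "(\<Sum>i<n. c * (v $ i)\<^sup>2) \<le> (\<Sum>i<n. (A $$ (i, i) - (\<Sum>j<n. off i j)) * (v $ i)\<^sup>2)"
    using c off by (intro sum_mono mult_right_mono) (auto simp: algebra_simps)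
  ultimately show ?thesis by (simp add: vec_norm2_power2[OF v] sum_distrib_left)
qed

text \<open>
  A coercive matrix is injective, hence invertible, and \<open>c \<parallel>v\<parallel>\<^sup>2 \<le> \<parallel>v\<parallel> \<parallel>A v\<parallel>\<close> bounds the inverse.
\<close>
lemma coercive_inverse:
  assumes A: "A \<in> carrier_mat n n" and c: "0 < c"
    and low: "\<And>v. v \<in> carrier_vec n \<Longrightarrow> c * (vec_norm2 v)\<^sup>2 \<le> v \<bullet> (A *\<^sub>v v)"
  obtains P where "P \<in> carrier_mat n n" "A * P = 1\<^sub>m n" "P * A = 1\<^sub>m n" "op_bound P (1 / c)"
proof -
  have le: "c * vec_norm2 v \<le> vec_norm2 (A *\<^sub>v v)" if v: "v \<in> carrier_vec n" for v
  proof (cases "vec_norm2 v = 0")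
    case False
    then have "0 < vec_norm2 v" by (simp add: less_le)
    moreover have "c * vec_norm2 v * vec_norm2 v \<le> vec_norm2 (A *\<^sub>v v) * vec_norm2 v"
      using low[OF v] abs_scalar_prod_le[OF v, of "A *\<^sub>v v"] A v
      by (auto simp: power2_eq_square mult_ac)
    ultimately show ?thesis by simp
  qed simp
  have "Determinant.det A \<noteq> 0"
  proof
    assume "Determinant.det A = 0"
    then obtain v where v: "v \<in> carrier_vec n" "v \<noteq> 0\<^sub>v n" "A *\<^sub>v v = 0\<^sub>v n"
      using det_0_iff_vec_prod_zero_field[OF A] by auto
    have "vec_norm2 (0\<^sub>v n) = 0" by (simp add: vec_norm2_def L2_set_def)
    then have "vec_norm2 v = 0" using le[OF v(1)] v(3) c by (simp add: mult_le_0_iff order.antisym)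
    then have "v $ i = 0" if "i < n" for i
      using that v(1) by (auto simp: vec_norm2_def L2_set_eq_0_iff)
    then show False using v by auto
  qed
  then obtain P where P: "P \<in> carrier_mat n n" "A * P = 1\<^sub>m n" "P * A = 1\<^sub>m n"
    using det_non_zero_imp_unit[OF A] A unfolding Units_def ring_mat_def by auto
  have "op_bound P (1 / c)"
    unfolding op_bound_def
  proof
    fix v :: "real Matrix.vec" assume "v \<in> carrier_vec (dim_col P)"
    then have v: "v \<in> carrier_vec n" using P by auto
    have "A *\<^sub>v (P *\<^sub>v v) = v" using A P v by (simp flip: assoc_mult_mat_vec)
    then have "c * vec_norm2 (P *\<^sub>v v) \<le> vec_norm2 v" using le[of "P *\<^sub>v v"] P v by auto
    then show "vec_norm2 (P *\<^sub>v v) \<le> 1 / c * vec_norm2 v" using c by (simp add: field_simps)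
  qed
  then show ?thesis using that P by blast
qed

lemma inverse_transpose:
  fixes A P :: "real mat"
  assumes A: "A \<in> carrier_mat n n" "A\<^sup>T = A" and P: "P \<in> carrier_mat n n" "A * P = 1\<^sub>m n"
  shows "P\<^sup>T = P"
proof -
  have "P\<^sup>T * A = 1\<^sub>m n" using arg_cong[OF P(2), of transpose_mat] transpose_mult[OF A(1) P(1)] A(2) by simp
  then have "P\<^sup>T * (A * P) = P" using A P by (subst assoc_mult_mat[of _ n n _ n _ n, symmetric]) auto
  then show ?thesis using P by simp
qed

lemma mat_trace_cyclic_square:
  assumes "A \<in> carrier_mat n m" "B \<in> carrier_mat m n"
  shows "mat_trace ((A * B) * (A * B)) = mat_trace ((B * A) * (B * A))"
proof -
  have "(A * B) * (A * B) = A * (B * (A * B))" using assms by (intro assoc_mult_mat[of _ n m _ n _ n]) auto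
  moreover have "(B * (A * B)) * A = (B * A) * (B * A)"
  proof -
    have "(B * (A * B)) * A = ((B * A) * B) * A" using assms by (subst assoc_mult_mat[of B m n A m B n]) auto
    also have "\<dots> = (B * A) * (B * A)" using assms by (intro assoc_mult_mat[of _ m m _ n _ m]) auto
    finally show ?thesis .
  qed
  ultimately show ?thesis using mat_trace_comm[of A n m "B * (A * B)"] assms by simp
qed

text \<open>
  The expansion of \<open>P (1 + K) Z' (1 + K)\<^sup>T\<close> for \<open>P = Z\<^sup>-\<^sup>1\<close> has four terms. The two that are linear in \<open>K\<close>
  have equal trace, by transposition, and in them \<open>Z' P = 1 + (Z' - Z) P\<close> leaves only \<open>tr ((Z' - Z) P K)\<close>
  because \<open>tr K = 0\<close>. Without that cancellation the norms would only bound them by the order \<open>sqrt n\<close>.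
\<close>
lemma trace_inverse_congruence:
  fixes P Z Z' K :: "real mat"
  assumes P: "P \<in> carrier_mat n n" "op_bound P p" "0 \<le> p"
    and Z: "Z \<in> carrier_mat n n" "Z\<^sup>T = Z" "Z * P = 1\<^sub>m n" "P * Z = 1\<^sub>m n"
    and Z': "Z' \<in> carrier_mat n n" "Z'\<^sup>T = Z'" "op_bound Z' z" "0 \<le> z"
    and K: "K \<in> carrier_mat n n" "mat_trace K = 0"
  defines "J \<equiv> 1\<^sub>m n + K"
  shows "\<bar>mat_trace (P * (J * (Z' * J\<^sup>T))) - real n\<bar> \<le>
      p * (\<Sum>i<n. \<Sum>j<n. \<bar>(Z' - Z) $$ (i, j)\<bar>) + 2 * p * frobenius K * frobenius (Z' - Z) + p * z * (frobenius K)\<^sup>2"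
    (is ?th1)
    and "\<bar>mat_trace ((P * (J * (Z' * J\<^sup>T))) * (P * (J * (Z' * J\<^sup>T))))\<bar> \<le>
      (p * ((1 + frobenius K) * (z * (sqrt (real n) + frobenius K))))\<^sup>2" (is ?th2)
proof -
  define D where "D = Z' - Z"
  have D: "D \<in> carrier_mat n n" unfolding D_def using Z Z' by auto
  have PT: "P\<^sup>T = P" using inverse_transpose[OF Z(1,2) P(1) Z(3)] .
  have Z'_split: "Z' = Z + D" unfolding D_def using Z Z' by (intro eq_matI) auto
  have J: "J \<in> carrier_mat n n" unfolding J_def using K by auto
  have PZ': "P * Z' = 1\<^sub>m n + P * D"
    unfolding Z'_split using P Z D by (simp add: mult_add_distrib_mat[of _ n n _ n])
  have tr0: "mat_trace (P * Z') = real n + mat_trace (P * D)"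
    unfolding PZ' using P D by (subst mat_trace_add[of _ n]) auto
  \<comment> \<open>Here \<open>tr K = 0\<close> removes the contribution of the identity in \<open>Z' P = 1 + (Z' - Z) P\<close>.\<close>
  have "mat_trace (P * (K * Z')) = mat_trace ((P * K) * Z')"
    using P K Z' by (simp add: assoc_mult_mat[of _ n n _ n _ n])
  also have "\<dots> = mat_trace (Z' * (P * K))" using P K Z' by (intro mat_trace_comm[of _ n n]) auto
  also have "Z' * (P * K) = K + D * (P * K)"
  proof -
    have "Z * (P * K) = K" using P Z K by (simp flip: assoc_mult_mat[of _ n n _ n _ n])
    then show ?thesis unfolding Z'_split using P Z K D by (simp add: add_mult_distrib_mat[of _ n n _ _ n])
  qed
  also have "mat_trace \<dots> = mat_trace (D * (P * K))"
    using P K D by (subst mat_trace_add[of _ n]) auto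
  finally have tr1: "mat_trace (P * (K * Z')) = mat_trace (D * (P * K))" .
  have "mat_trace (P * (Z' * K\<^sup>T)) = mat_trace ((P * (Z' * K\<^sup>T))\<^sup>T)"
    using P Z' K by (intro mat_trace_transpose[symmetric]) auto
  also have "(P * (Z' * K\<^sup>T))\<^sup>T = (K * Z') * P"
    using P Z' K PT by (simp add: transpose_mult[of _ n n _ n])
  also have "mat_trace \<dots> = mat_trace (P * (K * Z'))"
    using P K Z' by (intro mat_trace_comm[of _ n n]) auto
  finally have tr2: "mat_trace (P * (Z' * K\<^sup>T)) = mat_trace (D * (P * K))" using tr1 by simp
  have expand: "P * (J * (Z' * J\<^sup>T)) = (P * Z' + P * (Z' * K\<^sup>T)) + (P * (K * Z') + P * (K * (Z' * K\<^sup>T)))"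
  proof -
    have "Z' * J\<^sup>T = Z' + Z' * K\<^sup>T"
      unfolding J_def using K Z' by (simp add: transpose_add[of _ n n] mult_add_distrib_mat[of _ n n _ n])
    moreover have "J * Y = Y + K * Y" if "Y \<in> carrier_mat n n" for Y
      unfolding J_def using K that by (simp add: add_mult_distrib_mat[of _ n n _ _ n])
    ultimately show ?thesis
      using P K Z' by (simp add: mult_add_distrib_mat[of _ n n _ n] assoc_add_mat[of _ n n])
  qed
  have tr: "mat_trace (P * (J * (Z' * J\<^sup>T))) - real n =
      mat_trace (P * D) + 2 * mat_trace (D * (P * K)) + mat_trace (P * (K * (Z' * K\<^sup>T)))"
    unfolding expand using P K Z' tr0 tr1 tr2 by (simp add: mat_trace_add[of _ n])
  have PK: "frobenius (P * K) \<le> p * frobenius K" using P K by (intro frobenius_mult_le) auto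
  have "\<bar>mat_trace (P * D)\<bar> \<le> p * (\<Sum>i<n. \<Sum>j<n. \<bar>D $$ (i, j)\<bar>)"
    using P D by (intro abs_mat_trace_mult_le_entrywise) auto
  moreover have "\<bar>mat_trace (D * (P * K))\<bar> \<le> frobenius D * (p * frobenius K)"
    using abs_mat_trace_mult_le[of D n n "P * K"] D P K mult_left_mono[OF PK, of "frobenius D"] by auto
  moreover have "\<bar>mat_trace (P * (K * (Z' * K\<^sup>T)))\<bar> \<le> (p * frobenius K) * (z * frobenius K)"
  proof -
    have "P * (K * (Z' * K\<^sup>T)) = (P * K) * (Z' * K\<^sup>T)"
      using P K Z' by (intro assoc_mult_mat[symmetric, of _ n n _ n _ n]) auto
    then have "\<bar>mat_trace (P * (K * (Z' * K\<^sup>T)))\<bar> \<le> frobenius (P * K) * frobenius (Z' * K\<^sup>T)"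
      using P K Z' abs_mat_trace_mult_le[of "P * K" n n "Z' * K\<^sup>T"] by auto
    also have "\<dots> \<le> (p * frobenius K) * (z * frobenius (K\<^sup>T))"
      using P K Z' by (intro mult_mono PK frobenius_mult_le[of _ n n _ n]) auto
    finally show ?thesis using frobenius_transpose[OF K(1)] by simp
  qed
  moreover have "frobenius D * (p * frobenius K) = p * frobenius K * frobenius D" "(p * frobenius K) * (z * frobenius K) = p * z * (frobenius K)\<^sup>2"
    by (simp_all add: power2_eq_square)
  ultimately show ?th1
    unfolding tr D_def[symmetric] by linarith
  have JT: "frobenius (J\<^sup>T) \<le> sqrt (real n) + frobenius K"
    using frobenius_transpose[OF J] frobenius_triangle[of "1\<^sub>m n" n n K] K frobenius_one[of n] by (simp add: J_def)
  have JT': "J\<^sup>T \<in> carrier_mat n n" and ZJ: "Z' * J\<^sup>T \<in> carrier_mat n n" and JZJ: "J * (Z' * J\<^sup>T) \<in> carrier_mat n n"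
    using J Z'(1) by auto
  have opJ: "op_bound J (1 + frobenius K)" unfolding J_def by (rule op_bound_one_add[OF K(1)])
  have "frobenius (P * (J * (Z' * J\<^sup>T))) \<le> p * frobenius (J * (Z' * J\<^sup>T))"
    by (rule frobenius_mult_le[OF P(1) JZJ P(2,3)])
  also have "\<dots> \<le> p * ((1 + frobenius K) * frobenius (Z' * J\<^sup>T))"
    by (intro mult_left_mono frobenius_mult_le[OF J ZJ opJ] P(3)) simp
  also have "\<dots> \<le> p * ((1 + frobenius K) * (z * frobenius (J\<^sup>T)))"
    by (intro mult_left_mono frobenius_mult_le[OF Z'(1) JT' Z'(3,4)] P(3)) simp
  also have "\<dots> \<le> p * ((1 + frobenius K) * (z * (sqrt (real n) + frobenius K)))"
    by (intro mult_left_mono JT Z'(4) P(3)) simp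
  finally have fr: "frobenius (P * (J * (Z' * J\<^sup>T))) \<le> \<dots>" .
  have "\<bar>mat_trace ((P * (J * (Z' * J\<^sup>T))) * (P * (J * (Z' * J\<^sup>T))))\<bar> \<le> (frobenius (P * (J * (Z' * J\<^sup>T))))\<^sup>2"
    using abs_mat_trace_mult_le[of "P * (J * (Z' * J\<^sup>T))" n n "P * (J * (Z' * J\<^sup>T))"] P J Z'
    by (auto simp: power2_eq_square)
  also have "\<dots> \<le> (p * ((1 + frobenius K) * (z * (sqrt (real n) + frobenius K))))\<^sup>2"
    using fr by (intro power_mono) auto
  finally show ?th2 .
qed

section \<open>Moments of Gaussian quadratic forms\<close>

lemma (in prob_space) centred_normal_even_moment:
  assumes "normal_rv M Y 0 v"
  shows "has_bochner_integral M (\<lambda>\<omega>. Y \<omega> ^ (2 * k)) (fact (2 * k) / (2 ^ k * fact k) * v ^ k)"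
proof (cases "v > 0")
  case True
  then have dist: "distributed M lborel Y (\<lambda>x. ennreal (normal_density 0 (sqrt v) x))"
    using assms by (auto simp: normal_rv_def)
  have mom: "has_bochner_integral lborel (\<lambda>x. normal_density 0 (sqrt v) x * x ^ (2 * k))
      (fact (2 * k) / ((2 / v) ^ k * fact k))"
    using normal_moment_even[where \<mu> = 0 and \<sigma> = "sqrt v" and k = k] True by (simp only: real_sqrt_pow2 less_imp_le diff_zero real_sqrt_gt_zero)
  have "integrable M (\<lambda>\<omega>. Y \<omega> ^ (2 * k))"
    using mom distributed_integrable[OF dist, of "\<lambda>x. x ^ (2 * k)"] by (simp add: has_bochner_integral_iff)
  moreover have "expectation (\<lambda>\<omega>. Y \<omega> ^ (2 * k)) = fact (2 * k) / ((2 / v) ^ k * fact k)"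
    using mom distributed_integral[OF dist, of "\<lambda>x. x ^ (2 * k)"] by (simp add: has_bochner_integral_iff)
  moreover have "fact (2 * k) / ((2 / v) ^ k * fact k) = fact (2 * k) / (2 ^ k * fact k) * v ^ k"
    by (simp add: power_divide)
  ultimately show ?thesis by (simp only: has_bochner_integral_iff)
next
  case False
  then have v: "v = 0" and Y: "AE \<omega> in M. Y \<omega> = 0" and m: "random_variable borel Y"
    using assms by (auto simp: normal_rv_def)
  have ae: "AE \<omega> in M. Y \<omega> ^ (2 * k) = 0 ^ (2 * k)" using Y by eventually_elim simp
  have "has_bochner_integral M (\<lambda>\<omega>. (0 :: real) ^ (2 * k)) (0 ^ (2 * k))"
    by (simp add: has_bochner_integral_iff prob_space)
  then have "has_bochner_integral M (\<lambda>\<omega>. Y \<omega> ^ (2 * k)) (0 ^ (2 * k))"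
    using m
    by (subst has_bochner_integral_cong_AE[OF _ _ ae]) auto
  moreover have "(0 :: real) ^ (2 * k) = fact (2 * k) / (2 ^ k * fact k) * v ^ k"
    unfolding v by (cases "k = 0") (simp_all add: power_0_left)
  ultimately show ?thesis by (simp only:)
qed

lemma has_bochner_integral_transfer:
  assumes "has_bochner_integral M f m" "m = m'" "\<And>x. x \<in> space M \<Longrightarrow> f x = g x"
  shows "has_bochner_integral M g m'"
proof -
  have "has_bochner_integral M f m \<longleftrightarrow> has_bochner_integral M g m'"
    by (rule has_bochner_integral_cong) (simp_all add: assms(2,3))
  then show ?thesis using assms(1) by simp
qed

text \<open>
  Only the univariate laws of the linear forms of \<open>X\<close> are given, so all mixed moments below come from
  polarization: products of linear forms are combinations of squares and fourth powers of linear forms.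
\<close>
locale gaussian_vector = prob_space M for M :: "'a measure" +
  fixes X :: "'a \<Rightarrow> real Matrix.vec" and k :: nat and S :: "real mat"
  assumes normal: "multivariate_normal M X k (0\<^sub>v k) S"
begin

definition lin :: "real Matrix.vec \<Rightarrow> 'a \<Rightarrow> real" where
  "lin a \<omega> = a \<bullet> X \<omega>"

definition cov :: "real Matrix.vec \<Rightarrow> real Matrix.vec \<Rightarrow> real" where
  "cov a b = a \<bullet> (S *\<^sub>v b)"

lemma S: "S \<in> carrier_mat k k" "S\<^sup>T = S"
  and X: "\<omega> \<in> space M \<Longrightarrow> X \<omega> \<in> carrier_vec k"
  using normal by (auto simp: multivariate_normal_def)

lemma normal_lin: "a \<in> carrier_vec k \<Longrightarrow> normal_rv M (lin a) 0 (cov a a)"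
  using normal by (simp add: multivariate_normal_def lin_def[abs_def] cov_def)

lemma lin_add: "a \<in> carrier_vec k \<Longrightarrow> b \<in> carrier_vec k \<Longrightarrow> \<omega> \<in> space M \<Longrightarrow> lin (a + b) \<omega> = lin a \<omega> + lin b \<omega>"
  using X by (simp add: lin_def add_scalar_prod_distrib[of _ k])

lemma lin_diff: "a \<in> carrier_vec k \<Longrightarrow> b \<in> carrier_vec k \<Longrightarrow> \<omega> \<in> space M \<Longrightarrow> lin (a - b) \<omega> = lin a \<omega> - lin b \<omega>"
  using X by (simp add: lin_def minus_scalar_prod_distrib[of _ k])

lemma cov_add_left:
  "a \<in> carrier_vec k \<Longrightarrow> b \<in> carrier_vec k \<Longrightarrow> c \<in> carrier_vec k \<Longrightarrow> cov (a + b) c = cov a c + cov b c"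
  using S by (simp add: cov_def add_scalar_prod_distrib[of _ k])

lemma cov_diff_left:
  "a \<in> carrier_vec k \<Longrightarrow> b \<in> carrier_vec k \<Longrightarrow> c \<in> carrier_vec k \<Longrightarrow> cov (a - b) c = cov a c - cov b c"
  using S by (simp add: cov_def minus_scalar_prod_distrib[of _ k])

lemma cov_commute: "a \<in> carrier_vec k \<Longrightarrow> b \<in> carrier_vec k \<Longrightarrow> cov a b = cov b a"
  unfolding cov_def using transpose_vec_mult_scalar[of S k k b a] comm_scalar_prod[of b k "S *\<^sub>v a"] S
  by (simp only: mult_mat_vec_carrier)

lemma cov_add_right:
  "a \<in> carrier_vec k \<Longrightarrow> b \<in> carrier_vec k \<Longrightarrow> c \<in> carrier_vec k \<Longrightarrow> cov c (a + b) = cov c a + cov c b"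
  using cov_add_left cov_commute by simp

lemma cov_diff_right:
  "a \<in> carrier_vec k \<Longrightarrow> b \<in> carrier_vec k \<Longrightarrow> c \<in> carrier_vec k \<Longrightarrow> cov c (a - b) = cov c a - cov c b"
  using cov_diff_left cov_commute by simp

lemmas cov_simps = cov_add_left cov_add_right cov_diff_left cov_diff_right

lemma lin_moments:
  assumes "a \<in> carrier_vec k"
  shows "has_bochner_integral M (\<lambda>\<omega>. (lin a \<omega>)\<^sup>2) (cov a a)"
    and "has_bochner_integral M (\<lambda>\<omega>. lin a \<omega> ^ 4) (3 * (cov a a)\<^sup>2)"
  using centred_normal_even_moment[OF normal_lin[OF assms], of 1]
    centred_normal_even_moment[OF normal_lin[OF assms], of 2]
  by (simp_all add: fact_numeral)

lemma cov_add_diff: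
  assumes "a \<in> carrier_vec k" "b \<in> carrier_vec k"
  shows "cov (a + b) (a + b) = cov a a + 2 * cov a b + cov b b"
    and "cov (a - b) (a - b) = cov a a - 2 * cov a b + cov b b"
  using assms by (simp_all add: cov_simps cov_commute[of b a])

lemma second_moment:
  assumes ab: "a \<in> carrier_vec k" "b \<in> carrier_vec k"
  shows "has_bochner_integral M (\<lambda>\<omega>. lin a \<omega> * lin b \<omega>) (cov a b)"
proof -
  have int: "has_bochner_integral M (\<lambda>\<omega>. ((lin (a + b) \<omega>)\<^sup>2 - (lin (a - b) \<omega>)\<^sup>2) / 4)
      ((cov (a + b) (a + b) - cov (a - b) (a - b)) / 4)"
    using ab by (intro has_bochner_integral_divide_zero has_bochner_integral_diff lin_moments) auto
  show ?thesis
  proof (rule has_bochner_integral_transfer[OF int])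
    show "(cov (a + b) (a + b) - cov (a - b) (a - b)) / 4 = cov a b"
      by (simp only: cov_add_diff[OF ab]) simp
    show "((lin (a + b) \<omega>)\<^sup>2 - (lin (a - b) \<omega>)\<^sup>2) / 4 = lin a \<omega> * lin b \<omega>" if "\<omega> \<in> space M" for \<omega>
      by (simp only: lin_add[OF ab that] lin_diff[OF ab that]) (simp add: power2_sum power2_diff)
  qed
qed

text \<open>
  From \<open>(x + y)\<^sup>4 + (x - y)\<^sup>4 = 2 x\<^sup>4 + 12 x\<^sup>2 y\<^sup>2 + 2 y\<^sup>4\<close>.
\<close>
lemma moment_sq_sq:
  assumes ab: "a \<in> carrier_vec k" "b \<in> carrier_vec k"
  shows "has_bochner_integral M (\<lambda>\<omega>. (lin a \<omega>)\<^sup>2 * (lin b \<omega>)\<^sup>2) (cov a a * cov b b + 2 * (cov a b)\<^sup>2)"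
proof -
  have int: "has_bochner_integral M
      (\<lambda>\<omega>. (lin (a + b) \<omega> ^ 4 + lin (a - b) \<omega> ^ 4 - 2 * lin a \<omega> ^ 4 - 2 * lin b \<omega> ^ 4) / 12)
      ((3 * (cov (a + b) (a + b))\<^sup>2 + 3 * (cov (a - b) (a - b))\<^sup>2 - 2 * (3 * (cov a a)\<^sup>2) - 2 * (3 * (cov b b)\<^sup>2)) / 12)"
    using ab by (intro has_bochner_integral_divide_zero has_bochner_integral_diff
        has_bochner_integral_add has_bochner_integral_mult_right lin_moments) auto
  have quartic: "((x + y) ^ 4 + (x - y) ^ 4 - 2 * x ^ 4 - 2 * y ^ 4) / 12 = x\<^sup>2 * y\<^sup>2" for x y :: real
    by (simp add: power4_eq_xxxx power2_eq_square algebra_simps)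
  show ?thesis
  proof (rule has_bochner_integral_transfer[OF int])
    have "(3 * (x + 2 * y + z)\<^sup>2 + 3 * (x - 2 * y + z)\<^sup>2 - 2 * (3 * x\<^sup>2) - 2 * (3 * z\<^sup>2)) / 12 = x * z + 2 * y\<^sup>2"
      for x y z :: real
      by (simp add: power2_eq_square algebra_simps)
    then show "(3 * (cov (a + b) (a + b))\<^sup>2 + 3 * (cov (a - b) (a - b))\<^sup>2 - 2 * (3 * (cov a a)\<^sup>2)
        - 2 * (3 * (cov b b)\<^sup>2)) / 12 = cov a a * cov b b + 2 * (cov a b)\<^sup>2"
      by (simp only: cov_add_diff[OF ab])
    show "(lin (a + b) \<omega> ^ 4 + lin (a - b) \<omega> ^ 4 - 2 * lin a \<omega> ^ 4 - 2 * lin b \<omega> ^ 4) / 12 =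
        (lin a \<omega>)\<^sup>2 * (lin b \<omega>)\<^sup>2" if "\<omega> \<in> space M" for \<omega>
      by (simp only: lin_add[OF ab that] lin_diff[OF ab that] quartic)
  qed
qed

lemma moment_mult_sq:
  assumes ab: "a \<in> carrier_vec k" "b \<in> carrier_vec k" and c: "c \<in> carrier_vec k"
  shows "has_bochner_integral M (\<lambda>\<omega>. lin a \<omega> * lin b \<omega> * (lin c \<omega>)\<^sup>2) (cov a b * cov c c + 2 * cov a c * cov b c)"
proof -
  have int: "has_bochner_integral M
      (\<lambda>\<omega>. ((lin (a + b) \<omega>)\<^sup>2 * (lin c \<omega>)\<^sup>2 - (lin (a - b) \<omega>)\<^sup>2 * (lin c \<omega>)\<^sup>2) / 4)
      ((cov (a + b) (a + b) * cov c c + 2 * (cov (a + b) c)\<^sup>2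
        - (cov (a - b) (a - b) * cov c c + 2 * (cov (a - b) c)\<^sup>2)) / 4)"
    using ab c by (intro has_bochner_integral_divide_zero has_bochner_integral_diff moment_sq_sq) auto
  show ?thesis
  proof (rule has_bochner_integral_transfer[OF int])
    have "((x + 2 * y + z) * w + 2 * (p + q)\<^sup>2 - ((x - 2 * y + z) * w + 2 * (p - q)\<^sup>2)) / 4 = y * w + 2 * p * q"
      for x y z w p q :: real
      by (simp add: power2_eq_square algebra_simps)
    then show "(cov (a + b) (a + b) * cov c c + 2 * (cov (a + b) c)\<^sup>2
        - (cov (a - b) (a - b) * cov c c + 2 * (cov (a - b) c)\<^sup>2)) / 4 = cov a b * cov c c + 2 * cov a c * cov b c"
      by (simp only: cov_add_diff[OF ab] cov_add_left[OF ab c] cov_diff_left[OF ab c])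
    have "((x + y)\<^sup>2 * z\<^sup>2 - (x - y)\<^sup>2 * z\<^sup>2) / 4 = x * y * z\<^sup>2" for x y z :: real
      by (simp add: power2_eq_square algebra_simps)
    then show "((lin (a + b) \<omega>)\<^sup>2 * (lin c \<omega>)\<^sup>2 - (lin (a - b) \<omega>)\<^sup>2 * (lin c \<omega>)\<^sup>2) / 4 =
        lin a \<omega> * lin b \<omega> * (lin c \<omega>)\<^sup>2" if "\<omega> \<in> space M" for \<omega>
      by (simp only: lin_add[OF ab that] lin_diff[OF ab that])
  qed
qed

text \<open>
  Isserlis' formula, the last step of the polarization.
\<close>
lemma fourth_moment:
  assumes ab: "a \<in> carrier_vec k" "b \<in> carrier_vec k" and ce: "c \<in> carrier_vec k" "e \<in> carrier_vec k"
  shows "has_bochner_integral M (\<lambda>\<omega>. (lin a \<omega> * lin b \<omega>) * (lin c \<omega> * lin e \<omega>))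
    (cov a b * cov c e + cov a c * cov b e + cov a e * cov b c)"
proof -
  have int: "has_bochner_integral M
      (\<lambda>\<omega>. (lin a \<omega> * lin b \<omega> * (lin (c + e) \<omega>)\<^sup>2 - lin a \<omega> * lin b \<omega> * (lin (c - e) \<omega>)\<^sup>2) / 4)
      ((cov a b * cov (c + e) (c + e) + 2 * cov a (c + e) * cov b (c + e)
        - (cov a b * cov (c - e) (c - e) + 2 * cov a (c - e) * cov b (c - e))) / 4)"
    using ab ce by (intro has_bochner_integral_divide_zero has_bochner_integral_diff moment_mult_sq) auto
  show ?thesis
  proof (rule has_bochner_integral_transfer[OF int])
    have "(u * (x + 2 * y + z) + 2 * (p + q) * (r + s) - (u * (x - 2 * y + z) + 2 * (p - q) * (r - s))) / 4
        = u * y + p * s + q * r"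
      for x y z u p q r s :: real
      by (simp add: algebra_simps)
    then show "(cov a b * cov (c + e) (c + e) + 2 * cov a (c + e) * cov b (c + e)
        - (cov a b * cov (c - e) (c - e) + 2 * cov a (c - e) * cov b (c - e))) / 4
      = cov a b * cov c e + cov a c * cov b e + cov a e * cov b c"
      using ab by (simp only: cov_add_diff[OF ce] cov_add_right[OF ce] cov_diff_right[OF ce])
    have "(x * y * (z + w)\<^sup>2 - x * y * (z - w)\<^sup>2) / 4 = (x * y) * (z * w)" for x y z w :: real
      by (simp add: power2_eq_square algebra_simps)
    then show "(lin a \<omega> * lin b \<omega> * (lin (c + e) \<omega>)\<^sup>2 - lin a \<omega> * lin b \<omega> * (lin (c - e) \<omega>)\<^sup>2) / 4 =
        (lin a \<omega> * lin b \<omega>) * (lin c \<omega> * lin e \<omega>)" if "\<omega> \<in> space M" for \<omega>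
      by (simp only: lin_add[OF ce that] lin_diff[OF ce that])
  qed
qed

text \<open>
  The square of the quadratic form is a sum over four indices. Of the three pairings in Isserlis'
  formula, one gives the squared trace and each of the other two gives \<open>tr ((Q S)\<^sup>2)\<close>.
\<close>
lemma quadratic_form_moments:
  assumes Q: "Q \<in> carrier_mat k k" "Q\<^sup>T = Q"
  defines "Y \<equiv> \<lambda>\<omega>. X \<omega> \<bullet> (Q *\<^sub>v X \<omega>)"
  shows "has_bochner_integral M Y (mat_trace (Q * S))"
    and "has_bochner_integral M (\<lambda>\<omega>. (Y \<omega>)\<^sup>2) ((mat_trace (Q * S))\<^sup>2 + 2 * mat_trace ((Q * S) * (Q * S)))"
proof -
  let ?u = "unit_vec k :: nat \<Rightarrow> real Matrix.vec"
  have lin: "lin (?u i) \<omega> = X \<omega> $ i" if "\<omega> \<in> space M" "i < k" for \<omega> i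
    using that X[of \<omega>] by (simp add: lin_def scalar_prod_left_unit)
  have cov: "cov (?u i) (?u j) = S $$ (i, j)" if "i < k" "j < k" for i j
    using that S by (auto simp: cov_def scalar_prod_left_unit scalar_prod_right_unit)
  have symS: "S $$ (i, j) = S $$ (j, i)" if "i < k" "j < k" for i j
    using that S by (metis carrier_matD index_transpose_mat(1))
  have symQ: "Q $$ (i, j) = Q $$ (j, i)" if "i < k" "j < k" for i j
    using that Q by (metis carrier_matD index_transpose_mat(1))
  have Y: "Y \<omega> = (\<Sum>i<k. \<Sum>j<k. Q $$ (i, j) * (lin (?u i) \<omega> * lin (?u j) \<omega>))" if "\<omega> \<in> space M" for \<omega>
  proof -
    have "Y \<omega> = (\<Sum>i<k. X \<omega> $ i * (\<Sum>j<k. Q $$ (i, j) * X \<omega> $ j))"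
      using Q(1) X[OF that] mult_mat_vec_entry[OF Q(1) X[OF that]]
      unfolding Y_def scalar_prod_def lessThan_atLeast0[symmetric] by (auto intro!: sum.cong)
    then show ?thesis using that by (simp add: lin sum_distrib_left mult_ac)
  qed
  have tr: "mat_trace (Q * S) = (\<Sum>i<k. \<Sum>j<k. Q $$ (i, j) * S $$ (i, j))"
    using mat_trace_mult[OF Q(1) S(1)] by (auto intro!: sum.cong simp: symS)
  have "has_bochner_integral M (\<lambda>\<omega>. \<Sum>i<k. \<Sum>j<k. Q $$ (i, j) * (lin (?u i) \<omega> * lin (?u j) \<omega>))
      (\<Sum>i<k. \<Sum>j<k. Q $$ (i, j) * cov (?u i) (?u j))"
    by (intro has_bochner_integral_sum has_bochner_integral_mult_right second_moment) auto
  then show "has_bochner_integral M Y (mat_trace (Q * S))"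
   
    by (rule has_bochner_integral_transfer) (simp_all add: tr cov Y)
  have int: "has_bochner_integral M (\<lambda>\<omega>. \<Sum>i<k. \<Sum>j<k. \<Sum>l<k. \<Sum>m<k. Q $$ (i, j) * (Q $$ (l, m) *
        ((lin (?u i) \<omega> * lin (?u j) \<omega>) * (lin (?u l) \<omega> * lin (?u m) \<omega>))))
      (\<Sum>i<k. \<Sum>j<k. \<Sum>l<k. \<Sum>m<k. Q $$ (i, j) * (Q $$ (l, m) *
        (cov (?u i) (?u j) * cov (?u l) (?u m) + cov (?u i) (?u l) * cov (?u j) (?u m)
          + cov (?u i) (?u m) * cov (?u j) (?u l))))"
    by (intro has_bochner_integral_sum has_bochner_integral_mult_right fourth_moment) auto
  have pt: "(\<Sum>i<k. \<Sum>j<k. \<Sum>l<k. \<Sum>m<k. Q $$ (i, j) * (Q $$ (l, m) *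
        ((lin (?u i) \<omega> * lin (?u j) \<omega>) * (lin (?u l) \<omega> * lin (?u m) \<omega>)))) = (Y \<omega>)\<^sup>2"
    if "\<omega> \<in> space M" for \<omega>
    unfolding Y[OF that] power2_eq_square sum_distrib_right sum_distrib_left
    by (intro sum.cong refl) (simp only: mult_ac)
  have val: "(\<Sum>i<k. \<Sum>j<k. \<Sum>l<k. \<Sum>m<k. Q $$ (i, j) * (Q $$ (l, m) *
        (cov (?u i) (?u j) * cov (?u l) (?u m) + cov (?u i) (?u l) * cov (?u j) (?u m)
          + cov (?u i) (?u m) * cov (?u j) (?u l)))) =
      (mat_trace (Q * S))\<^sup>2 + 2 * mat_trace ((Q * S) * (Q * S))"
  proof -
    have QS: "Q * S \<in> carrier_mat k k" using Q S by auto
    have "mat_trace ((Q * S) * (Q * S)) =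
        (\<Sum>i<k. \<Sum>l<k. (\<Sum>j<k. Q $$ (i, j) * S $$ (j, l)) * (\<Sum>m<k. Q $$ (l, m) * S $$ (m, i)))"
      unfolding mat_trace_mult[OF QS QS]
      by (intro sum.cong refl) (simp add: mat_mult_entry[OF Q(1) S(1)])
    also have "\<dots> = (\<Sum>i<k. \<Sum>l<k. \<Sum>j<k. \<Sum>m<k. Q $$ (i, j) * (Q $$ (l, m) * (S $$ (i, m) * S $$ (j, l))))"
      unfolding sum_product by (intro sum.cong refl) (simp add: symS mult_ac)
    also have "\<dots> = (\<Sum>i<k. \<Sum>j<k. \<Sum>l<k. \<Sum>m<k. Q $$ (i, j) * (Q $$ (l, m) * (S $$ (i, m) * S $$ (j, l))))"
      by (rule sum.cong[OF refl sum.swap])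
    finally have t1: "mat_trace ((Q * S) * (Q * S)) = \<dots>" .
    also have "\<dots> = (\<Sum>i<k. \<Sum>j<k. \<Sum>m<k. \<Sum>l<k. Q $$ (i, j) * (Q $$ (l, m) * (S $$ (i, m) * S $$ (j, l))))"
      by (rule sum.cong[OF refl], rule sum.cong[OF refl sum.swap])
    also have "\<dots> = (\<Sum>i<k. \<Sum>j<k. \<Sum>m<k. \<Sum>l<k. Q $$ (i, j) * (Q $$ (m, l) * (S $$ (i, m) * S $$ (j, l))))"
      by (intro sum.cong refl) (simp add: symQ)
    finally have t2: "mat_trace ((Q * S) * (Q * S)) = \<dots>" .
    have t3: "(mat_trace (Q * S))\<^sup>2 = (\<Sum>i<k. \<Sum>j<k. \<Sum>l<k. \<Sum>m<k. Q $$ (i, j) * (Q $$ (l, m) * (S $$ (i, j) * S $$ (l, m))))"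
      unfolding tr power2_eq_square sum_distrib_right sum_distrib_left by (intro sum.cong refl) (simp only: mult_ac)
    have "(\<Sum>i<k. \<Sum>j<k. \<Sum>l<k. \<Sum>m<k. Q $$ (i, j) * (Q $$ (l, m) *
        (cov (?u i) (?u j) * cov (?u l) (?u m) + cov (?u i) (?u l) * cov (?u j) (?u m)
          + cov (?u i) (?u m) * cov (?u j) (?u l)))) =
      (\<Sum>i<k. \<Sum>j<k. \<Sum>l<k. \<Sum>m<k. Q $$ (i, j) * (Q $$ (l, m) * (S $$ (i, j) * S $$ (l, m)))
        + Q $$ (i, j) * (Q $$ (l, m) * (S $$ (i, l) * S $$ (j, m)))
        + Q $$ (i, j) * (Q $$ (l, m) * (S $$ (i, m) * S $$ (j, l))))"
      by (intro sum.cong refl) (simp add: cov distrib_left)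
    also have "\<dots> = (mat_trace (Q * S))\<^sup>2 + mat_trace ((Q * S) * (Q * S)) + mat_trace ((Q * S) * (Q * S))"
      unfolding sum.distrib by (simp only: t3 flip: t1 t2)
    finally show ?thesis by simp
  qed
  show "has_bochner_integral M (\<lambda>\<omega>. (Y \<omega>)\<^sup>2) ((mat_trace (Q * S))\<^sup>2 + 2 * mat_trace ((Q * S) * (Q * S)))"
    by (rule has_bochner_integral_transfer[OF int val pt])
qed

lemma quadratic_form_expectation_variance:
  assumes Q: "Q \<in> carrier_mat k k" "Q\<^sup>T = Q"
  defines "Y \<equiv> \<lambda>\<omega>. X \<omega> \<bullet> (Q *\<^sub>v X \<omega>)"
  shows "random_variable borel Y" "integrable M (\<lambda>\<omega>. (Y \<omega>)\<^sup>2)"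
    and "expectation Y = mat_trace (Q * S)"
    and "variance Y = 2 * mat_trace ((Q * S) * (Q * S))"
proof -
  note m = quadratic_form_moments[OF Q]
  show "random_variable borel Y" "integrable M (\<lambda>\<omega>. (Y \<omega>)\<^sup>2)" "expectation Y = mat_trace (Q * S)"
    unfolding Y_def using m by (auto simp: has_bochner_integral_iff)
  show "variance Y = 2 * mat_trace ((Q * S) * (Q * S))"
    unfolding Y_def using m by (subst variance_eq) (auto simp: has_bochner_integral_iff)
qed

end

section \<open>Kronecker products\<close>

lemma sum_div_mod:
  fixes f :: "nat \<Rightarrow> nat \<Rightarrow> 'b :: comm_monoid_add"
  shows "(\<Sum>l<a * b. f (l div b) (l mod b)) = (\<Sum>u<a. \<Sum>v<b. f u v)"
proof -
  have "(\<Sum>l<a * b. f (l div b) (l mod b)) = (\<Sum>(u, v)\<in>{..<a} \<times> {..<b}. f u v)"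
  proof (rule sum.reindex_bij_witness[where i = "\<lambda>(u, v). u * b + v" and j = "\<lambda>l. (l div b, l mod b)"])
    fix p assume "p \<in> {..<a} \<times> {..<b}"
    then obtain u v where p: "p = (u, v)" "u < a" "v < b" by auto
    then have "u * b + v < Suc u * b" by simp
    also have "\<dots> \<le> a * b" using p by (intro mult_right_mono) auto
    finally show "(case p of (u, v) \<Rightarrow> u * b + v) \<in> {..<a * b}" using p by simp
    show "((case p of (u, v) \<Rightarrow> u * b + v) div b, (case p of (u, v) \<Rightarrow> u * b + v) mod b) = p"
      using p by simp
  next
    fix l assume l: "l \<in> {..<a * b}"
    then have "0 < b" by (cases b) auto
    then show "(l div b, l mod b) \<in> {..<a} \<times> {..<b}"
      using l by (auto simp: less_mult_imp_div_less)
  qed auto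
  then show ?thesis by (simp add: sum.cartesian_product)
qed

lemma kron_carrier [simp]:
  "A \<in> carrier_mat a b \<Longrightarrow> B \<in> carrier_mat p q \<Longrightarrow> kron A B \<in> carrier_mat (a * p) (b * q)"
  by (auto simp: kron_def)

lemma kron_entry:
  assumes "A \<in> carrier_mat a b" "B \<in> carrier_mat p q" "i < a * p" "j < b * q"
  shows "kron A B $$ (i, j) = A $$ (i div p, j div q) * B $$ (i mod p, j mod q)"
  using assms by (auto simp: kron_def)

lemma kron_mult:
  assumes A: "A \<in> carrier_mat a b" and B: "B \<in> carrier_mat p q"
    and C: "C \<in> carrier_mat b c" and D: "D \<in> carrier_mat q r"
  shows "kron A B * kron C D = kron (A * C) (B * D)"
proof (rule eq_matI)
  fix i j assume "i < dim_row (kron (A * C) (B * D))" "j < dim_col (kron (A * C) (B * D))"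
  then have ij: "i < a * p" "j < c * r" using A B C D by (auto simp: kron_def)
  have ij': "i div p < a" "i mod p < p" "j div r < c" "j mod r < r"
    using ij by (auto simp: less_mult_imp_div_less intro!: mod_less_divisor gr0I)
  have "(kron A B * kron C D) $$ (i, j) = (\<Sum>l<b * q. kron A B $$ (i, l) * kron C D $$ (l, j))"
    using A B C D ij by (intro mat_mult_entry[of _ "a * p" _ _ "c * r"]) auto
  also have "\<dots> = (\<Sum>l<b * q. (\<lambda>u v. A $$ (i div p, u) * B $$ (i mod p, v) * (C $$ (u, j div r) * D $$ (v, j mod r)))
      (l div q) (l mod q))"
    using ij by (intro sum.cong refl) (simp add: kron_entry[OF A B] kron_entry[OF C D])
  also have "\<dots> = (\<Sum>u<b. \<Sum>v<q. A $$ (i div p, u) * B $$ (i mod p, v) * (C $$ (u, j div r) * D $$ (v, j mod r)))"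
    by (rule sum_div_mod)
  also have "\<dots> = (\<Sum>u<b. A $$ (i div p, u) * C $$ (u, j div r)) * (\<Sum>v<q. B $$ (i mod p, v) * D $$ (v, j mod r))"
    unfolding sum_product by (intro sum.cong refl) simp
  also have "\<dots> = kron (A * C) (B * D) $$ (i, j)"
    using ij ij' A B C D
    by (simp add: kron_entry[of _ a c _ p r] mat_mult_entry[OF A C] mat_mult_entry[OF B D] del: index_mult_mat(1))
  finally show "(kron A B * kron C D) $$ (i, j) = kron (A * C) (B * D) $$ (i, j)" .
qed (use A B C D in \<open>auto simp: kron_def\<close>)

lemma kron_one: "kron (1\<^sub>m a) (1\<^sub>m b) = 1\<^sub>m (a * b)"
proof (rule eq_matI)
  fix i j assume "i < dim_row (1\<^sub>m (a * b))" "j < dim_col (1\<^sub>m (a * b))"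
  then have ij: "i < a * b" "j < a * b" by auto
  then have "i div b < a" "i mod b < b" "j div b < a" "j mod b < b"
    by (auto simp: less_mult_imp_div_less intro!: mod_less_divisor gr0I)
  moreover have "i = j \<longleftrightarrow> i div b = j div b \<and> i mod b = j mod b" by (metis div_mult_mod_eq)
  ultimately show "kron (1\<^sub>m a) (1\<^sub>m b) $$ (i, j) = 1\<^sub>m (a * b) $$ (i, j)"
    using ij by (simp add: kron_entry[of _ a a _ b b])
qed (auto simp: kron_def)

lemma kron_transpose:
  assumes A: "A \<in> carrier_mat a b" and B: "B \<in> carrier_mat p q"
  shows "(kron A B)\<^sup>T = kron (A\<^sup>T) (B\<^sup>T)"
proof (rule eq_matI)
  fix i j assume "i < dim_row (kron (A\<^sup>T) (B\<^sup>T))" "j < dim_col (kron (A\<^sup>T) (B\<^sup>T))"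
  then have ij: "i < b * q" "j < a * p" using A B by (auto simp: kron_def)
  then have "i div q < b" "i mod q < q" "j div p < a" "j mod p < p"
    by (auto simp: less_mult_imp_div_less intro!: mod_less_divisor gr0I)
  then show "(kron A B)\<^sup>T $$ (i, j) = kron (A\<^sup>T) (B\<^sup>T) $$ (i, j)"
    using ij A B by (simp add: kron_def)
qed (use A B in \<open>auto simp: kron_def\<close>)

lemma mat_trace_kron:
  assumes A: "A \<in> carrier_mat a a" and B: "B \<in> carrier_mat b b"
  shows "mat_trace (kron A B) = mat_trace A * mat_trace B"
proof -
  have "mat_trace (kron A B) = (\<Sum>l<a * b. (\<lambda>u v. A $$ (u, u) * B $$ (v, v)) (l div b) (l mod b))"
    unfolding mat_trace_def using A B by (intro sum.cong) (auto simp: kron_def)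
  also have "\<dots> = (\<Sum>u<a. \<Sum>v<b. A $$ (u, u) * B $$ (v, v))" by (rule sum_div_mod)
  finally show ?thesis using A B by (simp add: mat_trace_def sum_product)
qed

lemma kron_upto_cong: "(\<And>t. t \<in> {1..d} \<Longrightarrow> F t = G t) \<Longrightarrow> kron_upto F d = kron_upto G d"
  by (induction d) auto

lemma kron_upto_mult:
  assumes "\<And>t. t \<in> {1..d} \<Longrightarrow> F t \<in> carrier_mat n n" "\<And>t. t \<in> {1..d} \<Longrightarrow> G t \<in> carrier_mat n n"
  shows "kron_upto F d * kron_upto G d = kron_upto (\<lambda>t. F t * G t) d"
  using assms
proof (induction d)
  case (Suc d)
  have F: "kron_upto F d \<in> carrier_mat (n ^ d) (n ^ d)" and G: "kron_upto G d \<in> carrier_mat (n ^ d) (n ^ d)"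
    using Suc.prems by (auto intro!: dim_kron_upto)
  have "kron_upto F (Suc d) * kron_upto G (Suc d) =
      kron (kron_upto F d * kron_upto G d) (F (Suc d) * G (Suc d))"
    using kron_mult[OF F _ G, of "F (Suc d)" n n "G (Suc d)" n] Suc.prems by simp
  then show ?case using Suc by simp
qed simp

lemma kron_upto_one: "kron_upto (\<lambda>t. 1\<^sub>m n) d = 1\<^sub>m (n ^ d)"
  by (induction d) (auto simp: kron_one mult.commute)

lemma kron_upto_transpose:
  assumes "\<And>t. t \<in> {1..d} \<Longrightarrow> F t \<in> carrier_mat n n"
  shows "(kron_upto F d)\<^sup>T = kron_upto (\<lambda>t. (F t)\<^sup>T) d"
  using assms
proof (induction d)
  case (Suc d)
  have F: "kron_upto F d \<in> carrier_mat (n ^ d) (n ^ d)"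
    using Suc.prems by (auto intro!: dim_kron_upto)
  show ?case using kron_transpose[OF F, of "F (Suc d)" n n] Suc by simp
qed simp

lemma mat_trace_kron_upto:
  assumes "\<And>t. t \<in> {1..d} \<Longrightarrow> F t \<in> carrier_mat n n"
  shows "mat_trace (kron_upto F d) = (\<Prod>t=1..d. mat_trace (F t))"
  using assms
proof (induction d)
  case (Suc d)
  have F: "kron_upto F d \<in> carrier_mat (n ^ d) (n ^ d)"
    using Suc.prems by (auto intro!: dim_kron_upto)
  show ?case using mat_trace_kron[OF F, of "F (Suc d)" n] Suc by simp
qed simp

lemma inv_mat_eqI:
  assumes "A \<in> carrier_mat n n" "B \<in> carrier_mat n n" "A * B = 1\<^sub>m n" "B * A = 1\<^sub>m n"
  shows "inv_mat A = B"
proof -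
  have "A \<in> Units (ring_mat TYPE(real) n ())" using assms by (auto simp: Units_def ring_mat_def)
  then obtain C where C: "mat_inverse A = Some C" using mat_inverse(1)[OF assms(1), of "()"] by (cases "mat_inverse A") auto
  then have "C \<in> carrier_mat n n" "A * C = 1\<^sub>m n" using mat_inverse(2)[OF assms(1) C] by auto
  then have "B * (A * C) = B" "(B * A) * C = C" using assms by auto
  moreover have "(B * A) * C = B * (A * C)"
    using assms \<open>C \<in> carrier_mat n n\<close> by (intro assoc_mult_mat[of _ n n _ n _ n]) auto
  ultimately show ?thesis by (simp add: inv_mat_def C)
qed

lemma inv_mat_kron_upto:
  assumes "\<And>t. t \<in> {1..d} \<Longrightarrow> F t \<in> carrier_mat n n" "\<And>t. t \<in> {1..d} \<Longrightarrow> P t \<in> carrier_mat n n"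
    and "\<And>t. t \<in> {1..d} \<Longrightarrow> F t * P t = 1\<^sub>m n" "\<And>t. t \<in> {1..d} \<Longrightarrow> P t * F t = 1\<^sub>m n"
  shows "inv_mat (kron_upto F d) = kron_upto P d"
proof (rule inv_mat_eqI)
  have "kron_upto F d * kron_upto P d = kron_upto (\<lambda>t. F t * P t) d"
    by (rule kron_upto_mult) (use assms in auto)
  also have "\<dots> = kron_upto (\<lambda>t. 1\<^sub>m n) d" using assms by (intro kron_upto_cong) auto
  finally show "kron_upto F d * kron_upto P d = 1\<^sub>m (n ^ d)" by (simp add: kron_upto_one)
  have "kron_upto P d * kron_upto F d = kron_upto (\<lambda>t. P t * F t) d"
    by (rule kron_upto_mult) (use assms in auto)
  also have "\<dots> = kron_upto (\<lambda>t. 1\<^sub>m n) d" using assms by (intro kron_upto_cong) auto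
  finally show "kron_upto P d * kron_upto F d = 1\<^sub>m (n ^ d)" by (simp add: kron_upto_one)
qed (use assms in \<open>auto intro!: dim_kron_upto\<close>)

section \<open>Whitening the covariance of one coordinate\<close>

definition decay :: "real \<Rightarrow> nat \<Rightarrow> real" where
  "decay a n = exp (- (a / real n))"

text \<open>
  The covariance at lag \<open>m / n\<close>, divided by \<open>a\<^sup>3\<close>: the expansion \<open>(1 + u) exp (-u) = 1 - u\<^sup>2 / 2 + u\<^sup>3 / 3 + \<dots>\<close>
  shows that its leading singular term \<open>\<bar>h\<bar>\<^sup>3 / 3\<close> at lag \<open>h\<close> then is free of \<open>a\<close>.
\<close>
definition scaled_cov :: "real \<Rightarrow> nat \<Rightarrow> nat \<Rightarrow> real" where
  "scaled_cov a n m = decay a n ^ m * (1 + real m * (a / real n)) / a ^ 3"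

definition scaled_corr_mat :: "real \<Rightarrow> nat \<Rightarrow> real mat" where
  "scaled_corr_mat a n = (1 / a ^ 3) \<cdot>\<^sub>m corr_mat a n"

text \<open>
  The reciprocals of the orders of magnitude of a value, of a first difference and of a second
  difference of the once differentiable process.
\<close>
definition innov_scale :: "nat \<Rightarrow> nat \<Rightarrow> real" where
  "innov_scale n i = (if i = 0 then 1 else if i = 1 then real n else real n * sqrt (real n))"

text \<open>
  The covariance at lag \<open>m\<close> is \<open>\<rho>\<^sup>m\<close> times a linear function of \<open>m\<close>, so \<open>1 - 2 \<rho> B + \<rho>\<^sup>2 B\<^sup>2\<close>, with \<open>B\<close> the
  backward shift, annihilates it. The first two observations lack predecessors; the second is only made
  uncorrelated with the first, by subtracting its regression, whose coefficient is the correlation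
  \<open>(1 + a / n) \<rho>\<close>.
\<close>
definition ar_filter :: "real \<Rightarrow> nat \<Rightarrow> (nat \<Rightarrow> real) \<Rightarrow> nat \<Rightarrow> real" where
  "ar_filter a n f i =
    (if i = 0 then f 0
     else if i = 1 then f 1 - (1 + a / real n) * decay a n * f 0
     else f i - 2 * decay a n * f (i - 1) + (decay a n)\<^sup>2 * f (i - 2))"

definition whitening_mat :: "real \<Rightarrow> nat \<Rightarrow> real mat" where
  "whitening_mat a n = mat n n (\<lambda>(i, k). innov_scale n i * ar_filter a n (\<lambda>l. if l = k then 1 else 0) i)"

text \<open>
  Column \<open>j\<close> is the sequence whose filtered and rescaled version is the unit impulse at \<open>j\<close>, so these are
  the entries of the inverse of the whitening matrix.
\<close>
definition response :: "real \<Rightarrow> nat \<Rightarrow> nat \<Rightarrow> nat \<Rightarrow> real" where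
  "response a n i j =
    (if i < j then 0
     else if j = 0 then decay a n ^ i * (1 + real i * (a / real n))
     else real (i - j + 1) * decay a n ^ (i - j) / innov_scale n j)"

definition response_mat :: "real \<Rightarrow> nat \<Rightarrow> real mat" where
  "response_mat a n = mat n n (\<lambda>(i, j). response a n i j)"

text \<open>
  The covariance of two consecutive filtered differences, scaled to order one. It reduces to that of
  one filtered difference with one observation, which is \<open>c 1 - 2 \<rho> c 0 + \<rho>\<^sup>2 c 1\<close> for \<open>c = scaled_cov a n\<close>.
\<close>
definition ma_cov1 :: "real \<Rightarrow> nat \<Rightarrow> real" where
  "ma_cov1 a n = real n ^ 3 * (2 * scaled_cov a n 1 - 2 * decay a n * scaled_cov a n 0
      + ((decay a n)\<^sup>2 - 1) * scaled_cov a n 1)"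

text \<open>
  The variance of a filtered difference, on the same scale.
\<close>
definition ma_cov0 :: "real \<Rightarrow> nat \<Rightarrow> real" where
  "ma_cov0 a n = real n ^ 3 * (scaled_cov a n 0 - 2 * decay a n * scaled_cov a n 1
      + (decay a n)\<^sup>2 * scaled_cov a n 2) - 2 * decay a n * ma_cov1 a n"

definition start_var :: "real \<Rightarrow> nat \<Rightarrow> real" where
  "start_var a n = real n ^ 2 * (scaled_cov a n 0 - (1 + a / real n) * decay a n * scaled_cov a n 1)"

definition innov_cov :: "real \<Rightarrow> nat \<Rightarrow> nat \<Rightarrow> nat \<Rightarrow> real" where
  "innov_cov a n i k =
    (if i = k then (if i = 0 then 1 / a ^ 3 else if i = 1 then start_var a n else ma_cov0 a n)
     else if i = 0 \<or> k = 0 then 0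
     else if i = Suc k \<or> k = Suc i then (if i = 1 \<or> k = 1 then ma_cov1 a n / sqrt (real n) else ma_cov1 a n)
     else 0)"

definition innov_cov_mat :: "real \<Rightarrow> nat \<Rightarrow> real mat" where
  "innov_cov_mat a n = mat n n (\<lambda>(i, k). innov_cov a n i k)"

lemma mat_carriers [simp]:
  "corr_mat a n \<in> carrier_mat n n" "scaled_corr_mat a n \<in> carrier_mat n n"
  "whitening_mat a n \<in> carrier_mat n n" "response_mat a n \<in> carrier_mat n n"
  "innov_cov_mat a n \<in> carrier_mat n n"
  by (auto simp: corr_mat_def scaled_corr_mat_def whitening_mat_def response_mat_def innov_cov_mat_def)

lemma corr_mat_transpose: "(corr_mat a n)\<^sup>T = corr_mat a n"
  by (intro eq_matI) (auto simp: corr_mat_def abs_minus_commute)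

lemma scaled_corr_mat_entry:
  assumes "i < n" "k < n"
  shows "scaled_corr_mat a n $$ (i, k) = scaled_cov a n (if k \<le> i then i - k else k - i)"
proof -
  have "corr_mat a n $$ (i, k) = (1 + a * real (if k \<le> i then i - k else k - i) / real n)
      * exp (- a * real (if k \<le> i then i - k else k - i) / real n)"
    using assms by (simp add: corr_mat_def of_nat_diff)
  moreover have "exp (- a * real m / real n) = decay a n ^ m" for m
    by (simp add: decay_def flip: exp_of_nat_mult)
  ultimately show ?thesis
    using assms by (simp add: scaled_corr_mat_def scaled_cov_def corr_mat_def mult_ac)
qed

lemma scaled_corr_mat_transpose: "(scaled_corr_mat a n)\<^sup>T = scaled_corr_mat a n"
  by (intro eq_matI) (auto simp: scaled_corr_mat_def corr_mat_def abs_minus_commute)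

lemma innov_cov_mat_transpose: "(innov_cov_mat a n)\<^sup>T = innov_cov_mat a n"
  by (intro eq_matI) (auto simp: innov_cov_mat_def innov_cov_def)

text \<open>
  The entries of the whitening matrix are defined by filtering unit impulses, so this is the linearity of
  the filter.
\<close>
lemma whitening_mat_apply:
  assumes i: "i < n"
  shows "(\<Sum>k<n. whitening_mat a n $$ (i, k) * f k) = innov_scale n i * ar_filter a n f i"
proof -
  have delta: "(\<Sum>k<n. (if l = k then 1 else 0) * f k) = f l" if "l < n" for l
    using that by (simp add: if_distrib[of "\<lambda>c. c * f _"] cong: if_cong)
  have "ar_filter a n f i = (\<Sum>k<n. ar_filter a n (\<lambda>l. if l = k then 1 else 0) i * f k)"
  proof (cases "i = 0 \<or> i = 1")
    case True
    then show ?thesis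
    proof
      assume "i = 0"
      then show ?thesis using delta[of 0] i by (simp add: ar_filter_def)
    next
      assume "i = 1"
      then have "(\<Sum>k<n. ar_filter a n (\<lambda>l. if l = k then 1 else 0) i * f k) =
          (\<Sum>k<n. (if 1 = k then 1 else 0) * f k) - (1 + a / real n) * decay a n * (\<Sum>k<n. (if 0 = k then 1 else 0) * f k)"
        by (simp only: sum_distrib_left sum_subtractf[symmetric]) (simp add: ar_filter_def left_diff_distrib mult.assoc)
      also have "\<dots> = ar_filter a n f i"
        using delta[of 0] delta[of 1] i \<open>i = 1\<close> by (simp add: ar_filter_def)
      finally show ?thesis ..
    qed
  next
    case False
    then have "(\<Sum>k<n. ar_filter a n (\<lambda>l. if l = k then 1 else 0) i * f k) =
        (\<Sum>k<n. (if i = k then 1 else 0) * f k) - 2 * decay a n * (\<Sum>k<n. (if i - 1 = k then 1 else 0) * f k)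
        + (decay a n)\<^sup>2 * (\<Sum>k<n. (if i - 2 = k then 1 else 0) * f k)"
      by (simp only: sum_distrib_left sum_subtractf[symmetric] sum.distrib[symmetric])
         (simp add: ar_filter_def left_diff_distrib distrib_right mult.assoc)
    also have "\<dots> = ar_filter a n f i"
      using delta[of i] delta[of "i - 1"] delta[of "i - 2"] i False by (simp add: ar_filter_def)
    finally show ?thesis ..
  qed
  then show ?thesis
    using i by (simp add: whitening_mat_def sum_distrib_left mult.assoc)
qed

lemma ar_filter_response:
  assumes n: "0 < n"
  shows "innov_scale n i * ar_filter a n (\<lambda>l. response a n l j) i = (if i = j then 1 else 0)"
proof -
  have w: "innov_scale n i \<noteq> 0" for i using n by (simp add: innov_scale_def)
  have "i < j \<or> i = j \<or> (i = 1 \<and> j = 0) \<or> (1 < i \<and> j = 0) \<or> (1 \<le> j \<and> i = Suc j) \<or> (1 \<le> j \<and> j + 2 \<le> i)"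
    by arith
  then consider "i < j" | "i = j" | "i = 1" "j = 0" | "1 < i" "j = 0" | "1 \<le> j" "i = Suc j" | "1 \<le> j" "j + 2 \<le> i"
    by blast
  then show ?thesis
  proof cases
    case 1
    then show ?thesis by (auto simp: ar_filter_def response_def)
  next
    case 2
    then show ?thesis using w[of i] n by (auto simp: ar_filter_def response_def innov_scale_def)
  next
    case 3
    then show ?thesis by (simp add: ar_filter_def response_def)
  next
    case 4
    define m where "m = i - 2"
    have i: "i = Suc (Suc m)" using 4 by (simp add: m_def)
    have r: "response a n l j = (1 + real l * (a / real n)) * decay a n ^ l" for l
      using 4 by (simp add: response_def mult.commute)
    have "(1 + real (Suc (Suc m)) * t) * r ^ Suc (Suc m) - 2 * r * ((1 + real (Suc m) * t) * r ^ Suc m)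
        + r\<^sup>2 * ((1 + real m * t) * r ^ m) = 0" for t r :: real
      by (simp add: algebra_simps power2_eq_square)
    then have "ar_filter a n (\<lambda>l. response a n l j) i = 0"
      unfolding ar_filter_def r i diff_Suc_1 numeral_2_eq_2 diff_Suc_Suc diff_zero by (simp only: numeral_2_eq_2) simp
    then show ?thesis using 4 by simp
  next
    case 5
    then show ?thesis by (simp add: ar_filter_def response_def)
  next
    case 6
    define m where "m = i - 2 - j"
    have i: "i = Suc (Suc m) + j" using 6 by (simp add: m_def)
    have r: "response a n (l + j) j = real (l + 1) * decay a n ^ l / innov_scale n j" for l
      using 6 by (simp add: response_def)
    have "ar_filter a n (\<lambda>l. response a n l j) i = response a n (Suc (Suc m) + j) j
        - 2 * decay a n * response a n (Suc m + j) j + (decay a n)\<^sup>2 * response a n (m + j) j"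
      by (simp add: ar_filter_def i)
    also have "\<dots> = (real (Suc (Suc m) + 1) * decay a n ^ Suc (Suc m) - 2 * decay a n * (real (Suc m + 1) * decay a n ^ Suc m)
        + (decay a n)\<^sup>2 * (real (m + 1) * decay a n ^ m)) / innov_scale n j"
      unfolding r by (simp add: diff_divide_distrib add_divide_distrib)
    also have "real (Suc (Suc m) + 1) * decay a n ^ Suc (Suc m) - 2 * decay a n * (real (Suc m + 1) * decay a n ^ Suc m)
        + (decay a n)\<^sup>2 * (real (m + 1) * decay a n ^ m) = 0"
      by (simp add: algebra_simps power2_eq_square)
    finally show ?thesis using 6 by simp
  qed
qed

lemma whitening_response:
  assumes "0 < n"
  shows "whitening_mat a n * response_mat a n = 1\<^sub>m n" "response_mat a n * whitening_mat a n = 1\<^sub>m n"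
proof -
  show *: "whitening_mat a n * response_mat a n = 1\<^sub>m n"
  proof (rule eq_matI)
    fix i j assume "i < dim_row (1\<^sub>m n)" "j < dim_col (1\<^sub>m n)"
    then have ij: "i < n" "j < n" by auto
    have "(whitening_mat a n * response_mat a n) $$ (i, j) =
        (\<Sum>k<n. whitening_mat a n $$ (i, k) * response a n k j)"
      using ij by (subst mat_mult_entry[of _ n n _ n]) (auto simp: response_mat_def)
    then show "(whitening_mat a n * response_mat a n) $$ (i, j) = 1\<^sub>m n $$ (i, j)"
      using ij assms by (simp add: whitening_mat_apply ar_filter_response)
  qed (simp_all add: whitening_mat_def response_mat_def)
  show "response_mat a n * whitening_mat a n = 1\<^sub>m n"
    by (rule mat_mult_left_right_inverse[OF _ _ *]) simp_all
qed

text \<open>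
  The covariances of the filtered process with the process itself. A filtered difference is uncorrelated
  with everything two or more steps in the past, because the covariance solves the recurrence there; the
  kink of the covariance at lag \<open>0\<close> spoils this for the last two observations.
\<close>
lemma ar_filter_cov:
  fixes a n
  defines "U \<equiv> \<lambda>i j. ar_filter a n (\<lambda>l. scaled_cov a n (if j \<le> l then l - j else j - l)) i"
  shows "U 0 0 = scaled_cov a n 0" "U 1 0 = 0"
    and "U 1 1 = scaled_cov a n 0 - (1 + a / real n) * decay a n * scaled_cov a n 1"
    and "2 \<le> i \<Longrightarrow> j + 2 \<le> i \<Longrightarrow> U i j = 0"
    and "1 \<le> j \<Longrightarrow> U (Suc j) j = 2 * scaled_cov a n 1 - 2 * decay a n * scaled_cov a n 0 + ((decay a n)\<^sup>2 - 1) * scaled_cov a n 1"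
    and "2 \<le> i \<Longrightarrow> U i i = scaled_cov a n 0 - 2 * decay a n * scaled_cov a n 1 + (decay a n)\<^sup>2 * scaled_cov a n 2"
proof -
  show "U 0 0 = scaled_cov a n 0" "U 1 0 = 0"
    "U 1 1 = scaled_cov a n 0 - (1 + a / real n) * decay a n * scaled_cov a n 1"
    by (simp_all add: U_def ar_filter_def scaled_cov_def)
  show "U i j = 0" if "2 \<le> i" "j + 2 \<le> i"
  proof -
    define m where "m = i - 2 - j"
    have i: "i = Suc (Suc m) + j" using that by (simp add: m_def)
    then have "U i j = scaled_cov a n (Suc (Suc m)) - 2 * decay a n * scaled_cov a n (Suc m) + (decay a n)\<^sup>2 * scaled_cov a n m"
      by (simp add: U_def ar_filter_def Suc_diff_le)
    also have "\<dots> = 0"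
      by (simp add: scaled_cov_def algebra_simps power2_eq_square flip: diff_divide_distrib add_divide_distrib)
    finally show ?thesis .
  qed
  show "U (Suc j) j = 2 * scaled_cov a n 1 - 2 * decay a n * scaled_cov a n 0 + ((decay a n)\<^sup>2 - 1) * scaled_cov a n 1"
    if "1 \<le> j"
  proof -
    have "\<not> j \<le> j - 1" "j - (j - 1) = 1" "Suc j - j = 1" "Suc j - 2 = j - 1" "Suc j \<noteq> 1" using that by auto
    then show ?thesis
      unfolding U_def ar_filter_def by (simp add: left_diff_distrib)
  qed
  show "U i i = scaled_cov a n 0 - 2 * decay a n * scaled_cov a n 1 + (decay a n)\<^sup>2 * scaled_cov a n 2" if "2 \<le> i"
  proof -
    have "\<not> i \<le> i - 1" "\<not> i \<le> i - 2" "i - (i - 1) = 1" "i - (i - 2) = 2" "i \<noteq> 1" "i \<noteq> 0" using that by auto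
    then show ?thesis
      unfolding U_def ar_filter_def by simp
  qed
qed

text \<open>
  By symmetry only entries below and on the diagonal matter, and there the second filter only meets
  covariances of a filtered difference with its present and past, nearly all of which vanish.
\<close>
lemma whitened_covariance:
  assumes n: "0 < n"
  shows "whitening_mat a n * (scaled_corr_mat a n * (whitening_mat a n)\<^sup>T) = innov_cov_mat a n"
proof -
  let ?L = "whitening_mat a n" and ?S = "scaled_corr_mat a n" and ?Z = "innov_cov_mat a n"
  let ?W = "?L * (?S * ?L\<^sup>T)"
  define U where "U i j = ar_filter a n (\<lambda>l. scaled_cov a n (if j \<le> l then l - j else j - l)) i" for i j
  note U = ar_filter_cov[where a = a and n = n, folded U_def]
  have LS: "?L * ?S \<in> carrier_mat n n" and SL: "?S * ?L\<^sup>T \<in> carrier_mat n n"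
    by (rule mult_carrier_mat[of _ n n]; simp)+
  have Wc: "?W \<in> carrier_mat n n" by (rule mult_carrier_mat[OF _ SL]) simp
  have WT: "?W\<^sup>T = ?W"
  proof -
    have "?W\<^sup>T = (?L * ?S) * ?L\<^sup>T"
      using transpose_mult[OF _ SL, of ?L n] transpose_mult[of ?S n n "?L\<^sup>T" n]
      by (simp add: scaled_corr_mat_transpose)
    then show ?thesis by (simp add: assoc_mult_mat[of _ n n _ n _ n])
  qed
  have W: "?W $$ (i, k) = innov_scale n i * innov_scale n k * ar_filter a n (U i) k" if ik: "i < n" "k < n" for i k
  proof -
    have LSe: "(?L * ?S) $$ (i, j) = innov_scale n i * U i j" if "j < n" for j
    proof -
      have "(?L * ?S) $$ (i, j) = (\<Sum>l<n. ?L $$ (i, l) * scaled_cov a n (if j \<le> l then l - j else j - l))"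
        using ik that by (subst mat_mult_entry[of _ n n _ n]) (auto simp: scaled_corr_mat_entry intro!: sum.cong)
      then show ?thesis using ik by (simp add: whitening_mat_apply U_def)
    qed
    have "?W $$ (i, k) = ((?L * ?S) * ?L\<^sup>T) $$ (i, k)"
      by (simp add: assoc_mult_mat[of _ n n _ n _ n])
    also have "\<dots> = (\<Sum>j<n. (?L * ?S) $$ (i, j) * ?L\<^sup>T $$ (j, k))"
      using ik by (intro mat_mult_entry[of _ n n _ n]) (auto simp: LS)
    also have "\<dots> = innov_scale n i * (\<Sum>j<n. ?L $$ (k, j) * U i j)"
      using ik by (auto simp: LSe sum_distrib_left mult_ac intro!: sum.cong) (simp add: whitening_mat_def)
    finally show ?thesis using ik by (simp add: whitening_mat_apply)
  qed
  have scale: "innov_scale n 1 * innov_scale n 1 = real n ^ 2"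
    "2 \<le> i \<Longrightarrow> 2 \<le> k \<Longrightarrow> innov_scale n i * innov_scale n k = real n ^ 3"
    "innov_scale n 2 * innov_scale n 1 = real n ^ 3 / sqrt (real n)" for i k
    using n by (simp_all add: innov_scale_def power2_eq_square power3_eq_cube field_simps)
  have low: "?W $$ (i, k) = innov_cov a n i k" if ik: "i < n" "k \<le> i" for i k
  proof -
    consider "k = 0" "i = 0" | "k = 0" "i = 1" | "k = 0" "2 \<le> i" | "k = 1" "i = 1" | "k = 1" "i = 2" | "k = 1" "3 \<le> i"
      | "2 \<le> k" "i = k" | "2 \<le> k" "i = Suc k" | "2 \<le> k" "k + 2 \<le> i"
    proof -
      have "i = 0 \<or> i = 1 \<or> 2 \<le> i" "k = 0 \<or> k = 1 \<or> 2 \<le> k" "k = 1 \<Longrightarrow> i = 1 \<or> i = 2 \<or> 3 \<le> i"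
        "i = k \<or> i = Suc k \<or> k + 2 \<le> i"
        using ik by linarith+
      then show ?thesis using that by blast
    qed
    then show ?thesis
    proof cases
      case 1
      then show ?thesis using ik U(1) W[of 0 0]
        by (simp add: ar_filter_def innov_cov_def innov_scale_def scaled_cov_def)
    next
      case 2
      then show ?thesis using ik U(2) W[of 1 0] by (simp add: ar_filter_def innov_cov_def)
    next
      case 3
      then show ?thesis using ik U(4)[of i 0] W[of i 0] by (simp add: ar_filter_def innov_cov_def)
    next
      case 4
      then show ?thesis using ik U(2,3) W[of 1 1] scale(1)
        by (simp add: ar_filter_def innov_cov_def start_var_def)
    next
      case 5
      then have "?W $$ (i, k) = real n ^ 3 / sqrt (real n) * U 2 1"
        using ik U(4)[of 2 0] W[of 2 1] scale(3) by (simp add: ar_filter_def)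
      then show ?thesis using 5 U(5)[of 1] by (simp add: innov_cov_def ma_cov1_def numeral_2_eq_2)
    next
      case 6
      then show ?thesis using ik U(4)[of i 0] U(4)[of i 1] W[of i 1]
        by (simp add: ar_filter_def innov_cov_def)
    next
      case 7
      then have "Suc (i - 1) = i" "1 \<le> i - 1" by auto
      then have "U i (i - 1) = 2 * scaled_cov a n 1 - 2 * decay a n * scaled_cov a n 0 + ((decay a n)\<^sup>2 - 1) * scaled_cov a n 1"
        using U(5)[of "i - 1"] by simp
      moreover have "U i (i - 2) = 0" using 7 by (intro U(4)) auto
      ultimately have "ar_filter a n (U i) i = U i i - 2 * decay a n * (2 * scaled_cov a n 1
          - 2 * decay a n * scaled_cov a n 0 + ((decay a n)\<^sup>2 - 1) * scaled_cov a n 1)"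
        using 7 by (simp add: ar_filter_def)
      moreover have "?W $$ (i, k) = real n ^ 3 * ar_filter a n (U i) i"
        using 7 ik W[of i i] scale(2)[of i i] by simp
      moreover have "N * (x - 2 * r * y) = N * x - 2 * r * (N * y)" for N x r y :: real
        by (simp add: algebra_simps)
      ultimately have "?W $$ (i, k) = ma_cov0 a n"
        using 7 U(6)[of i] by (simp only: ma_cov0_def ma_cov1_def)
      then show ?thesis using 7 by (simp add: innov_cov_def)
    next
      case 8
      then have "U i (k - 1) = 0" "U i (k - 2) = 0" by (auto intro!: U(4))
      then have "?W $$ (i, k) = ma_cov1 a n"
        using 8 ik U(5)[of k] W[of i k] scale(2)[of i k] by (simp add: ar_filter_def ma_cov1_def)
      then show ?thesis using 8 by (simp add: innov_cov_def)
    next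
      case 9
      then have "U i k = 0" "U i (k - 1) = 0" "U i (k - 2) = 0" by (auto intro!: U(4))
      then have "?W $$ (i, k) = 0" using 9 ik W[of i k] by (simp add: ar_filter_def)
      then show ?thesis using 9 by (simp add: innov_cov_def)
    qed
  qed
  have sym: "innov_cov a n i k = innov_cov a n k i" for i k by (auto simp: innov_cov_def)
  have "?W $$ (i, k) = innov_cov a n i k" if "i < n" "k < n" for i k
  proof (cases "k \<le> i")
    case False
    then have "?W $$ (i, k) = ?W\<^sup>T $$ (k, i)"
      using that carrier_matD[OF Wc] by simp
    then show ?thesis using WT low[of k i] sym that False by simp
  qed (use low that in simp)
  then show ?thesis using carrier_matD[OF Wc]
    by (intro eq_matI) (simp_all add: innov_cov_mat_def del: index_mult_mat)
qed

lemma mat_mult_regroup: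
  fixes A B C D E :: "real mat"
  assumes "A \<in> carrier_mat n n" "B \<in> carrier_mat n n" "C \<in> carrier_mat n n" "D \<in> carrier_mat n n" "E \<in> carrier_mat n n"
  shows "A * ((B * (C * D)) * E) = (A * B) * (C * (D * E))"
  using assms by (simp add: assoc_mult_mat[of _ n n _ n _ n])

lemma scaled_corr_mat_factorization:
  assumes n: "0 < n"
  shows "scaled_corr_mat a n = response_mat a n * (innov_cov_mat a n * (response_mat a n)\<^sup>T)"
proof -
  let ?L = "whitening_mat a n" and ?S = "scaled_corr_mat a n" and ?G = "response_mat a n"
  have LGT: "?L\<^sup>T * ?G\<^sup>T = 1\<^sub>m n"
    using transpose_mult[of ?G n n ?L n] whitening_response(2)[OF n, of a] by simp
  have "?G * (innov_cov_mat a n * ?G\<^sup>T) = ?G * ((?L * (?S * ?L\<^sup>T)) * ?G\<^sup>T)"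
    by (simp add: whitened_covariance[OF n])
  also have "\<dots> = (?G * ?L) * (?S * (?L\<^sup>T * ?G\<^sup>T))"
    by (rule mat_mult_regroup[of _ n]) simp_all
  also have "\<dots> = ?S"
    by (simp add: LGT whitening_response[OF n] left_mult_one_mat[of _ n n] right_mult_one_mat[of _ n n])
  finally show ?thesis ..
qed

section \<open>The whitened covariance as the grid is refined\<close>

lemma filterlim_step:
  assumes "0 < a"
  shows "filterlim (\<lambda>n. a / real n) (at_right 0) sequentially"
proof -
  have "((\<lambda>n. a / real n) \<longlongrightarrow> 0) sequentially" by (rule lim_const_over_n)
  moreover have "eventually (\<lambda>n. a / real n \<in> {0<..} \<and> a / real n \<noteq> 0) sequentially"
    using eventually_gt_at_top[of 0] by eventually_elim (use assms in simp)
  ultimately show ?thesis unfolding filterlim_at by blast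
qed

text \<open>
  All quantities below are functions of the single step size \<open>a / n\<close>, and their expansions in that variable
  at \<open>0\<close> have numerical coefficients.
\<close>
lemma bigo_step:
  fixes F :: "real \<Rightarrow> real"
  assumes a: "0 < a" and F: "F \<in> O[at_right 0](\<lambda>t. t)" and eq: "\<And>n. 0 < n \<Longrightarrow> f n = F (a / real n)"
  shows "f \<in> O(\<lambda>n. 1 / real n)"
proof -
  have "(\<lambda>n. F (a / real n)) \<in> O(\<lambda>n. a / real n)"
    by (rule landau_o.big.compose[OF F filterlim_step[OF a]])
  moreover have "(\<lambda>n. a / real n) \<in> O(\<lambda>n. 1 / real n)"
    by (rule bigoI[of _ "\<bar>a\<bar>"]) simp
  ultimately have "(\<lambda>n. F (a / real n)) \<in> O(\<lambda>n. 1 / real n)" by (rule landau_o.big.trans)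
  moreover have ev: "eventually (\<lambda>n. f n = F (a / real n)) sequentially"
    using eventually_gt_at_top[of 0] by eventually_elim (rule eq)
  ultimately show ?thesis by (simp only: landau_o.big.in_cong[OF ev])
qed

lemma scaled_cov_values:
  "scaled_cov a n 0 = 1 / a ^ 3"
  "scaled_cov a n 1 = decay a n * (1 + a / real n) / a ^ 3"
  "scaled_cov a n 2 = (decay a n)\<^sup>2 * (1 + 2 * (a / real n)) / a ^ 3"
  by (simp_all add: scaled_cov_def)

lemma ma_cov1_eq:
  "ma_cov1 a n = real n ^ 3 / a ^ 3 * (2 * (decay a n * (1 + a / real n)) - 2 * decay a n
      + ((decay a n)\<^sup>2 - 1) * (decay a n * (1 + a / real n)))"
proof -
  have "N * (2 * (y / A) - 2 * e * (1 / A) + (e\<^sup>2 - 1) * (y / A)) = N / A * (2 * y - 2 * e + (e\<^sup>2 - 1) * y)"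
    for N A e y :: real
    by (simp add: add_divide_distrib diff_divide_distrib distrib_left right_diff_distrib)
  then show ?thesis unfolding ma_cov1_def scaled_cov_values .
qed

lemma ma_cov0_eq:
  "ma_cov0 a n = real n ^ 3 / a ^ 3 * (1 - 4 * (a / real n) * decay a n ^ 2 - decay a n ^ 4)"
proof -
  have "N * (1 / A - 2 * e * (e * (1 + t) / A) + e\<^sup>2 * (e\<^sup>2 * (1 + 2 * t) / A))
      - 2 * e * (N / A * (2 * (e * (1 + t)) - 2 * e + (e\<^sup>2 - 1) * (e * (1 + t))))
      = N / A * (1 - 4 * t * e ^ 2 - e ^ 4)" for N A e t :: real
  proof -
    have "N * (1 / A - 2 * e * (e * (1 + t) / A) + e\<^sup>2 * (e\<^sup>2 * (1 + 2 * t) / A))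
        = N / A * (1 - 2 * e * (e * (1 + t)) + e\<^sup>2 * (e\<^sup>2 * (1 + 2 * t)))"
      by (simp add: add_divide_distrib diff_divide_distrib distrib_left right_diff_distrib)
    moreover have "1 - 2 * e * (e * (1 + t)) + e\<^sup>2 * (e\<^sup>2 * (1 + 2 * t))
        - 2 * e * (2 * (e * (1 + t)) - 2 * e + (e\<^sup>2 - 1) * (e * (1 + t))) = 1 - 4 * t * e ^ 2 - e ^ 4"
      by (simp add: algebra_simps power2_eq_square power4_eq_xxxx)
    then have "N / A * (1 - 4 * t * e ^ 2 - e ^ 4) = N / A * (1 - 2 * e * (e * (1 + t)) + e\<^sup>2 * (e\<^sup>2 * (1 + 2 * t)))
        - 2 * e * (N / A * (2 * (e * (1 + t)) - 2 * e + (e\<^sup>2 - 1) * (e * (1 + t))))"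
      by (simp only: right_diff_distrib[symmetric] mult.left_commute[of "2 * e" "N / A"])
    ultimately show ?thesis by simp
  qed
  then show ?thesis unfolding ma_cov0_def scaled_cov_values ma_cov1_eq .
qed

lemma start_var_eq:
  "start_var a n = real n ^ 2 / a ^ 3 * (1 - ((1 + a / real n) * decay a n)\<^sup>2)"
proof -
  have "N * (1 / A - s * e * (e * s / A)) = N / A * (1 - (s * e)\<^sup>2)" for N A s e :: real
    by (simp add: diff_divide_distrib right_diff_distrib power2_eq_square mult_ac)
  then show ?thesis unfolding start_var_def scaled_cov_values .
qed

lemma ma_cov1_asymp:
  assumes a: "0 < a"
  shows "(\<lambda>n. ma_cov1 a n - 2 / 3) \<in> O(\<lambda>n. 1 / real n)"
proof (rule bigo_step[OF a, where F = "\<lambda>t. (2 * (exp (- t) * (1 + t)) - 2 * exp (- t)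
      + ((exp (- t))\<^sup>2 - 1) * (exp (- t) * (1 + t))) / t ^ 3 - 2 / 3"])
  show "(\<lambda>t. (2 * (exp (- t) * (1 + t)) - 2 * exp (- t)
      + ((exp (- t))\<^sup>2 - 1) * (exp (- t) * (1 + t))) / t ^ 3 - 2 / 3) \<in> O[at_right 0](\<lambda>t::real. t)"
    by real_asymp
qed (simp add: ma_cov1_eq decay_def power_divide)

lemma ma_cov0_asymp:
  assumes a: "0 < a"
  shows "(\<lambda>n. ma_cov0 a n - 8 / 3) \<in> O(\<lambda>n. 1 / real n)"
proof (rule bigo_step[OF a, where F = "\<lambda>t. (1 - 4 * t * exp (- t) ^ 2 - exp (- t) ^ 4) / t ^ 3 - 8 / 3"])
  show "(\<lambda>t. (1 - 4 * t * exp (- t) ^ 2 - exp (- t) ^ 4) / t ^ 3 - 8 / 3) \<in> O[at_right 0](\<lambda>t::real. t)"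
    by real_asymp
qed (simp add: ma_cov0_eq decay_def power_divide)

lemma start_var_asymp:
  assumes a: "0 < a"
  shows "(start_var a \<longlongrightarrow> 1 / a) sequentially"
proof -
  define F where "F t = (1 - ((1 + t) * exp (- t))\<^sup>2) / t ^ 2" for t :: real
  have "(F \<longlongrightarrow> 1) (at_right 0)" unfolding F_def by real_asymp
  then have "((\<lambda>n. F (a / real n) / a) \<longlongrightarrow> 1 / a) sequentially"
    using a by (intro tendsto_divide tendsto_const filterlim_compose[OF _ filterlim_step[OF a]]) auto
  moreover have "F (a / real n) / a = start_var a n" for n
  proof -
    have "x / (a / N) ^ 2 / a = N ^ 2 / a ^ 3 * x" for x N :: real
      using a by (simp add: power_divide power2_eq_square power3_eq_cube)
    then show ?thesis by (simp only: F_def start_var_eq decay_def)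
  qed
  ultimately show ?thesis by simp
qed

lemma start_corr_asymp:
  assumes a: "0 < a" "0 < b"
  shows "(\<lambda>n. real n * ((1 + a / real n) * decay a n - (1 + b / real n) * decay b n)) \<in> O(\<lambda>n. 1 / real n)"
proof -
  have *: "(\<lambda>n. real n * ((1 + c / real n) * decay c n - 1)) \<in> O(\<lambda>n. 1 / real n)" if c: "0 < c" for c
  proof (rule bigo_step[OF c, where F = "\<lambda>t. c * (((1 + t) * exp (- t) - 1) / t)"])
    have "(\<lambda>t. ((1 + t) * exp (- t) - 1) / t) \<in> O[at_right 0](\<lambda>t::real. t)"
      by real_asymp
    then show "(\<lambda>t. c * (((1 + t) * exp (- t) - 1) / t)) \<in> O[at_right 0](\<lambda>t::real. t)"
      by (rule landau_o.big.cmult_in_iff[THEN iffD2, rotated]) (use c in simp)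
    show "real n * ((1 + c / real n) * decay c n - 1) = c * (((1 + c / real n) * exp (- (c / real n)) - 1) / (c / real n))"
      if "0 < n" for n
    proof -
      have "N * x = c * (x / (c / N))" if "0 < N" for N x :: real
        using c that by simp
      note rescale = this
      show ?thesis unfolding decay_def by (rule rescale) (use that in simp)
    qed
  qed
  have split: "N * (x - y) = N * (x - 1) - N * (y - 1)" for N x y :: real
    by (simp add: algebra_simps)
  show ?thesis by (subst split) (rule sum_in_bigo(2)[OF *[OF a(1)] *[OF a(2)]])
qed

lemma decay_diff_le:
  assumes "0 < a" "0 < b"
  shows "\<bar>decay a n - decay b n\<bar> \<le> \<bar>a - b\<bar> / real n"
proof -
  have le: "exp (- x) - exp (- y) \<le> y - x" if "0 \<le> x" "x \<le> y" for x y :: real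
  proof -
    have "exp (- x) - exp (- y) = exp (- x) * (1 - exp (- (y - x)))"
      by (simp only: right_diff_distrib exp_add[symmetric]) simp
    also have "\<dots> \<le> 1 * (y - x)"
    proof (intro mult_mono)
      show "1 - exp (- (y - x)) \<le> y - x" using exp_ge_add_one_self[of "- (y - x)"] by linarith
    qed (use that in auto)
    finally show ?thesis by simp
  qed
  have abs_le: "\<bar>exp (- x) - exp (- y)\<bar> \<le> \<bar>x - y\<bar>" if "0 \<le> x" "0 \<le> y" for x y :: real
  proof (cases "x \<le> y")
    case True
    then have "exp (- y) \<le> exp (- x)" by simp
    then show ?thesis using le[of x y] that True by linarith
  next
    case False
    then have "exp (- x) \<le> exp (- y)" by simp
    then show ?thesis using le[of y x] that False by linarith
  qed
  have "\<bar>a / real n - b / real n\<bar> = \<bar>a - b\<bar> / real n"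
    by (simp only: diff_divide_distrib[symmetric] abs_divide abs_of_nat)
  then show ?thesis using abs_le[of "a / real n" "b / real n"] assms by (simp add: decay_def)
qed

lemma sum_neighbours_le:
  fixes f :: "nat \<Rightarrow> real"
  assumes A: "finite A" and supp: "\<And>j. j \<in> A \<Longrightarrow> \<not> (j = Suc i \<or> i = Suc j) \<Longrightarrow> f j = 0"
    and le: "\<And>j. j \<in> A \<Longrightarrow> f j \<le> c" and c: "0 \<le> c"
  shows "sum f A \<le> 2 * c"
proof -
  have "f j = 0" if "j \<in> A" "j \<notin> {i - 1, Suc i}" for j
    by (rule supp) (use that in auto)
  then have "sum f A = sum f (A \<inter> {i - 1, Suc i})"
    by (intro sum.mono_neutral_right A) blast+
  also have "\<dots> \<le> real (card (A \<inter> {i - 1, Suc i})) * c"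
    using le by (intro sum_bounded_above) auto
  also have "\<dots> \<le> 2 * c"
  proof (rule mult_right_mono[OF _ c])
    have "card (A \<inter> {i - 1, Suc i}) \<le> card {i - 1, Suc i}" by (intro card_mono) auto
    also have "\<dots> \<le> 2" by (simp add: card_insert_if)
    finally show "real (card (A \<inter> {i - 1, Suc i})) \<le> 2" by simp
  qed
  finally show ?thesis .
qed

lemma tridiagonal_row_sum_le:
  fixes f :: "nat \<Rightarrow> real"
  assumes i: "i < n" and supp: "\<And>j. j < n \<Longrightarrow> \<not> (j = Suc i \<or> i = Suc j) \<Longrightarrow> j \<noteq> i \<Longrightarrow> f j = 0"
    and le: "\<And>j. j < n \<Longrightarrow> f j \<le> c" and c: "0 \<le> c"
  shows "sum f {..<n} \<le> 3 * c"
proof -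
  have "sum f {..<n} = f i + sum f ({..<n} - {i})" using i by (simp add: sum.remove[of "{..<n}" i])
  moreover have "sum f ({..<n} - {i}) \<le> 2 * c"
    using supp le c by (intro sum_neighbours_le[where i = i]) auto
  ultimately show ?thesis using le[OF i] by simp
qed

lemma sum_first_two_le:
  fixes c :: real
  assumes "0 \<le> c" "0 \<le> e"
  shows "(\<Sum>i<n. if i < 2 then c else e) \<le> 2 * c + real n * e"
proof -
  have "(\<Sum>i<n. if i < 2 then c else e) \<le> (\<Sum>i<n. (if i < 2 then c else 0) + e)"
    using assms by (intro sum_mono) auto
  also have "\<dots> = real (card ({..<n} \<inter> {i. i < 2})) * c + real n * e"
    by (simp add: sum.distrib sum.If_cases)
  also have "real (card ({..<n} \<inter> {i. i < 2})) * c \<le> 2 * c"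
  proof (rule mult_right_mono[OF _ assms(1)])
    have "card ({..<n} \<inter> {i. i < 2}) \<le> card {..<2 :: nat}" by (intro card_mono) auto
    then show "real (card ({..<n} \<inter> {i. i < 2})) \<le> 2" by simp
  qed
  finally show ?thesis by simp
qed

lemma bigo_inverse_nat_tendsto:
  assumes "(\<lambda>n. f n - l) \<in> O(\<lambda>n. 1 / real n)"
  shows "(f \<longlongrightarrow> l) sequentially"
proof -
  obtain C where "eventually (\<lambda>n. norm (f n - l) \<le> C * norm (1 / real n)) sequentially"
    using landau_o.bigE[OF assms] by blast
  then have "eventually (\<lambda>n. norm (f n - l) \<le> C / real n) sequentially"
    by eventually_elim simp
  then have "((\<lambda>n. f n - l) \<longlongrightarrow> 0) sequentially"
    by (rule Lim_null_comparison[OF _ lim_const_over_n])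
  then show ?thesis by (simp add: LIM_zero_iff)
qed

text \<open>
  In the limit the diagonal exceeds the off-diagonal row sums by \<open>8/3 - 2 \<sqdot> 2/3 > 0\<close> in the interior. The
  row of the second observation has diagonal entry near \<open>1 / a\<close> and off-diagonal entry of order
  \<open>1 / sqrt n\<close>, and that of the first observation is diagonal.
\<close>
lemma innov_cov_mat_bounds:
  assumes a: "0 < a"
  obtains c C where "0 < c" "0 \<le> C"
    "eventually (\<lambda>n. (\<forall>v\<in>carrier_vec n. c * (vec_norm2 v)\<^sup>2 \<le> v \<bullet> (innov_cov_mat a n *\<^sub>v v))
      \<and> op_bound (innov_cov_mat a n) C) sequentially"
proof -
  have g1: "(ma_cov1 a \<longlongrightarrow> 2 / 3) sequentially" by (rule bigo_inverse_nat_tendsto[OF ma_cov1_asymp[OF a]])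
  have g0: "(ma_cov0 a \<longlongrightarrow> 8 / 3) sequentially" by (rule bigo_inverse_nat_tendsto[OF ma_cov0_asymp[OF a]])
  have s: "(start_var a \<longlongrightarrow> 1 / a) sequentially" by (rule start_var_asymp[OF a])
  have r: "((\<lambda>n. ma_cov1 a n / sqrt (real n)) \<longlongrightarrow> 0) sequentially"
    by (rule tendsto_divide_0[OF g1 filterlim_at_top_imp_at_infinity])
       (rule filterlim_compose[OF sqrt_at_top filterlim_real_sequentially])
  define c where "c = min (min (1 / a ^ 3) (1 / (2 * a))) 1"
  define C where "C = 1 / a ^ 3 + 2 / a + 3"
  have C1: "1 / a ^ 3 \<le> C" "2 / a \<le> C" "3 \<le> C" "0 \<le> C" using a by (simp_all add: C_def)
  have num1: "3 / (4 * a) < 1 / a" using a by (simp add: field_simps)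
  have num2: "1 / a < 2 / a" using a by (intro divide_strict_right_mono) auto
  have num3: "0 < 1 / (8 * a)" using a by simp
  have "eventually (\<lambda>n. 1 \<le> n \<and> 1 / 2 < ma_cov1 a n \<and> ma_cov1 a n < 3 / 4 \<and> 5 / 2 < ma_cov0 a n \<and> ma_cov0 a n < 3
      \<and> 3 / (4 * a) < start_var a n \<and> start_var a n < 2 / a \<and> ma_cov1 a n / sqrt (real n) < 1 / (8 * a)) sequentially"
    by (intro eventually_conj eventually_ge_at_top order_tendstoD[OF g1] order_tendstoD[OF g0]
        order_tendstoD[OF s] order_tendstoD[OF r]) (simp_all add: num1 num2 num3 a)
  then have ev: "eventually (\<lambda>n. (\<forall>v\<in>carrier_vec n. c * (vec_norm2 v)\<^sup>2 \<le> v \<bullet> (innov_cov_mat a n *\<^sub>v v))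
      \<and> op_bound (innov_cov_mat a n) (3 * C)) sequentially"
  proof eventually_elim
    case (elim n)
    have entry: "innov_cov_mat a n $$ (i, j) = innov_cov a n i j" if "i < n" "j < n" for i j
      using that by (simp add: innov_cov_mat_def)
    have g: "0 < ma_cov1 a n" "ma_cov1 a n < 3 / 4" "5 / 2 < ma_cov0 a n" "ma_cov0 a n < 3"
      and st: "3 / (4 * a) < start_var a n" "start_var a n < 2 / a" "ma_cov1 a n / sqrt (real n) < 1 / (8 * a)"
      and n: "1 \<le> sqrt (real n)"
      using elim by auto
    have q: "0 \<le> ma_cov1 a n / sqrt (real n)" using g by simp
    have "ma_cov1 a n / sqrt (real n) \<le> ma_cov1 a n / 1" using g n by (intro divide_left_mono) auto
    then have q': "ma_cov1 a n / sqrt (real n) \<le> ma_cov1 a n" by simp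
    define q where "q = ma_cov1 a n / sqrt (real n)"
    define e where "e i = (if i = 0 then 0 else if i = 1 then q else ma_cov1 a n)" for i :: nat
    note bnd = q[folded q_def] q'[folded q_def] st(3)[folded q_def]
    have e0: "0 \<le> e i" for i using bnd(1) g(1) by (simp add: e_def)
    have e_ge: "q \<le> e i" if "i \<noteq> 0" for i using bnd(2) that by (simp add: e_def)
    have off: "\<bar>innov_cov a n i j\<bar> \<le> e i" if ij: "i \<noteq> j" for i j
    proof (cases "i \<noteq> 0 \<and> j \<noteq> 0 \<and> (i = Suc j \<or> j = Suc i)")
      case near: True
      show ?thesis
      proof (cases "i = 1 \<or> j = 1")
        case True
        then have "innov_cov a n i j = q" using ij near unfolding innov_cov_def q_def by presburger
        then show ?thesis using e_ge[of i] near bnd(1) by simp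
      next
        case False
        then have "innov_cov a n i j = ma_cov1 a n" using ij near unfolding innov_cov_def by presburger
        moreover have "e i = ma_cov1 a n" using near False by (simp add: e_def)
        ultimately show ?thesis using g(1) by simp
      qed
    next
      case False
      then have "innov_cov a n i j = 0" using ij unfolding innov_cov_def by presburger
      then show ?thesis using e0 by simp
    qed
    have far: "innov_cov a n i j = 0" if "\<not> (j = Suc i \<or> i = Suc j)" "j \<noteq> i" for i j
      using that unfolding innov_cov_def by presburger
    have diag: "c + 2 * e i \<le> innov_cov a n i i" for i
    proof -
      consider "i = 0" | "i = 1" | "2 \<le> i" by linarith
      then show ?thesis
      proof cases
        case 1
        then show ?thesis by (simp add: innov_cov_def e_def c_def)
      next
        case 2
        have "c \<le> 1 / (2 * a)" by (simp add: c_def)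
        moreover have "1 / (2 * a) + 2 * (1 / (8 * a)) = 3 / (4 * a)" using a by (simp add: field_simps)
        ultimately show ?thesis using 2 st(1) bnd(3) by (simp add: innov_cov_def e_def)
      next
        case 3
        have "c \<le> 1" by (simp add: c_def)
        then show ?thesis using 3 g by (simp add: innov_cov_def e_def)
      qed
    qed
    have low: "c * (vec_norm2 v)\<^sup>2 \<le> v \<bullet> (innov_cov_mat a n *\<^sub>v v)" if v: "v \<in> carrier_vec n" for v
    proof (rule diagonally_dominant_lower_bound[OF mat_carriers(5) innov_cov_mat_transpose v])
      fix i assume i: "i < n"
      have "(\<Sum>j\<in>{..<n} - {i}. \<bar>innov_cov_mat a n $$ (i, j)\<bar>) \<le> 2 * e i"
      proof (rule sum_neighbours_le[where i = i])
        fix j assume j: "j \<in> {..<n} - {i}"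
        then show "\<bar>innov_cov_mat a n $$ (i, j)\<bar> \<le> e i" using off[of i j] i by (simp add: entry)
        show "\<bar>innov_cov_mat a n $$ (i, j)\<bar> = 0" if "\<not> (j = Suc i \<or> i = Suc j)"
          using far[OF that] j i by (simp add: entry)
      qed (simp_all add: e0)
      then show "c + (\<Sum>j\<in>{..<n} - {i}. \<bar>innov_cov_mat a n $$ (i, j)\<bar>) \<le> innov_cov_mat a n $$ (i, i)"
        using diag[of i] i by (simp add: entry)
    qed
    have up: "op_bound (innov_cov_mat a n) (3 * C)"
    proof (rule op_bound_row_sums[OF mat_carriers(5) innov_cov_mat_transpose])
      fix i assume i: "i < n"
      have "e i \<le> C" using g(2) bnd(2) C1(3,4) unfolding e_def by (simp split: if_splits)
      moreover have "\<bar>innov_cov a n i i\<bar> \<le> C"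
      proof -
        have "0 < 3 / (4 * a)" using a by simp
        then have "0 < start_var a n" using st by linarith
        then show ?thesis using g st(2) C1 a by (simp add: innov_cov_def)
      qed
      ultimately have "\<bar>innov_cov a n i j\<bar> \<le> C" for j
        using off[of i j] by (cases "i = j") (simp, linarith)
      then have "\<bar>innov_cov_mat a n $$ (i, j)\<bar> \<le> C" if "j < n" for j using that i by (simp add: entry)
      then show "(\<Sum>j<n. \<bar>innov_cov_mat a n $$ (i, j)\<bar>) \<le> 3 * C"
      proof (rule tridiagonal_row_sum_le[OF i _ _ C1(4), rotated])
        fix j assume "j < n" "\<not> (j = Suc i \<or> i = Suc j)" "j \<noteq> i"
        then show "\<bar>innov_cov_mat a n $$ (i, j)\<bar> = 0" using far[of j i] i by (simp add: entry)
      qed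
    qed (use C1 in simp)
    show ?case by (intro conjI ballI low up)
  qed
  have "0 < 1 / a ^ 3" "0 < 1 / (2 * a)" using a by simp_all
  then have cpos: "0 < c" by (simp only: c_def min_less_iff_conj zero_less_one simp_thms)
  have Cpos: "0 \<le> 3 * C" using C1(4) by simp
  show ?thesis by (rule that[OF cpos Cpos ev])
qed

text \<open>
  The limits \<open>8/3\<close> and \<open>2/3\<close> are free of the parameter, so there are \<open>O(n)\<close> differences of size \<open>O(1 / n)\<close>,
  and only the two corner entries on the diagonal differ by more.
\<close>
lemma innov_cov_mat_diff_bounds:
  assumes a: "0 < a" and b: "0 < b"
  obtains C where "0 \<le> C"
    "eventually (\<lambda>n. (\<Sum>i<n. \<Sum>j<n. \<bar>(innov_cov_mat b n - innov_cov_mat a n) $$ (i, j)\<bar>) \<le> 9 * C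
      \<and> frobenius (innov_cov_mat b n - innov_cov_mat a n) \<le> 3 * C) sequentially"
proof -
  have diff: "(\<lambda>n. f b n - f a n) \<in> O(\<lambda>n. 1 / real n)"
    if "(\<lambda>n. f b n - l) \<in> O(\<lambda>n. 1 / real n)" "(\<lambda>n. f a n - l) \<in> O(\<lambda>n. 1 / real n)" for f :: "real \<Rightarrow> nat \<Rightarrow> real" and l
    using sum_in_bigo(2)[OF that] by simp
  obtain C1 where C1: "0 < C1" "eventually (\<lambda>n. norm (ma_cov1 b n - ma_cov1 a n) \<le> C1 * norm (1 / real n)) sequentially"
    using diff[OF ma_cov1_asymp[OF b] ma_cov1_asymp[OF a]] by (rule landau_o.bigE)
  obtain C0 where C0: "0 < C0" "eventually (\<lambda>n. norm (ma_cov0 b n - ma_cov0 a n) \<le> C0 * norm (1 / real n)) sequentially"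
    using diff[OF ma_cov0_asymp[OF b] ma_cov0_asymp[OF a]] by (rule landau_o.bigE)
  have s: "((\<lambda>n. start_var b n - start_var a n) \<longlongrightarrow> 1 / b - 1 / a) sequentially"
    by (intro tendsto_diff start_var_asymp a b)
  define Cs where "Cs = \<bar>1 / b - 1 / a\<bar> + 1"
  define C where "C = C0 + C1 + Cs + \<bar>1 / b ^ 3 - 1 / a ^ 3\<bar>"
  have C: "0 \<le> C" "C0 \<le> C" "C1 \<le> C" "Cs \<le> C" "\<bar>1 / b ^ 3 - 1 / a ^ 3\<bar> \<le> C"
    using C0 C1 by (auto simp: C_def Cs_def)
  have "eventually (\<lambda>n. \<bar>start_var b n - start_var a n\<bar> < Cs) sequentially"
    by (rule order_tendstoD(2)[OF tendsto_rabs[OF s]]) (simp add: Cs_def)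
  then have ev: "eventually (\<lambda>n. (\<Sum>i<n. \<Sum>j<n. \<bar>(innov_cov_mat b n - innov_cov_mat a n) $$ (i, j)\<bar>) \<le> 9 * C
      \<and> frobenius (innov_cov_mat b n - innov_cov_mat a n) \<le> 3 * C) sequentially"
    using C1(2) C0(2) eventually_ge_at_top[of 1]
  proof eventually_elim
    case (elim n)
    let ?D = "innov_cov_mat b n - innov_cov_mat a n"
    have entry: "?D $$ (i, j) = innov_cov b n i j - innov_cov a n i j" if "i < n" "j < n" for i j
      using that by (simp add: innov_cov_mat_def)
    have n: "1 \<le> real n" using elim by simp
    have Cn: "C0 / real n \<le> C / real n" "C1 / real n \<le> C / real n" "C / real n \<le> C"
      using C n by (auto intro!: divide_right_mono simp: divide_le_eq mult_le_cancel_left1)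
    have g0: "\<bar>ma_cov0 b n - ma_cov0 a n\<bar> \<le> C / real n" and g1: "\<bar>ma_cov1 b n - ma_cov1 a n\<bar> \<le> C / real n"
      using elim(2,3) Cn by simp_all
    have g1': "\<bar>ma_cov1 b n / sqrt (real n) - ma_cov1 a n / sqrt (real n)\<bar> \<le> C / real n"
    proof -
      have "\<bar>ma_cov1 b n / sqrt (real n) - ma_cov1 a n / sqrt (real n)\<bar> = \<bar>ma_cov1 b n - ma_cov1 a n\<bar> / sqrt (real n)"
        by (simp add: abs_divide flip: diff_divide_distrib)
      also have "\<dots> \<le> \<bar>ma_cov1 b n - ma_cov1 a n\<bar>" using n by (simp add: divide_le_eq mult_le_cancel_left1)
      finally show ?thesis using g1 by simp
    qed
    define qa qb where "qa = ma_cov1 a n / sqrt (real n)" and "qb = ma_cov1 b n / sqrt (real n)"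
    define h where "h = C / real n"
    note small_bounds = g0[folded h_def] g1[folded h_def] g1'[folded h_def qa_def qb_def]
    have h: "0 \<le> h" using C n by (simp add: h_def)
    have near_bound: "\<bar>innov_cov b n i j - innov_cov a n i j\<bar> \<le> h" if "\<not> (i = j \<and> i < 2)" for i j
    proof -
      have "innov_cov b n i j - innov_cov a n i j \<in> {0, ma_cov0 b n - ma_cov0 a n, ma_cov1 b n - ma_cov1 a n, qb - qa}"
        using that unfolding innov_cov_def qa_def[symmetric] qb_def[symmetric]
        by (cases "i = j"; cases "i = 0"; cases "j = 0"; cases "i = 1 \<or> j = 1"; cases "i = Suc j \<or> j = Suc i") simp_all
      then show ?thesis using small_bounds h by auto
    qed
    have far: "?D $$ (i, j) = 0" if "i < n" "j < n" "\<not> (j = Suc i \<or> i = Suc j)" "j \<noteq> i" for i j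
      using that(3,4) unfolding entry[OF that(1,2)] innov_cov_def by simp
    have small: "\<bar>?D $$ (i, j)\<bar> \<le> C / real n" if "i < n" "j < n" "2 \<le> i" for i j
      unfolding entry[OF that(1,2)] h_def[symmetric] by (rule near_bound) (use that in simp)
    have bound: "\<bar>?D $$ (i, j)\<bar> \<le> C" if "i < n" "j < n" for i j
    proof (cases "i = j \<and> i < 2")
      case True
      then consider "i = 0" | "i = 1" by linarith
      then show ?thesis
      proof cases
        case 1
        then show ?thesis using True that C(5) by (simp add: entry innov_cov_def)
      next
        case 2
        then show ?thesis using True that C(4) elim(1) by (simp add: entry innov_cov_def)
      qed
    next
      case False
      then have "\<bar>?D $$ (i, j)\<bar> \<le> C / real n"
        unfolding entry[OF that] h_def[symmetric] by (intro near_bound) auto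
      then show ?thesis using Cn by simp
    qed
    have "(\<Sum>i<n. \<Sum>j<n. \<bar>?D $$ (i, j)\<bar>) \<le> (\<Sum>i<n. if i < 2 then 3 * C else 3 * (C / real n))"
    proof (rule sum_mono)
      fix i assume "i \<in> {..<n}"
      then have i: "i < n" by simp
      have "(\<Sum>j<n. \<bar>?D $$ (i, j)\<bar>) \<le> 3 * (if i < 2 then C else C / real n)"
      proof (rule tridiagonal_row_sum_le[OF i])
        fix j assume j: "j < n"
        show "\<bar>?D $$ (i, j)\<bar> \<le> (if i < 2 then C else C / real n)"
          using bound[OF i j] small[OF i j] by simp
        show "\<bar>?D $$ (i, j)\<bar> = 0" if "\<not> (j = Suc i \<or> i = Suc j)" "j \<noteq> i"
          using far[OF i j that] by simp
      next
        show "0 \<le> (if i < 2 then C else C / real n)" using C(1) by simp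
      qed
      then show "(\<Sum>j<n. \<bar>?D $$ (i, j)\<bar>) \<le> (if i < 2 then 3 * C else 3 * (C / real n))" by (simp split: if_splits)
    qed
    also have "\<dots> \<le> 2 * (3 * C) + real n * (3 * (C / real n))"
      using C n by (intro sum_first_two_le) auto
    also have "\<dots> = 9 * C" using n by simp
    finally have l1: "(\<Sum>i<n. \<Sum>j<n. \<bar>?D $$ (i, j)\<bar>) \<le> 9 * C" .
    have "(frobenius ?D)\<^sup>2 = (\<Sum>i<n. \<Sum>j<n. (?D $$ (i, j))\<^sup>2)"
      by (rule frobenius_power2[OF minus_carrier_mat]) simp
    also have "\<dots> \<le> (\<Sum>i<n. \<Sum>j<n. C * \<bar>?D $$ (i, j)\<bar>)"
    proof (intro sum_mono)
      fix i j assume "i \<in> {..<n}" "j \<in> {..<n}"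
      then have "\<bar>?D $$ (i, j)\<bar> * \<bar>?D $$ (i, j)\<bar> \<le> C * \<bar>?D $$ (i, j)\<bar>"
        using bound by (intro mult_right_mono) auto
      then show "(?D $$ (i, j))\<^sup>2 \<le> C * \<bar>?D $$ (i, j)\<bar>" by (simp add: power2_eq_square)
    qed
    also have "\<dots> = C * (\<Sum>i<n. \<Sum>j<n. \<bar>?D $$ (i, j)\<bar>)" by (simp only: sum_distrib_left)
    also have "\<dots> \<le> C * (9 * C)" using l1 C by (intro mult_left_mono) auto
    also have "\<dots> = (3 * C)\<^sup>2" by (simp add: power2_eq_square)
    finally have "(frobenius ?D)\<^sup>2 \<le> (3 * C)\<^sup>2" .
    then have "frobenius ?D \<le> 3 * C" by (rule power2_le_imp_le) (use C in simp)
    then show ?case using l1 by simp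
  qed
  show ?thesis by (rule that[OF C(1) ev])
qed

section \<open>Whitening with the filter of another parameter\<close>

text \<open>
  Filtering with parameter \<open>a\<close> what the filter with parameter \<open>b\<close> has whitened amounts to the identity plus
  this matrix.
\<close>
definition filter_change_mat :: "real \<Rightarrow> real \<Rightarrow> nat \<Rightarrow> real mat" where
  "filter_change_mat a b n = whitening_mat a n * response_mat b n - 1\<^sub>m n"

lemma filter_change_mat_carrier: "filter_change_mat a b n \<in> carrier_mat n n"
  unfolding filter_change_mat_def by (rule minus_carrier_mat) simp

text \<open>
  The response of the \<open>b\<close>-filter is mapped to unit impulses by the \<open>b\<close>-filter, so only the difference of
  the two filters acts on it, and that has the small factor \<open>decay a n - decay b n\<close>.
\<close>
lemma filter_change_mat_entry:
  assumes n: "0 < n" and ij: "i < n" "j < n"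
  shows "filter_change_mat a b n $$ (i, j) = innov_scale n i *
    (if i = 0 then 0
     else if i = 1 then - (((1 + a / real n) * decay a n - (1 + b / real n) * decay b n) * response b n 0 j)
     else - (2 * (decay a n - decay b n) * response b n (i - 1) j)
       + (decay a n - decay b n) * (decay a n + decay b n) * response b n (i - 2) j)"
proof -
  have "(whitening_mat a n * response_mat b n) $$ (i, j) = (\<Sum>k<n. whitening_mat a n $$ (i, k) * response b n k j)"
    using ij by (subst mat_mult_entry[of _ n n _ n]) (auto simp: response_mat_def)
  also have "\<dots> = innov_scale n i * ar_filter a n (\<lambda>l. response b n l j) i"
    using ij(1) by (rule whitening_mat_apply)
  finally have "filter_change_mat a b n $$ (i, j) = innov_scale n i * ar_filter a n (\<lambda>l. response b n l j) i
      - innov_scale n i * ar_filter b n (\<lambda>l. response b n l j) i"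
    using ij by (simp add: filter_change_mat_def ar_filter_response[OF n])
  also have "\<dots> = innov_scale n i * (ar_filter a n (\<lambda>l. response b n l j) i - ar_filter b n (\<lambda>l. response b n l j) i)"
    by (simp only: right_diff_distrib)
  also have "ar_filter a n (\<lambda>l. response b n l j) i - ar_filter b n (\<lambda>l. response b n l j) i =
    (if i = 0 then 0
     else if i = 1 then - (((1 + a / real n) * decay a n - (1 + b / real n) * decay b n) * response b n 0 j)
     else - (2 * (decay a n - decay b n) * response b n (i - 1) j)
       + (decay a n - decay b n) * (decay a n + decay b n) * response b n (i - 2) j)"
  proof -
    have "(x - s * y) - (x - t * y) = - ((s - t) * y)" for x y s t :: real by (simp add: algebra_simps)
    moreover have "(x - 2 * s * y + s\<^sup>2 * z) - (x - 2 * t * y + t\<^sup>2 * z) = - (2 * (s - t) * y) + (s - t) * (s + t) * z"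
      for x y z s t :: real by (simp add: algebra_simps power2_eq_square)
    ultimately show ?thesis unfolding ar_filter_def by (cases "i = 0"; cases "i = 1") (simp_all only: if_True if_False simp_thms diff_self)
  qed
  finally show ?thesis .
qed

text \<open>
  The leading coefficients of both filters are \<open>1\<close>, so their difference only sees the strict past, where the
  response to an impulse vanishes.
\<close>
lemma filter_change_mat_trace:
  assumes "0 < n"
  shows "mat_trace (filter_change_mat a b n) = 0"
proof -
  have "filter_change_mat a b n $$ (i, i) = 0" if "i < n" for i
    unfolding filter_change_mat_entry[OF assms that that] by (simp add: response_def)
  then show ?thesis
    unfolding mat_trace_def using carrier_matD(1)[OF filter_change_mat_carrier] by (intro sum.neutral) simp
qed

lemma decay_bounds: "0 < b \<Longrightarrow> 0 \<le> decay b n" "0 < b \<Longrightarrow> decay b n \<le> 1"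
  by (simp_all add: decay_def)

text \<open>
  Each entry is a factor \<open>\<delta> = decay a n - decay b n = O(1 / n)\<close> times a combination of two consecutive
  responses. A response at lag \<open>m\<close> grows like \<open>m\<close> and may be of order \<open>n\<close>, but the combination is close to a first
  difference and \<open>\<delta> m\<close> is bounded, so it stays of order one relative to the scale of the input.
\<close>
lemma filter_change_mat_bound:
  assumes a: "0 < a" and b: "0 < b" and n: "0 < n" and ij: "i < n" "j < n" "2 \<le> i"
  defines "D \<equiv> \<bar>a - b\<bar>"
  shows "\<bar>filter_change_mat a b n $$ (i, j)\<bar> \<le> (if j < 2 then D * (2 + D) * (1 + b) / sqrt (real n) else D * (2 + D) * (1 + b) / real n)"
proof -
  define \<rho> where "\<rho> = decay b n"
  define \<delta> where "\<delta> = decay a n - decay b n"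
  have \<rho>: "0 \<le> \<rho>" "\<rho> \<le> 1" using decay_bounds[OF b, of n] by (simp_all add: \<rho>_def)
  have \<delta>: "\<bar>\<delta>\<bar> \<le> D / real n" unfolding \<delta>_def D_def by (rule decay_diff_le[OF a b])
  have D: "0 \<le> D" by (simp add: D_def)
  have rn: "0 < real n" using n by simp
  have K: "filter_change_mat a b n $$ (i, j) =
      innov_scale n i * (\<delta> * ((2 * \<rho> + \<delta>) * response b n (i - 2) j - 2 * response b n (i - 1) j))"
  proof -
    have "- (2 * \<delta> * y) + \<delta> * (decay a n + decay b n) * z = \<delta> * ((2 * \<rho> + \<delta>) * z - 2 * y)" for y z
      by (simp add: \<delta>_def \<rho>_def algebra_simps)
    then show ?thesis
      unfolding filter_change_mat_entry[OF n ij(1,2)] \<delta>_def[symmetric] using ij(3) by simp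
  qed
  \<comment> \<open>A lag is at most \<open>n\<close>, so the linear growth of the responses is compensated by \<open>\<delta> = O(1 / n)\<close>.\<close>
  have step: "\<bar>x\<bar> * m \<le> D" if "\<bar>x\<bar> \<le> D / real n" "0 \<le> m" "m \<le> real n" for x m
  proof -
    have "\<bar>x\<bar> * m \<le> D / real n * real n" using that D rn by (intro mult_mono) auto
    then show ?thesis using rn by simp
  qed
  have sn: "0 < sqrt (real n)" "sqrt (real n) * sqrt (real n) = real n" using rn by simp_all
  have inv: "sqrt (real n) / real n = 1 / sqrt (real n)"
    using sn rn by (simp add: field_simps)
  have big: "D * (2 + D) * 1 \<le> D * (2 + D) * (1 + b)" using b D by (intro mult_left_mono) auto
  show ?thesis
  proof (cases "j = 0")
    case True
    define m where "m = i - 2"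
    have i: "i = m + 2" "i - 1 = m + 1" "i - 2 = m" using ij(3) by (simp_all add: m_def)
    define t where "t = b / real n"
    have t: "0 \<le> t" "real m * t \<le> b"
    proof -
      show "0 \<le> t" using b rn by (simp add: t_def)
      have "real m * b \<le> real n * b" using ij i b by (intro mult_right_mono) auto
      then show "real m * t \<le> b" using rn by (simp add: t_def divide_le_eq mult.commute)
    qed
    have "(2 * \<rho> + \<delta>) * response b n (i - 2) j - 2 * response b n (i - 1) j
        = (2 * \<rho> + \<delta>) * (\<rho> ^ m * (1 + real m * t)) - 2 * (\<rho> ^ (m + 1) * (1 + real (m + 1) * t))"
      unfolding i True response_def \<rho>_def t_def by simp
    also have "\<dots> = \<rho> ^ m * (\<delta> * (1 + real m * t) - 2 * \<rho> * t)"
      by (simp add: algebra_simps)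
    finally have e: "(2 * \<rho> + \<delta>) * response b n (i - 2) j - 2 * response b n (i - 1) j = \<dots>" .
    have "\<bar>\<rho> ^ m * (\<delta> * (1 + real m * t) - 2 * \<rho> * t)\<bar> \<le> 1 * (\<bar>\<delta>\<bar> * (1 + b) + 2 * t)"
      unfolding abs_mult
    proof (intro mult_mono)
      show "\<bar>\<rho> ^ m\<bar> \<le> 1" using \<rho> by (simp add: power_le_one)
      have "\<bar>\<delta> * (1 + real m * t)\<bar> \<le> \<bar>\<delta>\<bar> * (1 + b)"
        unfolding abs_mult using t by (intro mult_left_mono) auto
      moreover have "\<bar>2 * \<rho> * t\<bar> \<le> 2 * t"
        using \<rho> t mult_right_mono[of \<rho> 1 t] by (simp add: abs_mult)
      ultimately show "\<bar>\<delta> * (1 + real m * t) - 2 * \<rho> * t\<bar> \<le> \<bar>\<delta>\<bar> * (1 + b) + 2 * t" by linarith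
    qed auto
    also have "\<dots> \<le> (D / real n) * (1 + b) + 2 * t"
      using mult_right_mono[OF \<delta>, of "1 + b"] b by simp
    also have "\<dots> = (D * (1 + b) + 2 * b) / real n" by (simp add: t_def add_divide_distrib)
    also have "\<dots> \<le> (2 + D) * (1 + b) / real n"
      using D b rn by (intro divide_right_mono) (auto simp: algebra_simps)
    finally have e': "\<bar>\<rho> ^ m * (\<delta> * (1 + real m * t) - 2 * \<rho> * t)\<bar> \<le> (2 + D) * (1 + b) / real n" .
    have "\<bar>filter_change_mat a b n $$ (i, j)\<bar> \<le> (real n * sqrt (real n)) * ((D / real n) * ((2 + D) * (1 + b) / real n))"
      unfolding K e abs_mult[of "innov_scale n i"] abs_mult[of \<delta>]
      using \<delta> e' D rn ij(3) by (intro mult_mono) (auto simp: innov_scale_def)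
    also have "\<dots> = (sqrt (real n) / real n) * (D * (2 + D) * (1 + b))" using rn by simp
    also have "\<dots> = D * (2 + D) * (1 + b) / sqrt (real n)" unfolding inv by simp
    finally show ?thesis using True by simp
  next
    case j: False
    have sj: "0 < innov_scale n j" using rn by (simp add: innov_scale_def)
    define x where "x = ((2 * \<rho> + \<delta>) * response b n (i - 2) j - 2 * response b n (i - 1) j) * innov_scale n j"
    have x: "\<bar>x\<bar> \<le> 2 + D"
    proof (cases "i - 1 < j")
      case True
      then have "x = 0" by (simp add: x_def response_def)
      then show ?thesis using D by simp
    next
      case False
      define m where "m = i - 1 - j"
      have i: "i - 1 = m + j" using False by (simp add: m_def)
      have r1: "response b n (i - 1) j * innov_scale n j = real (m + 1) * \<rho> ^ m"
        using j sj unfolding i response_def \<rho>_def by simp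
      show ?thesis
      proof (cases m)
        case 0
        then have "i - 2 < j" using i ij(3) j by simp
        then have "response b n (i - 2) j = 0" by (simp add: response_def)
        then have "x = - 2 * (response b n (i - 1) j * innov_scale n j)" by (simp add: x_def)
        then show ?thesis unfolding r1 using 0 D by simp
      next
        case (Suc l)
        have i2: "i - 2 = l + j" using i Suc by simp
        have r2: "response b n (i - 2) j * innov_scale n j = real (l + 1) * \<rho> ^ l"
          using j sj unfolding i2 response_def \<rho>_def by simp
        have "x = (2 * \<rho> + \<delta>) * (response b n (i - 2) j * innov_scale n j) - 2 * (response b n (i - 1) j * innov_scale n j)"
          by (simp add: x_def algebra_simps)
        also have "\<dots> = \<rho> ^ l * (\<delta> * real (l + 1) - 2 * \<rho>)"
          unfolding r1 r2 Suc by (simp add: algebra_simps)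
        finally have "\<bar>x\<bar> = \<bar>\<rho> ^ l\<bar> * \<bar>\<delta> * real (l + 1) - 2 * \<rho>\<bar>" by (simp only: abs_mult)
        also have "\<dots> \<le> 1 * (2 + D)"
        proof (intro mult_mono)
          show "\<bar>\<rho> ^ l\<bar> \<le> 1" using \<rho> by (simp add: power_le_one)
          have "real (l + 1) \<le> real n" using i2 ij by simp
          then have "\<bar>\<delta> * real (l + 1)\<bar> \<le> D"
            using step[OF \<delta>, of "real (l + 1)"] by (simp only: abs_mult abs_of_nat of_nat_0_le_iff)
          then show "\<bar>\<delta> * real (l + 1) - 2 * \<rho>\<bar> \<le> 2 + D" using \<rho> by linarith
        qed (use D in auto)
        finally show ?thesis by simp
      qed
    qed
    have "filter_change_mat a b n $$ (i, j) = innov_scale n i / innov_scale n j * (\<delta> * x)"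
      unfolding K x_def using sj by simp
    then have "\<bar>filter_change_mat a b n $$ (i, j)\<bar> = innov_scale n i / innov_scale n j * (\<bar>\<delta>\<bar> * \<bar>x\<bar>)"
      using rn by (simp add: abs_mult innov_scale_def)
    also have "\<dots> \<le> innov_scale n i / innov_scale n j * ((D / real n) * (2 + D))"
    proof (rule mult_left_mono)
      show "\<bar>\<delta>\<bar> * \<bar>x\<bar> \<le> D / real n * (2 + D)" using \<delta> x D rn by (intro mult_mono) auto
      show "0 \<le> innov_scale n i / innov_scale n j" using rn by (simp add: innov_scale_def)
    qed
    also have "\<dots> \<le> (if j < 2 then D * (2 + D) * (1 + b) / sqrt (real n) else D * (2 + D) * (1 + b) / real n)"
    proof (cases "j = 1")
      case True
      have "innov_scale n i / innov_scale n j * ((D / real n) * (2 + D)) = (sqrt (real n) / real n) * (D * (2 + D))"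
        using True ij(3) rn by (simp add: innov_scale_def)
      also have "\<dots> = D * (2 + D) * 1 / sqrt (real n)" unfolding inv by simp
      also have "\<dots> \<le> D * (2 + D) * (1 + b) / sqrt (real n)" using big sn(1) by (intro divide_right_mono) auto
      finally show ?thesis using True by simp
    next
      case False
      then have "innov_scale n i / innov_scale n j * ((D / real n) * (2 + D)) = D * (2 + D) * 1 / real n"
        using j ij(3) rn by (simp add: innov_scale_def)
      also have "\<dots> \<le> D * (2 + D) * (1 + b) / real n" using big rn by (intro divide_right_mono) auto
      finally show ?thesis using j False by simp
    qed
    finally show ?thesis .
  qed
qed

text \<open>
  There are \<open>2 n\<close> entries of order \<open>1 / sqrt n\<close>, those in the columns of the first two observations, and all
  others are of order \<open>1 / n\<close>.
\<close>
lemma filter_change_mat_frobenius: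
  assumes a: "0 < a" and b: "0 < b"
  obtains C where "0 \<le> C" "eventually (\<lambda>n. frobenius (filter_change_mat a b n) \<le> 2 * C) sequentially"
proof -
  obtain C1 where C1: "0 < C1" "eventually (\<lambda>n. norm (real n * ((1 + a / real n) * decay a n - (1 + b / real n) * decay b n))
      \<le> C1 * norm (1 / real n)) sequentially"
    using start_corr_asymp[OF a b] by (rule landau_o.bigE)
  define B where "B = \<bar>a - b\<bar> * (2 + \<bar>a - b\<bar>) * (1 + b)"
  define C where "C = max B C1"
  have C: "B \<le> C" "C1 \<le> C" "0 \<le> C" using C1(1) by (auto simp: C_def)
  have "eventually (\<lambda>n. frobenius (filter_change_mat a b n) \<le> 2 * C) sequentially"
    using C1(2) eventually_ge_at_top[of 1]
  proof eventually_elim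
    case (elim n)
    let ?K = "filter_change_mat a b n"
    have n: "0 < n" and rn: "1 \<le> real n" "0 < real n" using elim(2) by auto
    have "sqrt (real n) \<le> real n"
    proof -
      have "1 * sqrt (real n) \<le> sqrt (real n) * sqrt (real n)" using rn by (intro mult_right_mono) auto
      then show ?thesis by simp
    qed
    then have inv: "C / real n \<le> C / sqrt (real n)" using C rn by (intro divide_left_mono) auto
    have bound: "\<bar>?K $$ (i, j)\<bar> \<le> (if j < 2 then C / sqrt (real n) else C / real n)" if ij: "i < n" "j < n" for i j
    proof -
      consider "2 \<le> i" | "i = 0" | "i = 1" by linarith
      then show ?thesis
      proof cases
        case 1
        have "B / sqrt (real n) \<le> C / sqrt (real n)" "B / real n \<le> C / real n"
          using C(1) by (auto intro!: divide_right_mono)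
        then have "(if j < 2 then B / sqrt (real n) else B / real n) \<le> (if j < 2 then C / sqrt (real n) else C / real n)"
          by (simp only: split: if_split) simp
        with filter_change_mat_bound[OF a b n ij 1, folded B_def] show ?thesis by (rule order_trans)
      next
        case 2
        then show ?thesis using C(3) unfolding filter_change_mat_entry[OF n ij] by simp
      next
        case 3
        show ?thesis
        proof (cases "j = 0")
          case True
          have "\<bar>?K $$ (i, j)\<bar> = \<bar>real n * ((1 + a / real n) * decay a n - (1 + b / real n) * decay b n)\<bar>"
            unfolding filter_change_mat_entry[OF n ij] using 3 True
            by (simp add: innov_scale_def response_def abs_mult abs_minus_commute)
          also have "\<dots> \<le> C1 / real n" using elim(1) by simp
          also have "\<dots> \<le> C / real n" using C(2) by (intro divide_right_mono) auto
          also have "\<dots> \<le> C / sqrt (real n)" by (rule inv)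
          finally show ?thesis using True by simp
        next
          case False
          then have "?K $$ (i, j) = 0"
            unfolding filter_change_mat_entry[OF n ij] using 3 by (simp add: response_def)
          then show ?thesis using C(3) by simp
        qed
      qed
    qed
    have "(frobenius ?K)\<^sup>2 = (\<Sum>i<n. \<Sum>j<n. (?K $$ (i, j))\<^sup>2)" by (rule frobenius_power2[OF filter_change_mat_carrier])
    also have "\<dots> \<le> (\<Sum>i<n. \<Sum>j<n. if j < 2 then C\<^sup>2 / real n else C\<^sup>2 / (real n)\<^sup>2)"
    proof (intro sum_mono)
      fix i j assume "i \<in> {..<n}" "j \<in> {..<n}"
      then have "\<bar>?K $$ (i, j)\<bar>\<^sup>2 \<le> (if j < 2 then C / sqrt (real n) else C / real n)\<^sup>2"
        by (intro power_mono bound) auto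
      then show "(?K $$ (i, j))\<^sup>2 \<le> (if j < 2 then C\<^sup>2 / real n else C\<^sup>2 / (real n)\<^sup>2)"
        by (cases "j < 2") (simp_all add: power_divide)
    qed
    also have "\<dots> \<le> (\<Sum>i<n. 2 * (C\<^sup>2 / real n) + real n * (C\<^sup>2 / (real n)\<^sup>2))"
      by (intro sum_mono sum_first_two_le) auto
    also have "\<dots> = 3 * C\<^sup>2" using rn by (simp add: power2_eq_square)
    also have "\<dots> \<le> (2 * C)\<^sup>2" by (simp add: power_mult_distrib)
    finally show ?case by (rule power2_le_imp_le) (use C in simp)
  qed
  then show ?thesis by (rule that[OF C(3)])
qed

section \<open>Traces for one coordinate\<close>

lemma smult_smult_mat: "k \<cdot>\<^sub>m (l \<cdot>\<^sub>m A) = (k * l :: real) \<cdot>\<^sub>m A"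
  by (intro eq_matI) auto

lemma smult_mat_one: "(1 :: real) \<cdot>\<^sub>m A = A"
  by (intro eq_matI) auto

lemma scaled_corr_mat_inverse:
  fixes a :: real
  assumes n: "0 < n" and P: "P \<in> carrier_mat n n" "innov_cov_mat a n * P = 1\<^sub>m n"
  defines "L \<equiv> whitening_mat a n"
  shows "scaled_corr_mat a n * (L\<^sup>T * (P * L)) = 1\<^sub>m n"
proof -
  define G Z where "G = response_mat a n" and "Z = innov_cov_mat a n"
  have L: "L \<in> carrier_mat n n" and G: "G \<in> carrier_mat n n" and Z: "Z \<in> carrier_mat n n"
    by (simp_all add: L_def G_def Z_def)
  have LG: "L * G = 1\<^sub>m n" and GL: "G * L = 1\<^sub>m n"
    using whitening_response[OF n] by (simp_all add: L_def G_def)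
  have GLT: "G\<^sup>T * L\<^sup>T = 1\<^sub>m n"
    using transpose_mult[OF L G] LG by simp
  have ZP: "Z * P = 1\<^sub>m n" using P(2) by (simp add: Z_def)
  have "(G * (Z * G\<^sup>T)) * (L\<^sup>T * (P * L)) = G * (Z * ((G\<^sup>T * L\<^sup>T) * (P * L)))"
    using L G Z P(1) by (simp add: assoc_mult_mat[of _ n n _ n _ n])
  also have "\<dots> = G * ((Z * P) * L)"
    using L G Z P(1) by (simp add: GLT assoc_mult_mat[of _ n n _ n _ n])
  also have "\<dots> = 1\<^sub>m n" using L by (simp add: ZP GL)
  finally show ?thesis by (simp only: scaled_corr_mat_factorization[OF n] G_def Z_def)
qed

lemma whitened_other_covariance:
  fixes a b :: real
  assumes n: "0 < n"
  defines "L \<equiv> whitening_mat a n" and "J \<equiv> 1\<^sub>m n + filter_change_mat a b n"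
  shows "L * (scaled_corr_mat b n * L\<^sup>T) = J * (innov_cov_mat b n * J\<^sup>T)"
proof -
  define G Z where "G = response_mat b n" and "Z = innov_cov_mat b n"
  have L: "L \<in> carrier_mat n n" and G: "G \<in> carrier_mat n n" and Z: "Z \<in> carrier_mat n n"
    by (simp_all add: L_def G_def Z_def)
  have LG: "L * G \<in> carrier_mat n n" using L G by simp
  have J: "J = L * G"
    unfolding J_def filter_change_mat_def L_def[symmetric] G_def[symmetric] using carrier_matD[OF LG] by (intro eq_matI) simp_all
  have "J\<^sup>T = G\<^sup>T * L\<^sup>T" unfolding J by (rule transpose_mult[OF L G])
  then show ?thesis
    unfolding scaled_corr_mat_factorization[OF n] G_def[symmetric] Z_def[symmetric] J using L G Z
    by (simp add: assoc_mult_mat[of _ n n _ n _ n])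
qed

lemma corr_mat_scaled: "0 < a \<Longrightarrow> corr_mat a n = a ^ 3 \<cdot>\<^sub>m scaled_corr_mat a n"
  by (intro eq_matI) (auto simp: scaled_corr_mat_def corr_mat_def)

text \<open>
  The inverse of \<open>S a\<close> is \<open>L\<^sup>T P L\<close>, and cyclic permutation under the trace moves \<open>L\<^sup>T\<close> to the other side of
  \<open>S b\<close>, which turns the traces into traces of whitened matrices. The factor \<open>b\<^sup>3 / a\<^sup>3\<close> undoes the rescaling.
\<close>
lemma corr_mat_inverse_trace:
  assumes a: "0 < a" and b: "0 < b" and n: "0 < n"
    and P: "P \<in> carrier_mat n n" "innov_cov_mat a n * P = 1\<^sub>m n"
  defines "J \<equiv> 1\<^sub>m n + filter_change_mat a b n"
  defines "W \<equiv> P * (J * (innov_cov_mat b n * J\<^sup>T))"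
  shows "inv_mat (corr_mat a n) \<in> carrier_mat n n"
    and "corr_mat a n * inv_mat (corr_mat a n) = 1\<^sub>m n" "inv_mat (corr_mat a n) * corr_mat a n = 1\<^sub>m n"
    and "mat_trace (inv_mat (corr_mat a n) * corr_mat b n) = b ^ 3 / a ^ 3 * mat_trace W"
    and "mat_trace ((inv_mat (corr_mat a n) * corr_mat b n) * (inv_mat (corr_mat a n) * corr_mat b n))
      = (b ^ 3 / a ^ 3)\<^sup>2 * mat_trace (W * W)"
proof -
  define L where "L = whitening_mat a n"
  define S where "S = scaled_corr_mat b n"
  define Q where "Q = L\<^sup>T * (P * L)"
  have L: "L \<in> carrier_mat n n" and S: "S \<in> carrier_mat n n" and Sa: "scaled_corr_mat a n \<in> carrier_mat n n"
    by (simp_all add: L_def S_def)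
  have Q: "Q \<in> carrier_mat n n" using L P(1) by (simp add: Q_def)
  have SQ: "scaled_corr_mat a n * Q = 1\<^sub>m n"
    using scaled_corr_mat_inverse[OF n P] by (simp add: Q_def L_def)
  have QS: "Q * scaled_corr_mat a n = 1\<^sub>m n" by (rule mat_mult_left_right_inverse[OF Sa Q SQ])
  have RQ: "corr_mat a n * ((1 / a ^ 3) \<cdot>\<^sub>m Q) = 1\<^sub>m n"
    unfolding corr_mat_scaled[OF a] using Sa Q SQ a
    by (simp add: mult_smult_distrib[of _ n n _ n] mult_smult_assoc_mat[of _ n n _ n] smult_smult_mat smult_mat_one)
  have QR: "((1 / a ^ 3) \<cdot>\<^sub>m Q) * corr_mat a n = 1\<^sub>m n"
    by (rule mat_mult_left_right_inverse[OF _ _ RQ]) (use Q in simp_all)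
  have inv: "inv_mat (corr_mat a n) = (1 / a ^ 3) \<cdot>\<^sub>m Q"
    using Q by (intro inv_mat_eqI[of _ n] RQ QR) simp_all
  show "inv_mat (corr_mat a n) \<in> carrier_mat n n"
    "corr_mat a n * inv_mat (corr_mat a n) = 1\<^sub>m n" "inv_mat (corr_mat a n) * corr_mat a n = 1\<^sub>m n"
    unfolding inv using Q RQ QR by simp_all
  define V where "V = P * (L * S)"
  have V: "V \<in> carrier_mat n n" and LT: "L\<^sup>T \<in> carrier_mat n n" using P(1) L S by (simp_all add: V_def)
  have QSV: "Q * S = L\<^sup>T * V"
    unfolding Q_def V_def using L S P(1) by (simp add: assoc_mult_mat[of _ n n _ n _ n])
  have VW: "V * L\<^sup>T = W"
  proof -
    have "V * L\<^sup>T = P * (L * (S * L\<^sup>T))"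
      unfolding V_def using L S P(1) by (simp add: assoc_mult_mat[of _ n n _ n _ n])
    then show ?thesis
      using whitened_other_covariance[OF n, of a b] by (simp only: L_def S_def W_def J_def)
  qed
  have RS: "inv_mat (corr_mat a n) * corr_mat b n = (b ^ 3 / a ^ 3) \<cdot>\<^sub>m (L\<^sup>T * V)"
    unfolding inv corr_mat_scaled[OF b] S_def[symmetric] QSV[symmetric] using Q S
    by (simp add: mult_smult_distrib[of _ n n _ n] smult_smult_mat mult_smult_assoc_mat[of _ n n _ n])
  have LV: "L\<^sup>T * V \<in> carrier_mat n n" using LT V by simp
  show "mat_trace (inv_mat (corr_mat a n) * corr_mat b n) = b ^ 3 / a ^ 3 * mat_trace W"
    unfolding RS using mat_trace_smult[OF LV] mat_trace_comm[OF LT V] VW by simp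
  have "(inv_mat (corr_mat a n) * corr_mat b n) * (inv_mat (corr_mat a n) * corr_mat b n)
      = (b ^ 3 / a ^ 3)\<^sup>2 \<cdot>\<^sub>m ((L\<^sup>T * V) * (L\<^sup>T * V))"
    unfolding RS using LV
    by (simp add: mult_smult_distrib[of _ n n _ n] mult_smult_assoc_mat[of _ n n _ n] smult_smult_mat power2_eq_square)
  then show "mat_trace ((inv_mat (corr_mat a n) * corr_mat b n) * (inv_mat (corr_mat a n) * corr_mat b n))
      = (b ^ 3 / a ^ 3)\<^sup>2 * mat_trace (W * W)"
    using LV mat_trace_cyclic_square[OF LT V] VW mat_trace_smult[of "(L\<^sup>T * V) * (L\<^sup>T * V)" n] by simp
qed

lemma corr_mat_trace_bounds:
  assumes a: "0 < a" and b: "0 < b"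
  obtains A B where "eventually (\<lambda>n. inv_mat (corr_mat a n) \<in> carrier_mat n n
      \<and> corr_mat a n * inv_mat (corr_mat a n) = 1\<^sub>m n \<and> inv_mat (corr_mat a n) * corr_mat a n = 1\<^sub>m n
      \<and> \<bar>mat_trace (inv_mat (corr_mat a n) * corr_mat b n) - b ^ 3 / a ^ 3 * real n\<bar> \<le> A
      \<and> \<bar>mat_trace ((inv_mat (corr_mat a n) * corr_mat b n) * (inv_mat (corr_mat a n) * corr_mat b n))\<bar> \<le> B * real n)
    sequentially"
proof -
  obtain c Ca where c: "0 < c" and "0 \<le> Ca" and low:
    "eventually (\<lambda>n. (\<forall>v\<in>carrier_vec n. c * (vec_norm2 v)\<^sup>2 \<le> v \<bullet> (innov_cov_mat a n *\<^sub>v v))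
      \<and> op_bound (innov_cov_mat a n) Ca) sequentially"
    by (rule innov_cov_mat_bounds[OF a])
  obtain c' z where "0 < c'" and z: "0 \<le> z" and up:
    "eventually (\<lambda>n. (\<forall>v\<in>carrier_vec n. c' * (vec_norm2 v)\<^sup>2 \<le> v \<bullet> (innov_cov_mat b n *\<^sub>v v))
      \<and> op_bound (innov_cov_mat b n) z) sequentially"
    by (rule innov_cov_mat_bounds[OF b])
  obtain D where D: "0 \<le> D" and diff:
    "eventually (\<lambda>n. (\<Sum>i<n. \<Sum>j<n. \<bar>(innov_cov_mat b n - innov_cov_mat a n) $$ (i, j)\<bar>) \<le> 9 * D
      \<and> frobenius (innov_cov_mat b n - innov_cov_mat a n) \<le> 3 * D) sequentially"
    by (rule innov_cov_mat_diff_bounds[OF a b])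
  obtain k where k: "0 \<le> k" and K: "eventually (\<lambda>n. frobenius (filter_change_mat a b n) \<le> 2 * k) sequentially"
    by (rule filter_change_mat_frobenius[OF a b])
  define r where "r = b ^ 3 / a ^ 3"
  define p where "p = 1 / c"
  define A where "A = p * (9 * D) + 2 * p * (2 * k) * (3 * D) + p * z * (2 * k)\<^sup>2"
  define B where "B = (p * ((1 + 2 * k) * (z * (1 + 2 * k))))\<^sup>2"
  have p: "0 \<le> p" and r: "0 \<le> r" using c a b by (simp_all add: p_def r_def)
  have "eventually (\<lambda>n. inv_mat (corr_mat a n) \<in> carrier_mat n n
      \<and> corr_mat a n * inv_mat (corr_mat a n) = 1\<^sub>m n \<and> inv_mat (corr_mat a n) * corr_mat a n = 1\<^sub>m n
      \<and> \<bar>mat_trace (inv_mat (corr_mat a n) * corr_mat b n) - b ^ 3 / a ^ 3 * real n\<bar> \<le> r * A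
      \<and> \<bar>mat_trace ((inv_mat (corr_mat a n) * corr_mat b n) * (inv_mat (corr_mat a n) * corr_mat b n))\<bar> \<le> r\<^sup>2 * B * real n)
    sequentially"
    using low up diff K eventually_gt_at_top[of 0]
  proof eventually_elim
    case (elim n)
    let ?K = "filter_change_mat a b n" and ?Za = "innov_cov_mat a n" and ?Zb = "innov_cov_mat b n"
    have Za: "?Za \<in> carrier_mat n n" and Zb: "?Zb \<in> carrier_mat n n" by simp_all
    have coercive: "c * (vec_norm2 v)\<^sup>2 \<le> v \<bullet> (?Za *\<^sub>v v)" if "v \<in> carrier_vec n" for v
      using elim(1) that by (rule conjunct1[THEN bspec])
    obtain P where P: "P \<in> carrier_mat n n" "?Za * P = 1\<^sub>m n" "P * ?Za = 1\<^sub>m n" "op_bound P p"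
      unfolding p_def by (rule coercive_inverse[OF Za c coercive])
    define J where "J = 1\<^sub>m n + ?K"
    define W where "W = P * (J * (?Zb * J\<^sup>T))"
    note inv = corr_mat_inverse_trace[OF a b elim(5) P(1,2), folded J_def, folded W_def]
    note tr = trace_inverse_congruence[OF P(1,4) p Za innov_cov_mat_transpose P(2,3) Zb innov_cov_mat_transpose
        conjunct2[OF elim(2)] z filter_change_mat_carrier[of a b n] filter_change_mat_trace[OF elim(5)], folded J_def, folded W_def]
    have k2: "frobenius ?K \<le> 2 * k" by (rule elim(4))
    have d1: "(\<Sum>i<n. \<Sum>j<n. \<bar>(?Zb - ?Za) $$ (i, j)\<bar>) \<le> 9 * D" and d2: "frobenius (?Zb - ?Za) \<le> 3 * D"
      using elim(3) by simp_all
    have "p * (\<Sum>i<n. \<Sum>j<n. \<bar>(?Zb - ?Za) $$ (i, j)\<bar>) + 2 * p * frobenius ?K * frobenius (?Zb - ?Za) + p * z * (frobenius ?K)\<^sup>2 \<le> A"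
      unfolding A_def
      by (intro add_mono mult_mono power_mono d1 d2 k2 order_refl mult_nonneg_nonneg p z k frobenius_nonneg) (simp_all add: k p D sum_nonneg)
    then have t1: "\<bar>mat_trace W - real n\<bar> \<le> A" using tr(1) by linarith
    have t2: "\<bar>mat_trace (W * W)\<bar> \<le> B * real n"
    proof -
      have n1: "1 \<le> sqrt (real n)" using elim(5) by simp
      then have "frobenius ?K \<le> 2 * k * sqrt (real n)"
        using k2 k mult_left_mono[OF n1, of "2 * k"] by linarith
      then have s: "sqrt (real n) + frobenius ?K \<le> (1 + 2 * k) * sqrt (real n)" by (simp add: distrib_right)
      have "\<bar>mat_trace (W * W)\<bar> \<le> (p * ((1 + frobenius ?K) * (z * (sqrt (real n) + frobenius ?K))))\<^sup>2" by (rule tr(2))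
      also have "\<dots> \<le> (p * ((1 + 2 * k) * (z * ((1 + 2 * k) * sqrt (real n)))))\<^sup>2"
        by (intro power_mono mult_mono add_mono order_refl k2 s mult_nonneg_nonneg p z frobenius_nonneg add_nonneg_nonneg) (simp_all add: k)
      also have "\<dots> = B * (sqrt (real n))\<^sup>2" by (simp add: B_def power_mult_distrib mult_ac)
      finally show ?thesis by simp
    qed
    have "\<bar>mat_trace (inv_mat (corr_mat a n) * corr_mat b n) - b ^ 3 / a ^ 3 * real n\<bar> = r * \<bar>mat_trace W - real n\<bar>"
      unfolding inv(4) r_def[symmetric] right_diff_distrib[symmetric] abs_mult using r by simp
    also have "\<dots> \<le> r * A" by (rule mult_left_mono[OF t1 r])
    finally have c4: "\<bar>mat_trace (inv_mat (corr_mat a n) * corr_mat b n) - b ^ 3 / a ^ 3 * real n\<bar> \<le> r * A" .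
    have "\<bar>mat_trace ((inv_mat (corr_mat a n) * corr_mat b n) * (inv_mat (corr_mat a n) * corr_mat b n))\<bar> = r\<^sup>2 * \<bar>mat_trace (W * W)\<bar>"
      unfolding inv(5) r_def[symmetric] abs_mult by simp
    also have "\<dots> \<le> r\<^sup>2 * (B * real n)" by (rule mult_left_mono[OF t2]) simp
    finally show ?case using inv(1-3) c4 by (simp only: mult.assoc simp_thms)
  qed
  then show ?thesis by (rule that)
qed

section \<open>Mean, variance and consistency of the estimator\<close>

text \<open>
  Where \<open>g (Y n)\<close> is far from \<open>g c\<close>, continuity puts \<open>Y n\<close> away from \<open>c\<close> and so, for large \<open>n\<close>, away from its
  mean; Chebyshev's inequality bounds the probability of that.
\<close>
lemma (in prob_space) tendsto_in_prob_continuous_image: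
  fixes Y :: "nat \<Rightarrow> 'a \<Rightarrow> real"
  assumes Y: "eventually (\<lambda>n. random_variable borel (Y n) \<and> integrable M (\<lambda>\<omega>. (Y n \<omega>)\<^sup>2)) sequentially"
    and mean: "((\<lambda>n. expectation (Y n)) \<longlongrightarrow> c) sequentially"
    and var: "((\<lambda>n. variance (Y n)) \<longlongrightarrow> 0) sequentially"
    and g: "isCont g c"
  shows "tendsto_in_prob M (\<lambda>n \<omega>. g (Y n \<omega>)) (g c)"
  unfolding tendsto_in_prob_def
proof (intro allI impI)
  fix \<epsilon> :: real assume "0 < \<epsilon>"
  then obtain \<delta> where \<delta>: "0 < \<delta>" "\<And>y. \<bar>y - c\<bar> < \<delta> \<Longrightarrow> \<bar>g y - g c\<bar> < \<epsilon>"
    using g unfolding continuous_at_eps_delta dist_real_def by blast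
  have lim: "((\<lambda>n. variance (Y n) / (\<delta> / 2)\<^sup>2) \<longlongrightarrow> 0) sequentially"
    using tendsto_divide[OF var tendsto_const, of "(\<delta> / 2)\<^sup>2"] \<delta>(1) by simp
  have "eventually (\<lambda>n. dist (expectation (Y n)) c < \<delta> / 2) sequentially"
    using tendstoD[OF mean, of "\<delta> / 2"] \<delta>(1) by simp
  with Y have "eventually (\<lambda>n. prob {\<omega> \<in> space M. \<epsilon> < \<bar>g (Y n \<omega>) - g c\<bar>} \<le> variance (Y n) / (\<delta> / 2)\<^sup>2) sequentially"
  proof eventually_elim
    case (elim n)
    then have rv [measurable]: "random_variable borel (Y n)" and sq: "integrable M (\<lambda>\<omega>. (Y n \<omega>)\<^sup>2)" by auto
    have "prob {\<omega> \<in> space M. \<epsilon> < \<bar>g (Y n \<omega>) - g c\<bar>} \<le> prob {\<omega> \<in> space M. \<delta> / 2 \<le> \<bar>Y n \<omega> - expectation (Y n)\<bar>}"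
    proof (rule finite_measure_mono)
      show "{\<omega> \<in> space M. \<epsilon> < \<bar>g (Y n \<omega>) - g c\<bar>} \<subseteq> {\<omega> \<in> space M. \<delta> / 2 \<le> \<bar>Y n \<omega> - expectation (Y n)\<bar>}"
      proof safe
        fix \<omega> assume "\<epsilon> < \<bar>g (Y n \<omega>) - g c\<bar>"
        then have "\<not> \<bar>Y n \<omega> - c\<bar> < \<delta>" using \<delta>(2)[of "Y n \<omega>"] by linarith
        then show "\<delta> / 2 \<le> \<bar>Y n \<omega> - expectation (Y n)\<bar>"
          using elim(2) unfolding dist_real_def by linarith
      qed
      show "{\<omega> \<in> space M. \<delta> / 2 \<le> \<bar>Y n \<omega> - expectation (Y n)\<bar>} \<in> events" by measurable
    qed
    also have "\<dots> \<le> variance (Y n) / (\<delta> / 2)\<^sup>2"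
      by (rule Chebyshev_inequality[OF rv sq]) (use \<delta>(1) in simp)
    finally show ?case .
  qed
  then show "((\<lambda>n. prob {\<omega> \<in> space M. \<epsilon> < \<bar>g (Y n \<omega>) - g c\<bar>}) \<longlongrightarrow> 0) sequentially"
    by (rule tendsto_sandwich[OF _ _ tendsto_const lim, rotated]) simp
qed

text \<open>
  The identity \<open>x y - 1 = (x - 1) (y - 1) + (x - 1) + (y - 1)\<close> makes the induction work without a separate
  bound for the partial products.
\<close>
lemma prod_bigo_inverse_nat:
  fixes F :: "nat \<Rightarrow> nat \<Rightarrow> real"
  assumes "finite T" "\<And>t. t \<in> T \<Longrightarrow> (\<lambda>n. F t n - 1) \<in> O(\<lambda>n. 1 / real n)"
  shows "(\<lambda>n. (\<Prod>t\<in>T. F t n) - 1) \<in> O(\<lambda>n. 1 / real n)"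
  using assms
proof (induction T)
  case (insert s T)
  have s: "(\<lambda>n. F s n - 1) \<in> O(\<lambda>n. 1 / real n)" and T: "(\<lambda>n. (\<Prod>t\<in>T. F t n) - 1) \<in> O(\<lambda>n. 1 / real n)"
    using insert by auto
  have "(\<lambda>n. (F s n - 1) * ((\<Prod>t\<in>T. F t n) - 1)) \<in> O(\<lambda>n. 1 / real n * (1 / real n))"
    by (rule landau_o.big.mult[OF s T])
  moreover have "(\<lambda>n. 1 / real n * (1 / real n)) \<in> O(\<lambda>n. 1 / real n)"
    by (rule bigoI[of _ 1], rule eventually_mono[OF eventually_gt_at_top[of 0]]) (simp add: divide_le_eq)
  ultimately have "(\<lambda>n. (F s n - 1) * ((\<Prod>t\<in>T. F t n) - 1)) \<in> O(\<lambda>n. 1 / real n)"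
    by (rule landau_o.big.trans)
  then have "(\<lambda>n. (F s n - 1) * ((\<Prod>t\<in>T. F t n) - 1) + (F s n - 1) + ((\<Prod>t\<in>T. F t n) - 1)) \<in> O(\<lambda>n. 1 / real n)"
    by (intro sum_in_bigo s T)
  moreover have "(x - 1) * (y - 1) + (x - 1) + (y - 1) = x * y - 1" for x y :: real
    by (simp add: algebra_simps)
  ultimately have "(\<lambda>n. F s n * (\<Prod>t\<in>T. F t n) - 1) \<in> O(\<lambda>n. 1 / real n)" by (simp only:)
  then show ?case using insert(1,2) by simp
qed simp

lemma quad_stat_moments:
  fixes M :: "'a measure" and \<theta> \<theta>' :: "nat \<Rightarrow> real"
  assumes prob: "prob_space M"
    and X: "multivariate_normal M X (n ^ d) (0\<^sub>v (n ^ d)) (cov_mat d \<phi> \<theta> n)"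
    and inv: "\<And>t. t \<in> {1..d} \<Longrightarrow> inv_mat (corr_mat (\<theta>' t) n) \<in> carrier_mat n n
      \<and> corr_mat (\<theta>' t) n * inv_mat (corr_mat (\<theta>' t) n) = 1\<^sub>m n
      \<and> inv_mat (corr_mat (\<theta>' t) n) * corr_mat (\<theta>' t) n = 1\<^sub>m n"
  defines "c \<equiv> pi ^ d * \<phi> ^ d / (2 ^ d * (\<Prod>t=1..d. \<theta> t ^ 3))"
    and "R \<equiv> \<lambda>t. inv_mat (corr_mat (\<theta>' t) n) * corr_mat (\<theta> t) n"
    and "Y \<equiv> \<lambda>\<omega>. quad_stat d \<theta>' n (X \<omega>)"
  shows "Y \<in> borel_measurable M" "integrable M (\<lambda>\<omega>. (Y \<omega>)\<^sup>2)"
    and "prob_space.expectation M Y = c * (\<Prod>t=1..d. mat_trace (R t))"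
    and "prob_space.variance M Y = 2 * c\<^sup>2 * (\<Prod>t=1..d. mat_trace (R t * R t))"
proof -
  interpret gaussian_vector M X "n ^ d" "cov_mat d \<phi> \<theta> n"
    using prob X by (simp add: gaussian_vector_def gaussian_vector_axioms_def)
  define P where "P t = inv_mat (corr_mat (\<theta>' t) n)" for t
  have P: "P t \<in> carrier_mat n n" "corr_mat (\<theta>' t) n * P t = 1\<^sub>m n" "P t * corr_mat (\<theta>' t) n = 1\<^sub>m n"
    "(P t)\<^sup>T = P t" if "t \<in> {1..d}" for t
    using inv[OF that] inverse_transpose[OF mat_carriers(1)[of "\<theta>' t" n] corr_mat_transpose, of "P t"]
    by (simp_all add: P_def)
  define Q where "Q = kron_upto P d"
  define S where "S = kron_upto (\<lambda>t. corr_mat (\<theta> t) n) d"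
  have Q: "Q \<in> carrier_mat (n ^ d) (n ^ d)" unfolding Q_def by (rule dim_kron_upto) (rule P)
  have S: "S \<in> carrier_mat (n ^ d) (n ^ d)" unfolding S_def by (rule dim_kron_upto) (rule mat_carriers)
  have QT: "Q\<^sup>T = Q"
    unfolding Q_def by (subst kron_upto_transpose[of d P n]) (auto intro!: kron_upto_cong simp: P)
  have "inv_mat (corr_kron d \<theta>' n) = Q"
    unfolding corr_kron_def Q_def by (rule inv_mat_kron_upto[where n = n]) (simp_all add: P)
  then have Y: "Y = (\<lambda>\<omega>. X \<omega> \<bullet> (Q *\<^sub>v X \<omega>))" by (simp add: Y_def quad_stat_def)
  have R: "R t \<in> carrier_mat n n" if "t \<in> {1..d}" for t
    using P(1)[OF that] unfolding R_def P_def[symmetric] by (rule mult_carrier_mat) simp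
  have cov: "cov_mat d \<phi> \<theta> n = c \<cdot>\<^sub>m S" by (simp add: cov_mat_def corr_kron_def c_def S_def)
  have "Q * S = kron_upto (\<lambda>t. P t * corr_mat (\<theta> t) n) d"
    unfolding Q_def S_def by (rule kron_upto_mult[where n = n]) (simp_all add: P)
  then have QS: "Q * S = kron_upto R d" by (simp add: R_def P_def)
  have QSc: "Q * S \<in> carrier_mat (n ^ d) (n ^ d)" by (rule mult_carrier_mat[OF Q S])
  have Qcov: "Q * cov_mat d \<phi> \<theta> n = c \<cdot>\<^sub>m (Q * S)" unfolding cov by (rule mult_smult_distrib[OF Q S])
  have "(c \<cdot>\<^sub>m (Q * S)) * (c \<cdot>\<^sub>m (Q * S)) = c\<^sup>2 \<cdot>\<^sub>m ((Q * S) * (Q * S))"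
    using QSc by (simp only: mult_smult_distrib[of "c \<cdot>\<^sub>m (Q * S)" "n ^ d" "n ^ d" "Q * S" "n ^ d"]
        mult_smult_assoc_mat[of "Q * S" "n ^ d" "n ^ d" "Q * S" "n ^ d"] smult_carrier_mat smult_smult_mat power2_eq_square)
  moreover have "(Q * S) * (Q * S) = kron_upto (\<lambda>t. R t * R t) d"
    unfolding QS by (rule kron_upto_mult[where n = n]) (simp_all add: R)
  moreover have "mat_trace (kron_upto (\<lambda>t. R t * R t) d) = (\<Prod>t=1..d. mat_trace (R t * R t))"
    by (rule mat_trace_kron_upto[where n = n]) (rule mult_carrier_mat[OF R R])
  ultimately have tr2: "mat_trace ((Q * cov_mat d \<phi> \<theta> n) * (Q * cov_mat d \<phi> \<theta> n)) = c\<^sup>2 * (\<Prod>t=1..d. mat_trace (R t * R t))"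
    unfolding Qcov using mat_trace_smult[OF mult_carrier_mat[OF QSc QSc]] by simp
  have "mat_trace (kron_upto R d) = (\<Prod>t=1..d. mat_trace (R t))"
    by (rule mat_trace_kron_upto[where n = n]) (rule R)
  then have tr1: "mat_trace (Q * cov_mat d \<phi> \<theta> n) = c * (\<Prod>t=1..d. mat_trace (R t))"
    unfolding Qcov using mat_trace_smult[OF QSc] QS by simp
  note m = quadratic_form_expectation_variance[OF Q QT]
  show "Y \<in> borel_measurable M" "integrable M (\<lambda>\<omega>. (Y \<omega>)\<^sup>2)" unfolding Y by (rule m(1), rule m(2))
  show "expectation Y = c * (\<Prod>t=1..d. mat_trace (R t))" unfolding Y using m(3) tr1 by (rule trans)
  show "variance Y = 2 * c\<^sup>2 * (\<Prod>t=1..d. mat_trace (R t * R t))"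
    unfolding Y m(4) tr2 by simp
qed

theorem theorem9:
  fixes M :: "'a measure"
    and X :: "nat \<Rightarrow> 'a \<Rightarrow> real Matrix.vec"
    and d :: nat
    and \<phi> :: real
    and \<theta> \<theta>' \<beta>\<^sub>0 \<beta>\<^sub>1 :: "nat \<Rightarrow> real"
  assumes "prob_space M"
    and "d \<ge> 1"
    and "\<And>t. t \<in> {0..d} \<Longrightarrow> 0 < \<beta>\<^sub>0 t \<and> \<beta>\<^sub>0 t < \<beta>\<^sub>1 t"
    and "\<beta>\<^sub>0 0 < \<phi>" and "\<phi> < \<beta>\<^sub>1 0"
    and "\<And>t. t \<in> {1..d} \<Longrightarrow> \<beta>\<^sub>0 t < \<theta> t \<and> \<theta> t < \<beta>\<^sub>1 t"
    and "\<And>t. t \<in> {1..d} \<Longrightarrow> \<beta>\<^sub>0 t < \<theta>' t \<and> \<theta>' t < \<beta>\<^sub>1 t"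
    and "\<And>n. n \<ge> 1 \<Longrightarrow> multivariate_normal M (X n) (n ^ d) (0\<^sub>v (n ^ d)) (cov_mat d \<phi> \<theta> n)"
  shows "(\<lambda>n. quad_coeff d \<theta>' n * prob_space.expectation M (\<lambda>\<omega>. quad_stat d \<theta>' n (X n \<omega>)) - \<phi> ^ d)
           \<in> O(\<lambda>n. 1 / real n)
       \<and> (\<lambda>n. prob_space.variance M (\<lambda>\<omega>. quad_coeff d \<theta>' n * quad_stat d \<theta>' n (X n \<omega>)))
           \<in> O(\<lambda>n. 1 / real n ^ d)
       \<and> tendsto_in_prob M (\<lambda>n \<omega>. phi_hat d \<theta>' n (X n \<omega>)) \<phi>"
proof -
  interpret prob_space M by fact
  have pos: "0 < \<theta> t" "0 < \<theta>' t" if "t \<in> {1..d}" for t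
    using assms(3)[of t] assms(6,7)[OF that] that by force+
  have \<phi>: "0 < \<phi>" using assms(3)[of 0] assms(4) by force
  define R where "R t n = inv_mat (corr_mat (\<theta>' t) n) * corr_mat (\<theta> t) n" for t n
  define c where "c = pi ^ d * \<phi> ^ d / (2 ^ d * (\<Prod>t=1..d. \<theta> t ^ 3))"
  define q where "q = 2 ^ d * (\<Prod>t=1..d. \<theta>' t ^ 3) / pi ^ d"
  define Y where "Y n \<omega> = quad_stat d \<theta>' n (X n \<omega>)" for n \<omega>
  have coeff: "quad_coeff d \<theta>' n = q / real n ^ d" for n by (simp add: quad_coeff_def q_def)
  define good where "good t A B n \<longleftrightarrow> inv_mat (corr_mat (\<theta>' t) n) \<in> carrier_mat n n
      \<and> corr_mat (\<theta>' t) n * inv_mat (corr_mat (\<theta>' t) n) = 1\<^sub>m n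
      \<and> inv_mat (corr_mat (\<theta>' t) n) * corr_mat (\<theta>' t) n = 1\<^sub>m n
      \<and> \<bar>mat_trace (R t n) - \<theta> t ^ 3 / \<theta>' t ^ 3 * real n\<bar> \<le> A
      \<and> \<bar>mat_trace (R t n * R t n)\<bar> \<le> B * real n" for t A B n
  have "\<exists>AB. eventually (good t (fst AB) (snd AB)) sequentially" if t: "t \<in> {1..d}" for t
  proof (rule corr_mat_trace_bounds[OF pos(2,1)[OF t]])
    fix A B
    assume "eventually (\<lambda>n. inv_mat (corr_mat (\<theta>' t) n) \<in> carrier_mat n n
      \<and> corr_mat (\<theta>' t) n * inv_mat (corr_mat (\<theta>' t) n) = 1\<^sub>m n
      \<and> inv_mat (corr_mat (\<theta>' t) n) * corr_mat (\<theta>' t) n = 1\<^sub>m n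
      \<and> \<bar>mat_trace (inv_mat (corr_mat (\<theta>' t) n) * corr_mat (\<theta> t) n) - \<theta> t ^ 3 / \<theta>' t ^ 3 * real n\<bar> \<le> A
      \<and> \<bar>mat_trace ((inv_mat (corr_mat (\<theta>' t) n) * corr_mat (\<theta> t) n) * (inv_mat (corr_mat (\<theta>' t) n) * corr_mat (\<theta> t) n))\<bar>
        \<le> B * real n) sequentially"
    \<comment> \<open>Pairs, so that a single choice over \<open>t\<close> yields both families of constants.\<close>
    then have "eventually (good t (fst (A, B)) (snd (A, B))) sequentially"
      unfolding good_def R_def fst_conv snd_conv .
    then show ?thesis by (rule exI)
  qed
  then have "\<forall>t\<in>{1..d}. \<exists>AB. eventually (good t (fst AB) (snd AB)) sequentially" by (intro ballI)
  from bchoice[OF this] obtain f where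
    f: "\<forall>t\<in>{1..d}. eventually (good t (fst (f t)) (snd (f t))) sequentially" by (rule exE)
  define A B where "A t = fst (f t)" and "B t = snd (f t)" for t
  have good: "eventually (good t (A t) (B t)) sequentially" if "t \<in> {1..d}" for t
    using bspec[OF f that] by (simp only: A_def B_def)
  have "eventually (\<lambda>n. \<forall>t\<in>{1..d}. good t (A t) (B t) n) sequentially"
    by (rule eventually_ball_finite) (simp_all add: good)
  then have moments: "eventually (\<lambda>n. 0 < n \<and> Y n \<in> borel_measurable M \<and> integrable M (\<lambda>\<omega>. (Y n \<omega>)\<^sup>2)
      \<and> expectation (Y n) = c * (\<Prod>t=1..d. mat_trace (R t n))
      \<and> variance (Y n) = 2 * c\<^sup>2 * (\<Prod>t=1..d. mat_trace (R t n * R t n))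
      \<and> (\<forall>t\<in>{1..d}. \<bar>mat_trace (R t n * R t n)\<bar> \<le> B t * real n)) sequentially"
    using eventually_gt_at_top[of 0]
  proof eventually_elim
    case (elim n)
    have X: "multivariate_normal M (X n) (n ^ d) (0\<^sub>v (n ^ d)) (cov_mat d \<phi> \<theta> n)"
      using assms(8)[of n] elim(2) by simp
    have inv: "inv_mat (corr_mat (\<theta>' t) n) \<in> carrier_mat n n
      \<and> corr_mat (\<theta>' t) n * inv_mat (corr_mat (\<theta>' t) n) = 1\<^sub>m n
      \<and> inv_mat (corr_mat (\<theta>' t) n) * corr_mat (\<theta>' t) n = 1\<^sub>m n" if "t \<in> {1..d}" for t
      using bspec[OF elim(1) that] by (simp only: good_def simp_thms)
    have B: "\<forall>t\<in>{1..d}. \<bar>mat_trace (R t n * R t n)\<bar> \<le> B t * real n"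
    proof
      fix t assume "t \<in> {1..d}"
      from bspec[OF elim(1) this] show "\<bar>mat_trace (R t n * R t n)\<bar> \<le> B t * real n"
        by (simp only: good_def)
    qed
    note m = quad_stat_moments[where \<theta>' = \<theta>', OF assms(1) X inv, folded c_def R_def Y_def]
    show ?case by (intro conjI elim(2) m B)
  qed
  have mean: "(\<lambda>n. quad_coeff d \<theta>' n * expectation (Y n) - \<phi> ^ d) \<in> O(\<lambda>n. 1 / real n)"
  proof -
    define F where "F t n = \<theta>' t ^ 3 / \<theta> t ^ 3 * mat_trace (R t n) / real n" for t n
    have "(\<lambda>n. F t n - 1) \<in> O(\<lambda>n. 1 / real n)" if t: "t \<in> {1..d}" for t
    proof -
      define r where "r = \<theta>' t ^ 3 / \<theta> t ^ 3"
      have r: "0 < r" "r * (\<theta> t ^ 3 / \<theta>' t ^ 3) = 1" using pos[OF t] by (simp_all add: r_def)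
      show ?thesis
      proof (rule bigoI[of _ "r * A t"], use good[OF t] eventually_gt_at_top[of 0] in eventually_elim)
        case (elim n)
        have "F t n - 1 = r * (mat_trace (R t n) - \<theta> t ^ 3 / \<theta>' t ^ 3 * real n) / real n"
          unfolding F_def r_def[symmetric] right_diff_distrib mult.assoc[symmetric] r(2)
          using elim(2) by (simp add: diff_divide_distrib)
        then have "\<bar>F t n - 1\<bar> = r * \<bar>mat_trace (R t n) - \<theta> t ^ 3 / \<theta>' t ^ 3 * real n\<bar> / real n"
          using r(1) by (simp add: abs_mult)
        also have "\<dots> \<le> r * A t / real n"
          using elim(1) r(1) by (intro divide_right_mono mult_left_mono) (simp_all add: good_def)
        finally show ?case by simp
      qed
    qed
    then have "(\<lambda>n. (\<Prod>t=1..d. F t n) - 1) \<in> O(\<lambda>n. 1 / real n)"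
      by (intro prod_bigo_inverse_nat) auto
    then have big: "(\<lambda>n. \<phi> ^ d * ((\<Prod>t=1..d. F t n) - 1)) \<in> O(\<lambda>n. 1 / real n)"
      by (rule landau_o.big.cmult_in_iff[THEN iffD2, rotated]) (use \<phi> in simp)
    have "eventually (\<lambda>n. quad_coeff d \<theta>' n * expectation (Y n) - \<phi> ^ d = \<phi> ^ d * ((\<Prod>t=1..d. F t n) - 1)) sequentially"
      using moments
    proof eventually_elim
      case (elim n)
      have nz: "(\<Prod>t=1..d. \<theta> t ^ 3) \<noteq> 0" using pos(1) by fastforce
      have F: "(\<Prod>t=1..d. F t n) = (\<Prod>t=1..d. \<theta>' t ^ 3) / (\<Prod>t=1..d. \<theta> t ^ 3) * (\<Prod>t=1..d. mat_trace (R t n)) / real n ^ d"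
        by (simp add: F_def prod.distrib prod_dividef)
      have e: "expectation (Y n) = c * (\<Prod>t=1..d. mat_trace (R t n))" using elim by blast
      have "quad_coeff d \<theta>' n * expectation (Y n) = \<phi> ^ d * (\<Prod>t=1..d. F t n)"
        unfolding e F quad_coeff_def c_def using nz by (simp add: mult_ac)
      then show ?case by (simp add: right_diff_distrib)
    qed
    then show ?thesis using big by (simp only: landau_o.big.in_cong)
  qed
  have var_scale: "variance (\<lambda>\<omega>. quad_coeff d \<theta>' n * Y n \<omega>) = (quad_coeff d \<theta>' n)\<^sup>2 * variance (Y n)" for n
  proof -
    have "variance (\<lambda>\<omega>. quad_coeff d \<theta>' n * Y n \<omega>) = expectation (\<lambda>\<omega>. (quad_coeff d \<theta>' n)\<^sup>2 * (Y n \<omega> - expectation (Y n))\<^sup>2)"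
    proof (rule Bochner_Integration.integral_cong[OF refl])
      fix \<omega>
      have "quad_coeff d \<theta>' n * Y n \<omega> - expectation (\<lambda>\<omega>. quad_coeff d \<theta>' n * Y n \<omega>)
          = quad_coeff d \<theta>' n * (Y n \<omega> - expectation (Y n))"
        by (simp add: right_diff_distrib)
      then show "(quad_coeff d \<theta>' n * Y n \<omega> - expectation (\<lambda>\<omega>. quad_coeff d \<theta>' n * Y n \<omega>))\<^sup>2
          = (quad_coeff d \<theta>' n)\<^sup>2 * (Y n \<omega> - expectation (Y n))\<^sup>2"
        by (simp only: power_mult_distrib)
    qed
    then show ?thesis by simp
  qed
  have var: "(\<lambda>n. variance (\<lambda>\<omega>. quad_coeff d \<theta>' n * Y n \<omega>)) \<in> O(\<lambda>n. 1 / real n ^ d)"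
  proof (rule bigoI[of _ "q\<^sup>2 * (2 * c\<^sup>2 * (\<Prod>t=1..d. B t))"], use moments in eventually_elim)
    case (elim n)
    have v: "variance (Y n) = 2 * c\<^sup>2 * (\<Prod>t=1..d. mat_trace (R t n * R t n))" using elim by blast
    have n: "0 < real n ^ d" using elim by simp
    have "\<bar>\<Prod>t=1..d. mat_trace (R t n * R t n)\<bar> \<le> (\<Prod>t=1..d. B t * real n)"
      unfolding abs_prod using elim by (intro prod_mono) auto
    also have "\<dots> = (\<Prod>t=1..d. B t) * real n ^ d" by (simp add: prod.distrib)
    finally have p: "\<bar>\<Prod>t=1..d. mat_trace (R t n * R t n)\<bar> \<le> (\<Prod>t=1..d. B t) * real n ^ d" .
    have "variance (\<lambda>\<omega>. quad_coeff d \<theta>' n * Y n \<omega>) = (q / real n ^ d)\<^sup>2 * (2 * c\<^sup>2 * (\<Prod>t=1..d. mat_trace (R t n * R t n)))"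
      using var_scale[of n] by (simp only: v coeff)
    then have "\<bar>variance (\<lambda>\<omega>. quad_coeff d \<theta>' n * Y n \<omega>)\<bar> = (q / real n ^ d)\<^sup>2 * (2 * c\<^sup>2 * \<bar>\<Prod>t=1..d. mat_trace (R t n * R t n)\<bar>)"
      by (simp only: abs_mult abs_power2 abs_numeral)
    also have "\<dots> \<le> (q / real n ^ d)\<^sup>2 * (2 * c\<^sup>2 * ((\<Prod>t=1..d. B t) * real n ^ d))"
      by (intro mult_left_mono p) simp_all
    also have "\<dots> = q\<^sup>2 * (2 * c\<^sup>2 * (\<Prod>t=1..d. B t)) * (1 / real n ^ d)"
      using n by (simp add: power_divide power2_eq_square)
    finally show ?case by simp
  qed
  have "tendsto_in_prob M (\<lambda>n \<omega>. root d (quad_coeff d \<theta>' n * Y n \<omega>)) (root d (\<phi> ^ d))"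
  proof (rule tendsto_in_prob_continuous_image[where Y = "\<lambda>n \<omega>. quad_coeff d \<theta>' n * Y n \<omega>" and g = "root d" and c = "\<phi> ^ d"])
    show "eventually (\<lambda>n. (\<lambda>\<omega>. quad_coeff d \<theta>' n * Y n \<omega>) \<in> borel_measurable M
        \<and> integrable M (\<lambda>\<omega>. (quad_coeff d \<theta>' n * Y n \<omega>)\<^sup>2)) sequentially"
      using moments
    proof eventually_elim
      case (elim n)
      then have m: "Y n \<in> borel_measurable M" "integrable M (\<lambda>\<omega>. (Y n \<omega>)\<^sup>2)" by blast+
      show ?case
        unfolding power_mult_distrib
        by (intro conjI borel_measurable_times borel_measurable_const m(1) integrable_mult_right m(2))
    qed
    show "((\<lambda>n. expectation (\<lambda>\<omega>. quad_coeff d \<theta>' n * Y n \<omega>)) \<longlongrightarrow> \<phi> ^ d) sequentially"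
      using bigo_inverse_nat_tendsto[OF mean] by simp
    show "((\<lambda>n. variance (\<lambda>\<omega>. quad_coeff d \<theta>' n * Y n \<omega>)) \<longlongrightarrow> 0) sequentially"
    proof (rule bigo_inverse_nat_tendsto)
      have "(\<lambda>n. 1 / real n ^ d) \<in> O(\<lambda>n. 1 / real n)"
      proof (rule bigoI[of _ 1], rule eventually_mono[OF eventually_gt_at_top[of 0]])
        fix n :: nat assume n: "0 < n"
        then have "real n ^ 1 \<le> real n ^ d" using assms(2) by (intro power_increasing) auto
        then show "norm (1 / real n ^ d) \<le> 1 * norm (1 / real n)" using n by (simp add: frac_le)
      qed
      with var show "(\<lambda>n. variance (\<lambda>\<omega>. quad_coeff d \<theta>' n * Y n \<omega>) - 0) \<in> O(\<lambda>n. 1 / real n)"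
        unfolding diff_zero by (rule landau_o.big.trans)
    qed
    show "isCont (root d) (\<phi> ^ d)" by (rule isCont_real_root)
  qed
  moreover have "root d (\<phi> ^ d) = \<phi>" using assms(2) \<phi> by (simp add: real_root_power_cancel)
  ultimately have "tendsto_in_prob M (\<lambda>n \<omega>. phi_hat d \<theta>' n (X n \<omega>)) \<phi>"
    unfolding phi_hat_def Y_def by simp
  then show ?thesis using mean var unfolding Y_def by blast
qed

end
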